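(* Let $k\in\mathbb Z$, $m\in\mathbb Z_{\ge0}$, and let $\varphi=\sum_{n\ge0,\,l\in\mathbb Z} f(n,l)q^n\zeta^l\in J^{w}_{2k,m}$. If $f(n,l)\in\mathbb Z$ for all $0\le n\le [\frac{m+k}{6}]$ and all $l\in\mathbb Z$, then $f(n,l)\in\mathbb Z$ for all $n,l$. Here $[x]$ denotes the integral part of $x$.
   Context: $q=e^{2\pi i\tau}$, $\zeta=e^{2\pi i z}$ with $\tau\in\mathbb H$, $z\in\mathbb C$. For $k\in\mathbb Z$, $m\in\mathbb Z_{\ge0}$, $J^w_{k,m}$ is the space of weak Jacobi forms of weight $k$ and index $m$: holomorphic $\phi:\mathbb H\times\mathbb C\to\mathbb C$ with $\phi\big(\frac{a\tau+b}{c\tau+d},\frac{z}{c\tau+d}\big)=(c\tau+d)^k e^{2\pi i m\frac{cz^2}{c\tau+d}}\phi(\tau,z)$ for all $\begin{pmatrix}a&b\\c&d\end{pmatrix}\in\mathrm{SL}_2(\mathbb Z)$, $\phi(\tau,z+x\tau+y)=e^{-2\pi i m(x^2\tau+2xz)}\phi(\tau,z)$ for all $x,y\in\mathbb Z$, and having a Fourier expansion $\sum_{n\ge0,\,l\in\mathbb Z}f(n,l)q^n\zeta^l$. *)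

theory Defs
  imports "HOL-Analysis.Analysis"
begin

definition upper_half_plane :: "complex set" where
  "upper_half_plane = {\<tau>. Im \<tau> > 0}"

text \<open>Holomorphy in two variables: at each point the function has a Frechet derivative that is
  complex linear, i.e. of the form \<open>(u, v) \<mapsto> a u + b v\<close>.\<close>

definition holomorphic2_on :: "(complex \<times> complex \<Rightarrow> complex) \<Rightarrow> (complex \<times> complex) set \<Rightarrow> bool" where
  "holomorphic2_on F S \<longleftrightarrow>
     (\<forall>p\<in>S. \<exists>a b. (F has_derivative (\<lambda>(u, v). a * u + b * v)) (at p within S))"

text \<open>The sum over all pairs \<open>(n, l)\<close> is unconditional; a Fourier expansion of a holomorphic function
  on \<open>\<H> \<times> \<complex>\<close> converges absolutely, so this is no restriction.\<close>

definition jacobi_fourier_expansion ::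
    "(complex \<Rightarrow> complex \<Rightarrow> complex) \<Rightarrow> (nat \<Rightarrow> int \<Rightarrow> complex) \<Rightarrow> bool" where
  "jacobi_fourier_expansion \<phi> f \<longleftrightarrow>
     (\<forall>\<tau>\<in>upper_half_plane. \<forall>z.
        ((\<lambda>(n, l). f n l * exp (2 * pi * \<i> * \<tau>) ^ n * exp (2 * pi * \<i> * z) powi l)
           has_sum \<phi> \<tau> z) UNIV)"

text \<open>Values of \<open>\<phi>\<close> at first arguments outside the upper half-plane are irrelevant.\<close>

definition weak_jacobi_form :: "int \<Rightarrow> nat \<Rightarrow> (complex \<Rightarrow> complex \<Rightarrow> complex) \<Rightarrow> bool" where
  "weak_jacobi_form k m \<phi> \<longleftrightarrow>
     holomorphic2_on (\<lambda>(\<tau>, z). \<phi> \<tau> z) (upper_half_plane \<times> UNIV) \<and>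
     (\<forall>a b c d :: int. a * d - b * c = 1 \<longrightarrow>
        (\<forall>\<tau>\<in>upper_half_plane. \<forall>z.
           \<phi> ((of_int a * \<tau> + of_int b) / (of_int c * \<tau> + of_int d)) (z / (of_int c * \<tau> + of_int d)) =
             (of_int c * \<tau> + of_int d) powi k
             * exp (2 * pi * \<i> * of_nat m * (of_int c * z\<^sup>2 / (of_int c * \<tau> + of_int d)))
             * \<phi> \<tau> z)) \<and>
     (\<forall>x y :: int. \<forall>\<tau>\<in>upper_half_plane. \<forall>z.
        \<phi> \<tau> (z + of_int x * \<tau> + of_int y) =
          exp (- 2 * pi * \<i> * of_nat m * ((of_int x)\<^sup>2 * \<tau> + 2 * of_int x * z)) * \<phi> \<tau> z) \<and>
     (\<exists>f. jacobi_fourier_expansion \<phi> f)"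

end

theory Submission
  imports Defs "HOL-Complex_Analysis.Complex_Analysis"
begin

text \<open>Write \<open>q = e(\<tau>)\<close>, \<open>\<zeta> = e(z)\<close> and \<open>s = \<zeta> - 2 + 1 / \<zeta>\<close>. By Liouville's theorem for elliptic functions, a
  form of even weight \<open>2 k\<close> and index \<open>m\<close> is \<open>\<phi>\<^sub>-\<^sub>2\<^sub>,\<^sub>1 ^ m * Q(\<wp>)\<close> with a polynomial \<open>Q\<close> of degree at
  most \<open>m\<close> over the ring of level one modular forms. With \<open>\<wp>\<close> divided by \<open>(2 \<pi> i)\<^sup>2\<close> and \<open>X = \<wp> - 1 / 12
  = 1 / s + O(s)\<close>, both \<open>\<phi>\<^sub>-\<^sub>2\<^sub>,\<^sub>1\<close> and \<open>\<phi>\<^sub>-\<^sub>2\<^sub>,\<^sub>1 X\<close> are power series in \<open>q\<close> and \<open>s\<close> over the integers,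
  so integrality of the form up to \<open>q ^ N\<close> is integrality of \<open>Q(X + 1 / 12)\<close> up to \<open>q ^ N\<close>.

  The polynomial statement follows by induction on \<open>m\<close>. The leading coefficient of \<open>Q\<close> is a modular form
  of weight \<open>2 k\<close>, integral by Sturm's bound; subtracting an integral polynomial with the same leading
  coefficient passes to weight \<open>2 k + 2\<close> and index \<open>m - 1\<close>, which has the same bound \<open>(k + m) / 6\<close>. A
  leading coefficient \<open>E\<^sub>4 g\<close> or \<open>E\<^sub>6 g\<close> always occurs. A multiple \<open>b \<Delta> ^ c\<close> occurs iff \<open>12\<close> divides \<open>m
  b\<close>, and this divisibility is read off the next coefficient of \<open>Q(X + 1 / 12)\<close>, since the modular forms
  of weight \<open>12 c + 2\<close> have a basis of integral forms with leading terms \<open>q ^ i\<close>, \<open>i < c\<close>.\<close>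

section \<open>Power series in the nome with integral coefficients\<close>

text \<open>The obstacle is the shift by 1/12: the coefficients of \<open>Q\<close> are modular, but
  integrality is visible on those of \<open>shift_poly Q\<close>, and an integral modular form
  \<open>g\<close> need not lead an integral form, because \<open>g * wp ^ m\<close> acquires
  denominators. Where \<open>g\<close> does lead one, the lower coefficients are Eisenstein series
  chosen so that setting all of them to 1 leaves a polynomial in \<open>X\<close> over the integers.
  Below a constant leading coefficient no such correction exists, as there is no modular form of
  weight 2; this is the source of the divisibility condition. The variable \<open>s\<close> is used
  because an even function of \<open>z\<close> is near 0 a function of \<open>s\<close>. In this
  variable \<open>phi21\<close> is \<open>s\<close> times a unit and \<open>phi21 * wp0\<close> is a
  unit, so the coefficients of the polynomial are peeled off one at a time without leaving the
  integers. Infinite products and sums inherit integrality from their partial products and sums,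
  since Taylor coefficients converge and the integers are closed.\<close>

definition disc_fps :: "complex fps \<Rightarrow> bool" where
  "disc_fps F \<longleftrightarrow> 1 \<le> fps_conv_radius F"

text \<open>The bound is an extended real so that one predicate covers a rational cutoff such as (k
  + m) / 6, the vacuous case of a negative cutoff, and, with \<infinity>, integrality of all
  coefficients.\<close>

definition int_upto :: "ereal \<Rightarrow> complex fps \<Rightarrow> bool" where
  "int_upto N F \<longleftrightarrow> (\<forall>n. ereal (real n) \<le> N \<longrightarrow> fps_nth F n \<in> \<int>)"

lemma disc_fpsD: "disc_fps F \<Longrightarrow> norm z < 1 \<Longrightarrow> ereal (norm z) < fps_conv_radius F"
  unfolding disc_fps_def by (metis ereal_less(3) less_le_trans one_ereal_def)

lemma disc_fps_pos: "disc_fps F \<Longrightarrow> fps_conv_radius F > 0"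
  using disc_fpsD[of F 0] by (simp add: zero_ereal_def)

lemma disc_fps_const [simp, intro]: "disc_fps (fps_const c)"
  and disc_fps_0 [simp, intro]: "disc_fps 0"
  and disc_fps_1 [simp, intro]: "disc_fps 1"
  and disc_fps_numeral [simp, intro]: "disc_fps (numeral n)"
  and disc_fps_X [simp, intro]: "disc_fps fps_X"
  by (auto simp: disc_fps_def)

lemma disc_fps_add [intro]: "disc_fps F \<Longrightarrow> disc_fps G \<Longrightarrow> disc_fps (F + G)"
  unfolding disc_fps_def by (rule order_trans[OF _ fps_conv_radius_add]) simp

lemma disc_fps_diff [intro]: "disc_fps F \<Longrightarrow> disc_fps G \<Longrightarrow> disc_fps (F - G)"
  unfolding disc_fps_def by (rule order_trans[OF _ fps_conv_radius_diff]) simp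

lemma disc_fps_uminus [intro]: "disc_fps F \<Longrightarrow> disc_fps (- F)"
  unfolding disc_fps_def by simp

lemma disc_fps_mult [intro]: "disc_fps F \<Longrightarrow> disc_fps G \<Longrightarrow> disc_fps (F * G)"
  unfolding disc_fps_def by (rule order_trans[OF _ fps_conv_radius_mult]) simp

lemma disc_fps_power [intro]: "disc_fps F \<Longrightarrow> disc_fps (F ^ n)"
  by (induction n) auto

lemma disc_fps_sum [intro]: "(\<And>i. i \<in> I \<Longrightarrow> disc_fps (F i)) \<Longrightarrow> disc_fps (\<Sum>i\<in>I. F i)"
  by (induction I rule: infinite_finite_induct) auto

lemma disc_fps_prod [intro]: "(\<And>i. i \<in> I \<Longrightarrow> disc_fps (F i)) \<Longrightarrow> disc_fps (\<Prod>i\<in>I. F i)"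
  by (induction I rule: infinite_finite_induct) auto

lemma ev_add: "disc_fps F \<Longrightarrow> disc_fps G \<Longrightarrow> norm q < 1 \<Longrightarrow> eval_fps (F + G) q = eval_fps F q + eval_fps G q"
  by (intro eval_fps_add disc_fpsD)

lemma ev_diff: "disc_fps F \<Longrightarrow> disc_fps G \<Longrightarrow> norm q < 1 \<Longrightarrow> eval_fps (F - G) q = eval_fps F q - eval_fps G q"
  by (intro eval_fps_diff disc_fpsD)

lemma ev_uminus: "disc_fps F \<Longrightarrow> norm q < 1 \<Longrightarrow> eval_fps (- F) q = - eval_fps F q"
  by (intro eval_fps_minus disc_fpsD)

lemma ev_mult: "disc_fps F \<Longrightarrow> disc_fps G \<Longrightarrow> norm q < 1 \<Longrightarrow> eval_fps (F * G) q = eval_fps F q * eval_fps G q"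
  by (intro eval_fps_mult disc_fpsD)

lemma ev_power: "disc_fps F \<Longrightarrow> norm q < 1 \<Longrightarrow> eval_fps (F ^ n) q = eval_fps F q ^ n"
  by (induction n) (auto simp: ev_mult disc_fps_power)

lemma ev_sum: "(\<And>i. i \<in> I \<Longrightarrow> disc_fps (F i)) \<Longrightarrow> norm q < 1 \<Longrightarrow>
    eval_fps (\<Sum>i\<in>I. F i) q = (\<Sum>i\<in>I. eval_fps (F i) q)"
  by (induction I rule: infinite_finite_induct) (auto simp: ev_add disc_fps_sum)

lemma ev_prod: "(\<And>i. i \<in> I \<Longrightarrow> disc_fps (F i)) \<Longrightarrow> norm q < 1 \<Longrightarrow>
    eval_fps (\<Prod>i\<in>I. F i) q = (\<Prod>i\<in>I. eval_fps (F i) q)"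
  by (induction I rule: infinite_finite_induct) (auto simp: ev_mult disc_fps_prod)

lemmas ev_simps = ev_add ev_diff ev_uminus ev_mult ev_power

lemma holomorphic_ev: "disc_fps F \<Longrightarrow> A \<subseteq> ball 0 1 \<Longrightarrow> eval_fps F holomorphic_on A"
  by (rule holomorphic_on_subset[OF holomorphic_on_eval_fps[OF subset_refl]])
     (auto simp: disc_fpsD)

text \<open>Identities come from points \<tau> of the upper half-plane, and \<open>ee \<tau>\<close>
  is never 0. Continuity supplies the missing value before the coefficients are compared.\<close>

lemma disc_fps_eqI:
  assumes "disc_fps F" "disc_fps G" "\<And>q. norm q < 1 \<Longrightarrow> q \<noteq> 0 \<Longrightarrow> eval_fps F q = eval_fps G q"
  shows "F = G"
proof -
  let ?H = "F - G"
  have H: "disc_fps ?H" using assms by auto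
  have z: "eval_fps ?H q = 0" if "norm q < 1" "q \<noteq> 0" for q
    using assms that by (simp add: ev_diff)
  have "continuous_on (ball 0 1) (eval_fps ?H)"
    using holomorphic_ev[OF H] holomorphic_on_imp_continuous_on by blast
  hence "isCont (eval_fps ?H) 0"
    by (simp add: continuous_on_eq_continuous_at)
  hence "(eval_fps ?H \<longlongrightarrow> eval_fps ?H 0) (at 0)" by (simp add: isCont_def)
  moreover have "eventually (\<lambda>q. eval_fps ?H q = 0) (at (0::complex))"
    unfolding eventually_at by (intro exI[of _ 1]) (auto simp: z dist_norm)
  hence "(eval_fps ?H \<longlongrightarrow> 0) (at 0)" by (rule tendsto_eventually)
  ultimately have "eval_fps ?H 0 = 0" using LIM_unique by blast
  hence "eval_fps ?H q = 0" if "norm q < 1" for q using z that by (cases "q = 0") auto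
  hence "eventually (\<lambda>q. eval_fps ?H q = eval_fps 0 q) (nhds (0::complex))"
    unfolding eventually_nhds_metric by (intro exI[of _ 1]) (auto simp: dist_norm)
  hence "?H = 0" by (intro eval_fps_eqD disc_fps_pos H) auto
  thus ?thesis by simp
qed

lemma disc_fps_of_holomorphic:
  assumes "g holomorphic_on ball 0 1"
  shows "disc_fps (fps_expansion g 0)" "norm q < 1 \<Longrightarrow> eval_fps (fps_expansion g 0) q = g q"
proof -
  have "g holomorphic_on eball 0 (ereal 1)" using assms by simp
  thus "disc_fps (fps_expansion g 0)"
    unfolding disc_fps_def by (metis conv_radius_fps_expansion one_ereal_def)
  show "norm q < 1 \<Longrightarrow> eval_fps (fps_expansion g 0) q = g q"
    using \<open>g holomorphic_on eball 0 (ereal 1)\<close> using eval_fps_expansion'[of g 0 "ereal 1" q] by simp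
qed

lemma int_upto_const: "c \<in> \<int> \<Longrightarrow> int_upto N (fps_const c)"
  by (auto simp: int_upto_def)

lemma int_upto_0 [simp, intro]: "int_upto N 0"
  and int_upto_1 [simp, intro]: "int_upto N 1"
  and int_upto_X [simp, intro]: "int_upto N fps_X"
  by (auto simp: int_upto_def fps_X_def)

lemma int_upto_numeral [simp, intro]: "int_upto N (numeral k)"
  unfolding numeral_fps_const by (rule int_upto_const) simp

lemma int_upto_add [intro]: "int_upto N F \<Longrightarrow> int_upto N G \<Longrightarrow> int_upto N (F + G)"
  and int_upto_diff [intro]: "int_upto N F \<Longrightarrow> int_upto N G \<Longrightarrow> int_upto N (F - G)"
  and int_upto_uminus [intro]: "int_upto N F \<Longrightarrow> int_upto N (- F)"
  by (auto simp: int_upto_def)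

lemma int_upto_mult [intro]:
  assumes "int_upto N F" "int_upto N G" shows "int_upto N (F * G)"
  unfolding int_upto_def
proof (intro allI impI)
  fix n assume n: "ereal (real n) \<le> N"
  have "fps_nth F i \<in> \<int>" "fps_nth G (n - i) \<in> \<int>" if "i \<in> {0..n}" for i
    using assms that n unfolding int_upto_def
    by (meson atLeastAtMost_iff diff_le_self ereal_less_eq(3) of_nat_le_iff order_trans)+
  thus "fps_nth (F * G) n \<in> \<int>"
    unfolding fps_mult_nth by (intro Ints_sum Ints_mult) auto
qed

lemma int_upto_power [intro]: "int_upto N F \<Longrightarrow> int_upto N (F ^ n)"
  by (induction n) auto

lemma int_upto_sum [intro]: "(\<And>i. i \<in> I \<Longrightarrow> int_upto N (F i)) \<Longrightarrow> int_upto N (\<Sum>i\<in>I. F i)"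
  by (induction I rule: infinite_finite_induct) auto

lemma int_upto_prod [intro]: "(\<And>i. i \<in> I \<Longrightarrow> int_upto N (F i)) \<Longrightarrow> int_upto N (\<Prod>i\<in>I. F i)"
  by (induction I rule: infinite_finite_induct) auto

lemma int_upto_mono: "int_upto N F \<Longrightarrow> M \<le> N \<Longrightarrow> int_upto M F"
  by (auto simp: int_upto_def)

lemma fps_nth_right_inverse:
  fixes F :: "'a :: comm_ring_1 fps"
  assumes "F * G = 1" "fps_nth F 0 = 1"
  shows "fps_nth G 0 = 1" "n > 0 \<Longrightarrow> fps_nth G n = - (\<Sum>i=1..n. fps_nth F i * fps_nth G (n - i))"
proof -
  show "fps_nth G 0 = 1"
    using arg_cong[OF assms(1), of "\<lambda>H. fps_nth H 0"] assms(2) by simp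
  assume n: "n > 0"
  have "(\<Sum>i=0..n. fps_nth F i * fps_nth G (n - i)) = 0"
    using arg_cong[OF assms(1), of "\<lambda>H. fps_nth H n"] n by (simp add: fps_mult_nth)
  also have "(\<Sum>i=0..n. fps_nth F i * fps_nth G (n - i)) =
      fps_nth F 0 * fps_nth G n + (\<Sum>i=1..n. fps_nth F i * fps_nth G (n - i))"
    by (subst sum.atLeast_Suc_atMost) auto
  finally show "fps_nth G n = - (\<Sum>i=1..n. fps_nth F i * fps_nth G (n - i))"
    using assms(2) by (simp add: add_eq_0_iff2)
qed

text \<open>The recursion for the inverse divides only by the constant term 1, and the coefficient
  of index n uses indices up to n only, so a cutoff is respected.\<close>

lemma int_upto_inverse:
  assumes "F * G = 1" "fps_nth F 0 = 1" "int_upto N F"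
  shows "int_upto N G"
  unfolding int_upto_def
proof (intro allI impI)
  fix n assume "ereal (real n) \<le> N"
  thus "fps_nth G n \<in> \<int>"
  proof (induction n rule: less_induct)
    case (less n)
    show ?case
    proof (cases "n = 0")
      case True thus ?thesis using fps_nth_right_inverse(1)[OF assms(1,2)] by simp
    next
      case False
      have le: "ereal (real i) \<le> N" if "i \<le> n" for i
        using less.prems that by (meson ereal_less_eq(3) of_nat_le_iff order_trans)
      have "fps_nth F i * fps_nth G (n - i) \<in> \<int>" if "i \<in> {1..n}" for i
        using that assms(3) le[of i] le[of "n - i"] less.IH[of "n - i"]
        by (auto simp: int_upto_def intro!: Ints_mult)
      thus ?thesis
        using False fps_nth_right_inverse(2)[OF assms(1,2), of n] by (auto intro!: Ints_sum Ints_minus simp del: One_nat_def)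
    qed
  qed
qed

text \<open>The absence of zeros makes the reciprocal holomorphic on the whole disc, which gives the
  radius of convergence that the purely formal inverse does not reveal.\<close>

lemma disc_fps_inverse:
  assumes "disc_fps F" "\<And>q. norm q < 1 \<Longrightarrow> eval_fps F q \<noteq> 0"
  obtains G where "disc_fps G" "F * G = 1" "\<And>q. norm q < 1 \<Longrightarrow> eval_fps G q = inverse (eval_fps F q)"
proof -
  have h: "(\<lambda>q. inverse (eval_fps F q)) holomorphic_on ball 0 1"
    by (intro holomorphic_intros holomorphic_ev assms) (auto simp: assms)
  define G where "G = fps_expansion (\<lambda>q. inverse (eval_fps F q)) 0"
  have G: "disc_fps G" "\<And>q. norm q < 1 \<Longrightarrow> eval_fps G q = inverse (eval_fps F q)"
    unfolding G_def using disc_fps_of_holomorphic[OF h] by auto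
  have "F * G = 1"
    by (rule disc_fps_eqI) (use assms G in \<open>auto simp: ev_mult\<close>)
  thus ?thesis using that G by blast
qed

text \<open>Locally uniform convergence makes every Taylor coefficient at 0 converge, and a limit of
  integers is an integer.\<close>

lemma disc_fps_limit:
  assumes d: "\<And>M. disc_fps (F M)" and i: "\<And>M. int_upto N (F M)"
    and lim: "\<And>r. 0 < r \<Longrightarrow> r < 1 \<Longrightarrow> uniform_limit (cball 0 r) (\<lambda>M q. eval_fps (F M) q) g sequentially"
  obtains G where "disc_fps G" "int_upto N G" "\<And>q. norm q < 1 \<Longrightarrow> eval_fps G q = g q"
proof -
  have h: "g holomorphic_on ball 0 1"
  proof (rule holomorphic_uniform_sequence)
    show "eval_fps (F M) holomorphic_on ball 0 1" for M by (intro holomorphic_ev d subset_refl)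
    fix x :: complex assume x: "x \<in> ball 0 1"
    define e where "e = (1 - norm x) / 2"
    have e: "e > 0" "norm x + e < 1" using x by (auto simp: e_def field_simps)
    have sub: "cball x e \<subseteq> cball 0 (norm x + e)"
      by (metis cball_subset_cball_iff add.commute dist_0_norm dist_commute order_refl)
    show "\<exists>d>0. cball x d \<subseteq> ball 0 1 \<and> uniform_limit (cball x d) (\<lambda>n. eval_fps (F n)) g sequentially"
    proof (intro exI conjI)
      show "e > 0" by fact
      show "cball x e \<subseteq> ball 0 1" using sub e by (auto simp: subset_iff)
      show "uniform_limit (cball x e) (\<lambda>n. eval_fps (F n)) g sequentially"
        by (rule uniform_limit_on_subset[OF lim sub]) (use e norm_ge_zero[of x] in linarith)+
    qed
  qed auto
  define G where "G = fps_expansion g 0"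
  have G: "disc_fps G" "\<And>q. norm q < 1 \<Longrightarrow> eval_fps G q = g q"
    unfolding G_def using disc_fps_of_holomorphic[OF h] by auto
  have ul: "uniform_limit (ball 0 (1/2)) (\<lambda>M. eval_fps (F M)) g sequentially"
    by (rule uniform_limit_on_subset[OF lim[of "1/2"]]) auto
  have "fps_nth G n \<in> \<int>" if n: "ereal (real n) \<le> N" for n
  proof -
    have "(\<lambda>M. (deriv ^^ n) (eval_fps (F M)) 0) \<longlonglongrightarrow> (deriv ^^ n) g 0"
      by (rule higher_deriv_complex_uniform_limit[OF ul])
         (auto intro!: always_eventually holomorphic_ev d)
    hence "(\<lambda>M. (deriv ^^ n) (eval_fps (F M)) 0 / fact n) \<longlonglongrightarrow> (deriv ^^ n) g 0 / fact n"
      by (intro tendsto_intros) auto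
    moreover have "(deriv ^^ n) (eval_fps (F M)) 0 / fact n = fps_nth (F M) n" for M
      by (rule fps_nth_conv_deriv[symmetric]) (rule disc_fps_pos[OF d])
    moreover have "(deriv ^^ n) g 0 / fact n = fps_nth G n"
      by (simp add: G_def fps_expansion_def)
    ultimately have "(\<lambda>M. fps_nth (F M) n) \<longlonglongrightarrow> fps_nth G n" by simp
    moreover have "\<forall>M. fps_nth (F M) n \<in> \<int>" using i n by (auto simp: int_upto_def)
    ultimately show ?thesis
      using closed_sequentially[OF closed_Ints, of "\<lambda>M. fps_nth (F M) n"] by blast
  qed
  thus ?thesis using that G by (auto simp: int_upto_def)
qed

section \<open>Power series in \<open>s\<close> whose coefficients are power series in
  \<open>q\<close>\<close>

definition eval_q :: "complex \<Rightarrow> complex fps fps \<Rightarrow> complex fps" where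
  "eval_q q A = Abs_fps (\<lambda>i. eval_fps (fps_nth A i) q)"

definition disc_fps2 :: "complex fps fps \<Rightarrow> bool" where
  "disc_fps2 A \<longleftrightarrow> (\<forall>i. disc_fps (fps_nth A i))"

definition int_upto2 :: "ereal \<Rightarrow> complex fps fps \<Rightarrow> bool" where
  "int_upto2 N A \<longleftrightarrow> (\<forall>i. int_upto N (fps_nth A i))"

lemma disc_fps2_intros [intro]:
  "disc_fps2 0" "disc_fps2 1" "disc_fps2 fps_X"
  "disc_fps2 A \<Longrightarrow> disc_fps2 B \<Longrightarrow> disc_fps2 (A + B)"
  "disc_fps2 A \<Longrightarrow> disc_fps2 B \<Longrightarrow> disc_fps2 (A - B)"
  "disc_fps2 A \<Longrightarrow> disc_fps2 B \<Longrightarrow> disc_fps2 (A * B)"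
  "disc_fps F \<Longrightarrow> disc_fps2 (fps_const F)"
  by (auto simp: disc_fps2_def fps_mult_nth fps_X_def)

lemma disc_fps2_power [intro]: "disc_fps2 A \<Longrightarrow> disc_fps2 (A ^ n)"
  by (induction n) auto

lemma int_upto2_intros [intro]:
  "int_upto2 N 0" "int_upto2 N 1" "int_upto2 N fps_X"
  "int_upto2 N A \<Longrightarrow> int_upto2 N B \<Longrightarrow> int_upto2 N (A + B)"
  "int_upto2 N A \<Longrightarrow> int_upto2 N B \<Longrightarrow> int_upto2 N (A - B)"
  "int_upto2 N A \<Longrightarrow> int_upto2 N B \<Longrightarrow> int_upto2 N (A * B)"
  "int_upto N F \<Longrightarrow> int_upto2 N (fps_const F)"
  by (auto simp: int_upto2_def fps_mult_nth fps_X_def)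

lemma int_upto2_numeral [intro]: "int_upto2 N (numeral n)"
  unfolding numeral_fps_const[of n, where ?'a = "complex fps"] by (rule int_upto2_intros) (rule int_upto_numeral)

lemma int_upto2_power [intro]: "int_upto2 N A \<Longrightarrow> int_upto2 N (A ^ n)"
  by (induction n) auto

lemma int_upto2_sum [intro]: "(\<And>i. i \<in> I \<Longrightarrow> int_upto2 N (A i)) \<Longrightarrow> int_upto2 N (\<Sum>i\<in>I. A i)"
  by (induction I rule: infinite_finite_induct) auto

lemma eval_q_nth [simp]: "fps_nth (eval_q q A) i = eval_fps (fps_nth A i) q"
  by (simp add: eval_q_def)

lemma eval_q_0 [simp]: "eval_q q 0 = 0" and eval_q_1 [simp]: "eval_q q 1 = 1" and eval_q_X [simp]: "eval_q q fps_X = fps_X"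
  and eval_q_const [simp]: "eval_q q (fps_const F) = fps_const (eval_fps F q)"
  by (auto intro!: fps_ext simp: fps_X_def)

lemma eval_q_add: "disc_fps2 A \<Longrightarrow> disc_fps2 B \<Longrightarrow> norm q < 1 \<Longrightarrow> eval_q q (A + B) = eval_q q A + eval_q q B"
  and eval_q_diff: "disc_fps2 A \<Longrightarrow> disc_fps2 B \<Longrightarrow> norm q < 1 \<Longrightarrow> eval_q q (A - B) = eval_q q A - eval_q q B"
  by (auto intro!: fps_ext simp: disc_fps2_def ev_simps)

lemma eval_q_mult: "disc_fps2 A \<Longrightarrow> disc_fps2 B \<Longrightarrow> norm q < 1 \<Longrightarrow> eval_q q (A * B) = eval_q q A * eval_q q B"
  by (intro fps_ext) (auto simp: disc_fps2_def fps_mult_nth ev_simps ev_sum disc_fps_mult)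

text \<open>A two-variable power series, as a power series in \<open>s\<close> whose coefficients are power series in \<open>q\<close>: the
  function \<open>F q\<close> is only controlled near \<open>s = 0\<close>, in a neighbourhood depending on \<open>q\<close>.\<close>

definition sq_expansion :: "(complex \<Rightarrow> complex \<Rightarrow> complex) \<Rightarrow> complex fps fps \<Rightarrow> bool" where
  "sq_expansion F A \<longleftrightarrow> disc_fps2 A \<and> (\<forall>q. norm q < 1 \<longrightarrow> F q has_fps_expansion eval_q q A)"

lemma sq_expansion_const: "disc_fps F \<Longrightarrow> sq_expansion (\<lambda>q s. eval_fps F q) (fps_const F)"
  by (auto simp: sq_expansion_def)

lemma sq_expansion_0: "sq_expansion (\<lambda>q s. 0) 0" and sq_expansion_1: "sq_expansion (\<lambda>q s. 1) 1"
  and sq_expansion_X: "sq_expansion (\<lambda>q s. s) fps_X"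
  by (auto simp: sq_expansion_def intro!: has_fps_expansion_fps_X)

lemma sq_expansion_add: "sq_expansion F A \<Longrightarrow> sq_expansion G B \<Longrightarrow> sq_expansion (\<lambda>q s. F q s + G q s) (A + B)"
  and sq_expansion_diff: "sq_expansion F A \<Longrightarrow> sq_expansion G B \<Longrightarrow> sq_expansion (\<lambda>q s. F q s - G q s) (A - B)"
  and sq_expansion_mult: "sq_expansion F A \<Longrightarrow> sq_expansion G B \<Longrightarrow> sq_expansion (\<lambda>q s. F q s * G q s) (A * B)"
  by (auto simp: sq_expansion_def eval_q_add eval_q_diff eval_q_mult intro!: fps_expansion_intros)

lemma sq_expansion_power: "sq_expansion F A \<Longrightarrow> sq_expansion (\<lambda>q s. F q s ^ n) (A ^ n)"
  by (induction n) (auto intro!: sq_expansion_mult sq_expansion_1)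

lemma sq_expansion_sum: "(\<And>i. i \<in> I \<Longrightarrow> sq_expansion (F i) (A i)) \<Longrightarrow> sq_expansion (\<lambda>q s. \<Sum>i\<in>I. F i q s) (\<Sum>i\<in>I. A i)"
  by (induction I rule: infinite_finite_induct) (auto intro!: sq_expansion_add sq_expansion_0)

lemma sq_expansion_prod: "(\<And>i. i \<in> I \<Longrightarrow> sq_expansion (F i) (A i)) \<Longrightarrow> sq_expansion (\<lambda>q s. \<Prod>i\<in>I. F i q s) (\<Prod>i\<in>I. A i)"
  by (induction I rule: infinite_finite_induct) (auto intro!: sq_expansion_mult sq_expansion_1)

lemma int_upto2_prod [intro]: "(\<And>i. i \<in> I \<Longrightarrow> int_upto2 N (A i)) \<Longrightarrow> int_upto2 N (\<Prod>i\<in>I. A i)"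
  by (induction I rule: infinite_finite_induct) auto

text \<open>With constant term 1 the recursion uses only sums and products of coefficients, so
  convergence in \<open>q\<close> and integrality both survive.\<close>

lemma fps2_inverse_ex:
  assumes "fps_nth A 0 = 1" "disc_fps2 A"
  obtains B where "A * B = 1" "disc_fps2 B" "int_upto2 N A \<Longrightarrow> int_upto2 N B"
proof -
  define B where "B = fps_right_inverse A (1 :: complex fps)"
  have AB: "A * B = 1"
    unfolding B_def by (rule fps_right_inverse) (use assms in auto)
  note B0 = fps_nth_right_inverse(1)[OF AB assms(1)] and rec = fps_nth_right_inverse(2)[OF AB assms(1)]
  have "disc_fps (fps_nth B n)" for n
  proof (induction n rule: less_induct)
    case (less n)
    show ?case
      by (cases "n = 0") (use less assms in \<open>auto simp: B0 rec disc_fps2_def intro!: disc_fps_sum disc_fps_mult\<close>)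
  qed
  moreover have "int_upto N (fps_nth B n)" if "int_upto2 N A" for n
  proof (induction n rule: less_induct)
    case (less n)
    show ?case
      by (cases "n = 0") (use less that in \<open>auto simp: B0 rec int_upto2_def intro!: int_upto_sum int_upto_mult\<close>)
  qed
  ultimately show ?thesis using that AB by (auto simp: disc_fps2_def int_upto2_def)
qed

lemma sq_expansion_inverse:
  assumes "sq_expansion F A" "A * B = 1" "disc_fps2 B"
  shows "sq_expansion (\<lambda>q s. inverse (F q s)) B"
  unfolding sq_expansion_def
proof (intro conjI allI impI)
  fix q :: complex assume q: "norm q < 1"
  have A: "disc_fps2 A" "F q has_fps_expansion eval_q q A" using assms(1) q by (auto simp: sq_expansion_def)
  have 1: "eval_q q A * eval_q q B = 1"
    using eval_q_mult[OF A(1) assms(3) q] assms(2) by simp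
  hence 0: "fps_nth (eval_q q A) 0 \<noteq> 0"
    by (metis fps_mult_nth_0 fps_one_nth mult_zero_left zero_neq_one)
  have "eval_q q B = inverse (eval_q q A)"
    using 1 by (simp add: fps_inverse_unique)
  thus "(\<lambda>s. inverse (F q s)) has_fps_expansion eval_q q B"
    using has_fps_expansion_inverse[OF A(2) 0] by simp
qed fact

text \<open>Cauchy's inequality on a circle in \<open>s\<close> turns convergence that is uniform in
  both variables into convergence of each coefficient that is uniform in \<open>q\<close>, and
  \<open>disc_fps_limit\<close> then applies to each coefficient. The radius \<open>e\<close> may
  depend on \<open>r\<close>.\<close>

lemma sq_expansion_limit:
  assumes F: "\<And>M. sq_expansion (F M) (A M)" and int: "\<And>M. int_upto2 N (A M)"
    and lim: "\<And>r. 0 < r \<Longrightarrow> r < 1 \<Longrightarrow> \<exists>e>0. (\<forall>M. \<forall>q\<in>cball 0 r. F M q holomorphic_on ball 0 e) \<and>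
        uniform_limit (cball 0 r \<times> ball 0 e) (\<lambda>M (q, s). F M q s) (\<lambda>(q, s). G q s) sequentially"
  obtains B where "sq_expansion G B" "int_upto2 N B"
proof -
  define c where "c = (\<lambda>i q. (deriv ^^ i) (G q) 0 / fact i)"
  have coeff: "eval_fps (fps_nth (A M) i) q = (deriv ^^ i) (F M q) 0 / fact i" if "norm q < 1" for M i q
    using fps_nth_fps_expansion[of "F M q" "eval_q q (A M)" i] F[of M] that by (auto simp: sq_expansion_def)
  have main: "\<exists>e>0. (\<forall>q\<in>cball 0 r. G q holomorphic_on ball 0 e) \<and>
      (\<forall>i. uniform_limit (cball 0 r) (\<lambda>M q. eval_fps (fps_nth (A M) i) q) (c i) sequentially)"
    if r: "0 < r" "r < 1" for r
  proof -
    obtain e where e: "e > 0" "\<And>M q. q \<in> cball 0 r \<Longrightarrow> F M q holomorphic_on ball 0 e"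
      and ul: "uniform_limit (cball 0 r \<times> ball 0 e) (\<lambda>M (q, s). F M q s) (\<lambda>(q, s). G q s) sequentially"
      using lim[OF r] by blast
    have ulq: "uniform_limit (ball 0 e) (\<lambda>M. F M q) (G q) sequentially" if q: "q \<in> cball 0 r" for q
      unfolding uniform_limit_iff
    proof (intro allI impI)
      fix d :: real assume "d > 0"
      from uniform_limitD[OF ul this] show "\<forall>\<^sub>F n in sequentially. \<forall>x\<in>ball 0 e. dist (F n q x) (G q x) < d"
        by eventually_elim (use q in auto)
    qed
    have hol: "G q holomorphic_on ball 0 e" if q: "q \<in> cball 0 r" for q
    proof (rule holomorphic_uniform_sequence)
      show "F M q holomorphic_on ball 0 e" for M using e q by auto
      fix x :: complex assume "x \<in> ball 0 e"
      then obtain d where "d > 0" "cball x d \<subseteq> ball 0 e"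
        using open_contains_cball by (metis open_ball)
      thus "\<exists>d>0. cball x d \<subseteq> ball 0 e \<and> uniform_limit (cball x d) (\<lambda>M. F M q) (G q) sequentially"
        using uniform_limit_on_subset[OF ulq[OF q]] by blast
    qed auto
    have "uniform_limit (cball 0 r) (\<lambda>M q. eval_fps (fps_nth (A M) i) q) (c i) sequentially" for i
      unfolding uniform_limit_iff
    proof (intro allI impI)
      fix d :: real assume d: "d > 0"
      \<comment> \<open>Chosen so that Cauchy's inequality on the circle of radius
        \<open>e / 2\<close> returns \<open>d / 2\<close> after division by
        \<open>fact i\<close>.\<close>
      define d' where "d' = d / 2 * (e / 2) ^ i"
      have d': "d' > 0" using d e by (auto simp: d'_def)
      from uniform_limitD[OF ul d']
      show "\<forall>\<^sub>F M in sequentially. \<forall>q\<in>cball 0 r. dist (eval_fps (fps_nth (A M) i) q) (c i q) < d"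
      proof eventually_elim
        case (elim M)
        show ?case
        proof
          fix q :: complex assume q: "q \<in> cball 0 r"
          have q1: "norm q < 1" using q r by auto
          have hd: "(\<lambda>s. F M q s - G q s) holomorphic_on ball 0 e"
            by (intro holomorphic_intros hol q e)
          have "norm ((deriv ^^ i) (\<lambda>s. F M q s - G q s) 0) \<le> fact i * d' / (e / 2) ^ i"
          proof (rule Cauchy_inequality)
            show "(\<lambda>s. F M q s - G q s) holomorphic_on ball 0 (e/2)"
              by (rule holomorphic_on_subset[OF hd]) (use e in auto)
            show "continuous_on (cball 0 (e/2)) (\<lambda>s. F M q s - G q s)"
              by (rule holomorphic_on_imp_continuous_on, rule holomorphic_on_subset[OF hd]) (use e in auto)
            fix x :: complex assume "norm (0 - x) = e / 2"
            hence "x \<in> ball 0 e" using e by auto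
            thus "norm (F M q x - G q x) \<le> d'" using elim q by (force simp: dist_norm)
          qed (use e in auto)
          also have "(deriv ^^ i) (\<lambda>s. F M q s - G q s) 0 = (deriv ^^ i) (F M q) 0 - (deriv ^^ i) (G q) 0"
            by (rule higher_deriv_diff[OF e(2)[OF q] hol[OF q]]) (use e in auto)
          also have "fact i * d' / (e / 2) ^ i = fact i * (d / 2)" using e by (simp add: d'_def)
          finally have *: "norm ((deriv ^^ i) (F M q) 0 - (deriv ^^ i) (G q) 0) \<le> fact i * (d / 2)" .
          have "dist (eval_fps (fps_nth (A M) i) q) (c i q) = norm ((deriv ^^ i) (F M q) 0 - (deriv ^^ i) (G q) 0) / fact i"
            unfolding coeff[OF q1] c_def dist_norm
            by (simp add: diff_divide_distrib[symmetric] norm_divide)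
          also have "\<dots> \<le> d / 2" using * by (simp add: field_simps)
          also have "\<dots> < d" using d by simp
          finally show "dist (eval_fps (fps_nth (A M) i) q) (c i q) < d" .
        qed
      qed
    qed
    thus ?thesis using e(1) hol by blast
  qed
  have "\<exists>B. disc_fps B \<and> int_upto N B \<and> (\<forall>q. norm q < 1 \<longrightarrow> eval_fps B q = c i q)" for i
  proof -
    have 1: "disc_fps (fps_nth (A M) i)" for M using F by (auto simp: sq_expansion_def disc_fps2_def)
    have 2: "int_upto N (fps_nth (A M) i)" for M using int by (auto simp: int_upto2_def)
    have 3: "uniform_limit (cball 0 r) (\<lambda>M. eval_fps (fps_nth (A M) i)) (c i) sequentially"
      if "0 < r" "r < 1" for r using main[OF that] by blast
    show ?thesis
      by (rule disc_fps_limit[of "\<lambda>M. fps_nth (A M) i" N "c i", OF 1 2 3]) blast+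
  qed
  then obtain B where B: "\<And>i. disc_fps (B i)" "\<And>i. int_upto N (B i)"
    "\<And>i q. norm q < 1 \<Longrightarrow> eval_fps (B i) q = c i q" by metis
  have "sq_expansion G (Abs_fps B)"
    unfolding sq_expansion_def
  proof (intro conjI allI impI)
    show "disc_fps2 (Abs_fps B)" using B by (auto simp: disc_fps2_def)
    fix q :: complex assume q: "norm q < 1"
    define r where "r = (1 + norm q) / 2"
    have r: "0 < r" "r < 1" "norm q \<le> r" using q by (auto simp: r_def intro: add_pos_nonneg)
    obtain e where "e > 0" "G q holomorphic_on ball 0 e"
      using main[OF r(1,2)] r(3) by auto
    hence "G q has_fps_expansion fps_expansion (G q) 0"
      by (intro has_fps_expansion_fps_expansion[of "ball 0 e"]) auto
    moreover have "fps_expansion (G q) 0 = eval_q q (Abs_fps B)"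
      by (rule fps_ext) (simp add: fps_expansion_def B q c_def)
    ultimately show "G q has_fps_expansion eval_q q (Abs_fps B)" by simp
  qed
  moreover have "int_upto2 N (Abs_fps B)" using B by (auto simp: int_upto2_def)
  ultimately show ?thesis using that by blast
qed

section \<open>The theta product and the tail of the Weierstrass function\<close>

text \<open>For \<open>s = w - 2 + 1 / w\<close>, the factor \<open>1 - s * lam n q\<close> is \<open>(1 - q ^ Suc n * w) * (1 - q ^ Suc n / w) / (1
  - q ^ Suc n)\<^sup>2\<close>, and \<open>s * wp_term n q s\<close> collects the terms with \<open>q ^ Suc n * w\<close>, \<open>q ^ Suc n / w\<close> and
  \<open>q ^ Suc n\<close> of the \<open>q\<close>-expansion of the Weierstrass function.\<close>

definition lam :: "nat \<Rightarrow> complex \<Rightarrow> complex" where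
  "lam n q = q ^ Suc n / (1 - q ^ Suc n)\<^sup>2"

definition theta_prod :: "complex \<Rightarrow> complex \<Rightarrow> complex" where
  "theta_prod q s = (\<Prod>n. 1 - s * lam n q)"

definition wp_term :: "nat \<Rightarrow> complex \<Rightarrow> complex \<Rightarrow> complex" where
  "wp_term n q s = lam n q * (1 + 6 * lam n q - 2 * s * lam n q ^ 2) / (1 - s * lam n q)\<^sup>2"

definition wp_tail :: "complex \<Rightarrow> complex \<Rightarrow> complex" where
  "wp_tail q s = (\<Sum>n. wp_term n q s)"

lemma power_Suc_neq_1: "norm q < 1 \<Longrightarrow> q ^ Suc n \<noteq> (1::complex)"
proof
  assume "norm q < 1" "q ^ Suc n = 1"
  hence "norm q ^ Suc n = 1" by (metis norm_one norm_power)
  moreover have "norm q ^ Suc n \<le> norm q"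
    using mult_left_mono[OF power_le_one[of "norm q" n] norm_ge_zero[of q]] \<open>norm q < 1\<close> by simp
  ultimately show False using \<open>norm q < 1\<close> by simp
qed

lemma summable_geometric_Suc: "0 \<le> r \<Longrightarrow> r < (1::real) \<Longrightarrow> summable (\<lambda>n. r ^ Suc n)"
  by (subst summable_Suc_iff) (simp add: summable_geometric)

lemma norm_lam_le:
  assumes "norm q \<le> r" "r < 1" shows "norm (lam n q) \<le> r ^ Suc n / (1 - r)\<^sup>2"
proof -
  have r0: "0 \<le> r" using assms norm_ge_zero order_trans by blast
  have 1: "norm (q ^ Suc n) \<le> r ^ Suc n"
    unfolding norm_power by (intro power_mono assms) auto
  also have "r ^ Suc n \<le> r"
    using mult_left_mono[OF power_le_one[of r n] r0] r0 assms by simp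
  finally have "1 - r \<le> norm (1 - q ^ Suc n)"
    using norm_triangle_ineq2[of 1 "q ^ Suc n"] by simp
  hence "(1 - r)\<^sup>2 \<le> (norm (1 - q ^ Suc n))\<^sup>2" using assms by (intro power_mono) auto
  thus ?thesis unfolding lam_def norm_divide norm_power[of "1 - q ^ Suc n"]
    using assms r0 by (intro frac_le 1) auto
qed

lemma lam_fps:
  fixes n :: nat
  obtains U where "disc_fps U" "int_upto \<infinity> U" "\<And>q. norm q < 1 \<Longrightarrow> eval_fps U q = lam n q"
proof -
  define F :: "complex fps" where "F = 1 - fps_X ^ Suc n"
  have F: "disc_fps F" by (auto simp: F_def)
  have ev: "eval_fps F q = 1 - q ^ Suc n" if "norm q < 1" for q
    unfolding F_def using that by (subst ev_diff) (auto simp del: power_Suc)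
  obtain G where G: "disc_fps G" "F * G = 1" "\<And>q. norm q < 1 \<Longrightarrow> eval_fps G q = inverse (eval_fps F q)"
    by (rule disc_fps_inverse[OF F]) (use power_Suc_neq_1[of _ n] in \<open>auto simp: ev\<close>)
  have F0: "fps_nth F 0 = 1" by (simp add: F_def)
  have iF: "int_upto \<infinity> F" unfolding F_def by (intro int_upto_diff int_upto_1 int_upto_power int_upto_X)
  have iG: "int_upto \<infinity> G" by (rule int_upto_inverse[OF G(2) F0 iF])
  show ?thesis
  proof (rule that)
    show "disc_fps (fps_X ^ Suc n * G ^ 2)" using G by (intro disc_fps_mult disc_fps_power disc_fps_X)
    show "int_upto \<infinity> (fps_X ^ Suc n * G ^ 2)" using iG by (intro int_upto_mult int_upto_power int_upto_X)
    show "eval_fps (fps_X ^ Suc n * G ^ 2) q = lam n q" if "norm q < 1" for q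
      using that G by (simp add: ev_mult disc_fps_power disc_fps_mult ev_power ev lam_def field_simps del: power_Suc)
  qed
qed

lemma lam_sq_expansion:
  fixes n :: nat
  obtains U where "sq_expansion (\<lambda>q s. lam n q) (fps_const U)" "disc_fps U" "int_upto \<infinity> U"
proof -
  obtain U where U: "disc_fps U" "int_upto \<infinity> U" "\<And>q. norm q < 1 \<Longrightarrow> eval_fps U q = lam n q" using lam_fps[of n] by blast
  have "sq_expansion (\<lambda>q s. lam n q) (fps_const U)" unfolding sq_expansion_def
    using U by (auto simp: eval_q_const U(3))
  thus ?thesis using that U by blast
qed

lemma continuous_on_lam: "r < 1 \<Longrightarrow> continuous_on (cball 0 r) (lam n)"
  unfolding lam_def by (intro continuous_intros) (use power_Suc_neq_1[of _ n] in auto)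

lemma theta_prod_uniform:
  assumes "0 < r" "r < 1"
  shows "uniform_limit (cball 0 r \<times> cball 0 R) (\<lambda>M (q, s). \<Prod>n<M. 1 - s * lam n q) (\<lambda>(q, s). theta_prod q s) sequentially"
proof -
  let ?A = "cball 0 r \<times> cball 0 R :: (complex \<times> complex) set"
  have cont: "continuous_on ?A (\<lambda>x. - snd x * lam n (fst x))" for n
    by (intro continuous_intros continuous_on_compose2[OF continuous_on_lam[OF assms(2)]]) auto
  have bnd: "norm (norm (- snd x * lam n (fst x))) \<le> R * (r ^ Suc n / (1 - r)\<^sup>2)" if "x \<in> ?A" for x n
  proof -
    have "norm (fst x) \<le> r" "norm (snd x) \<le> R" using that by (auto simp: mem_Times_iff)
    hence "norm (snd x) * norm (lam n (fst x)) \<le> R * (r ^ Suc n / (1 - r)\<^sup>2)"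
      using norm_ge_zero[of "snd x"] by (intro mult_mono norm_lam_le assms) (linarith | simp)+
    thus ?thesis by (simp add: norm_mult)
  qed
  have sm: "summable (\<lambda>n. R * (r ^ Suc n / (1 - r)\<^sup>2))"
    using summable_geometric_Suc[of r] assms by (intro summable_mult summable_divide) auto
  have uc: "uniformly_convergent_on ?A (\<lambda>N x. \<Sum>n<N. norm (- snd x * lam n (fst x)))"
    by (rule Weierstrass_m_test'[OF bnd sm])
  have "uniformly_convergent_on ?A (\<lambda>N x. \<Prod>n<N. 1 + (- snd x * lam n (fst x)))"
    by (rule uniformly_convergent_on_prod[OF cont _ uc]) (auto intro!: compact_Times)
  then obtain l where l: "uniform_limit ?A (\<lambda>N x. \<Prod>n<N. 1 + (- snd x * lam n (fst x))) l sequentially"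
    by (auto simp: uniformly_convergent_on_def)
  have eq: "l x = (\<lambda>(q, s). theta_prod q s) x" if x: "x \<in> ?A" for x
  proof -
    have "summable (\<lambda>n. norm (- snd x * lam n (fst x)))"
      using bnd[OF x] by (intro summable_comparison_test'[OF sm, of 0]) (auto simp: norm_mult)
    hence "convergent_prod (\<lambda>n. 1 + (- snd x * lam n (fst x)))"
      by (intro abs_convergent_prod_imp_convergent_prod summable_imp_abs_convergent_prod) auto
    hence "(\<lambda>N. \<Prod>n<N. 1 + (- snd x * lam n (fst x))) \<longlonglongrightarrow> (\<Prod>n. 1 + (- snd x * lam n (fst x)))"
      using convergent_prod_LIMSEQ[THEN LIMSEQ_lessThan_iff_atMost[THEN iffD2]] by blast
    moreover have "(\<lambda>N. \<Prod>n<N. 1 + (- snd x * lam n (fst x))) \<longlonglongrightarrow> l x"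
      using tendsto_uniform_limitI[OF l x] .
    ultimately show ?thesis using LIMSEQ_unique by (force simp: theta_prod_def case_prod_unfold)
  qed
  have "uniform_limit ?A (\<lambda>N x. \<Prod>n<N. 1 + (- snd x * lam n (fst x))) (\<lambda>(q, s). theta_prod q s) sequentially"
    using l eq by (simp cong: uniform_limit_cong')
  thus ?thesis by (simp add: case_prod_unfold)
qed

lemma theta_prod_LIMSEQ:
  assumes "norm q < 1" shows "(\<lambda>M. \<Prod>n<M. 1 - s * lam n q) \<longlonglongrightarrow> theta_prod q s"
proof -
  define r where "r = (1 + norm q) / 2"
  have r: "0 < r" "r < 1" "norm q \<le> r" using assms by (auto simp: r_def intro: add_pos_nonneg)
  show ?thesis using tendsto_uniform_limitI[OF theta_prod_uniform[OF r(1,2), of "norm s"], of "(q, s)"] r by simp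
qed

lemma theta_prod_holomorphic:
  assumes "norm q < 1" shows "theta_prod q holomorphic_on A"
proof -
  define r where "r = (1 + norm q) / 2"
  have r: "0 < r" "r < 1" "norm q \<le> r" using assms by (auto simp: r_def intro: add_pos_nonneg)
  have "theta_prod q holomorphic_on UNIV"
  proof (rule holomorphic_uniform_sequence)
    show "(\<lambda>s. \<Prod>n<M. 1 - s * lam n q) holomorphic_on UNIV" for M by (intro holomorphic_intros)
    fix x :: complex
    have sub: "cball x 1 \<subseteq> cball 0 (norm x + 1)"
      by (metis cball_subset_cball_iff add.commute dist_0_norm dist_commute order_refl)
    have "uniform_limit (cball x 1) (\<lambda>M s. \<Prod>n<M. 1 - s * lam n q) (theta_prod q) sequentially"
      unfolding uniform_limit_iff
    proof (intro allI impI)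
      fix e :: real assume "e > 0"
      from uniform_limitD[OF theta_prod_uniform[OF r(1,2), of "norm x + 1"] this]
      show "\<forall>\<^sub>F n in sequentially. \<forall>y\<in>cball x 1. dist (\<Prod>i<n. 1 - y * lam i q) (theta_prod q y) < e"
        by eventually_elim (use r sub in auto)
    qed
    thus "\<exists>d>0. cball x d \<subseteq> UNIV \<and> uniform_limit (cball x d) (\<lambda>M s. \<Prod>n<M. 1 - s * lam n q) (theta_prod q) sequentially"
      by (intro exI[of _ 1]) auto
  qed auto
  thus ?thesis by (rule holomorphic_on_subset) auto
qed

lemma theta_prod_0 [simp]: "theta_prod q 0 = 1"
  by (simp add: theta_prod_def)

lemma convergent_prod_theta:
  assumes "norm q < 1" shows "convergent_prod (\<lambda>n. 1 - s * lam n q)"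
proof -
  have "summable (\<lambda>n. norm s * (norm q ^ Suc n / (1 - norm q)\<^sup>2))"
    using summable_geometric_Suc[of "norm q"] assms by (intro summable_mult summable_divide) auto
  hence "summable (\<lambda>n. norm (- s * lam n q))"
    by (rule summable_comparison_test'[of _ 0])
       (use mult_left_mono[OF norm_lam_le[of q "norm q"] norm_ge_zero[of s]] assms in \<open>simp add: norm_mult\<close>)
  hence "convergent_prod (\<lambda>n. 1 + (- s * lam n q))"
    by (intro abs_convergent_prod_imp_convergent_prod summable_imp_abs_convergent_prod) auto
  thus ?thesis by simp
qed

lemma theta_prod_eq_0_iff:
  assumes "norm q < 1" shows "theta_prod q s = 0 \<longleftrightarrow> (\<exists>n. s * lam n q = 1)"
proof
  assume "theta_prod q s = 0"
  thus "\<exists>n. s * lam n q = 1"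
    using prodinf_nonzero[OF convergent_prod_theta[OF assms, of s]] by (auto simp: theta_prod_def)
next
  assume "\<exists>n. s * lam n q = 1"
  then obtain n where "1 - s * lam n q = 0" by auto
  thus "theta_prod q s = 0"
    using has_prod_zeroI[OF convergent_prod_has_prod[OF convergent_prod_theta[OF assms]]] by (simp add: theta_prod_def)
qed

lemma theta_prod_sq_expansion: obtains K where "sq_expansion theta_prod K" "int_upto2 \<infinity> K" "fps_nth K 0 = 1"
proof -
  have "\<exists>U. disc_fps U \<and> int_upto \<infinity> U \<and> sq_expansion (\<lambda>q s. lam n q) (fps_const U)" for n
    using lam_sq_expansion[of n] by blast
  then obtain U where U: "\<And>n. disc_fps (U n)" "\<And>n. int_upto \<infinity> (U n)" "\<And>n. sq_expansion (\<lambda>q s. lam n q) (fps_const (U n))" by metis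
  have 1: "sq_expansion (\<lambda>q s. \<Prod>n<M. 1 - s * lam n q) (\<Prod>n<M. 1 - fps_X * fps_const (U n))" for M
    by (intro sq_expansion_prod sq_expansion_diff sq_expansion_mult sq_expansion_1 sq_expansion_X U)
  have 2: "int_upto2 \<infinity> (\<Prod>n<M. 1 - fps_X * fps_const (U n))" for M
    using U by (intro int_upto2_prod int_upto2_intros)
  have 3: "\<exists>e>0. (\<forall>M. \<forall>q\<in>cball 0 r. (\<lambda>s. \<Prod>n<M. 1 - s * lam n q) holomorphic_on ball 0 e) \<and>
        uniform_limit (cball 0 r \<times> ball 0 e) (\<lambda>M (q, s). \<Prod>n<M. 1 - s * lam n q) (\<lambda>(q, s). theta_prod q s) sequentially"
    if "0 < r" "r < 1" for r
    by (intro exI[of _ 1] conjI allI ballI holomorphic_intros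
          uniform_limit_on_subset[OF theta_prod_uniform[OF that, of 1]]) auto
  obtain K where K: "sq_expansion theta_prod K" "int_upto2 \<infinity> K"
    using sq_expansion_limit[OF 1 2 3] by blast
  have "fps_nth K 0 = 1"
  proof (rule disc_fps_eqI)
    show "disc_fps (fps_nth K 0)" using K by (auto simp: sq_expansion_def disc_fps2_def)
    fix q :: complex assume "norm q < 1"
    hence "theta_prod q has_fps_expansion eval_q q K" using K by (auto simp: sq_expansion_def)
    from has_fps_expansion_imp_0_eq_fps_nth_0[OF this] show "eval_fps (fps_nth K 0) q = eval_fps 1 q" by simp
  qed auto
  thus ?thesis using that K by blast
qed

text \<open>The last hypothesis keeps \<open>s * lam n q\<close> within norm 1/2, so the squared
  denominator has norm at least 1/4; this is the factor 4 in the bound.\<close>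

lemma norm_wp_term_le:
  assumes "norm q \<le> r" "r < 1" "norm s \<le> R" "R * (r ^ Suc n / (1 - r)\<^sup>2) \<le> 1 / 2"
  shows "norm (wp_term n q s) \<le> r ^ Suc n * (4 / (1 - r)\<^sup>2 * (1 + 6 / (1 - r)\<^sup>2 + 2 * R * (1 / (1 - r)\<^sup>2)\<^sup>2))"
    and "1 - s * lam n q \<noteq> 0"
proof -
  define K where "K = 1 / (1 - r)\<^sup>2"
  have r0: "0 \<le> r" "0 \<le> R" using assms norm_ge_zero order_trans by blast+
  have K: "K > 0" using assms by (auto simp: K_def)
  define u where "u = lam n q"
  have u: "norm u \<le> r ^ Suc n * K" using norm_lam_le[OF assms(1,2), of n] by (simp add: u_def K_def)
  have "r ^ Suc n \<le> 1" using r0 assms by (intro power_le_one) auto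
  hence u': "norm u \<le> K" using u K by (meson mult_left_le_one_le order_trans r0 zero_le_power less_imp_le)
  have "norm (s * u) \<le> R * (r ^ Suc n * K)" unfolding norm_mult by (intro mult_mono assms u r0) auto
  also have "\<dots> \<le> 1 / 2" using assms(4) by (simp add: K_def)
  finally have su: "norm (s * u) \<le> 1/2" .
  hence d: "norm (1 - s * u) \<ge> 1 / 2" using norm_triangle_ineq2[of 1 "s * u"] by simp
  show "1 - s * lam n q \<noteq> 0" using d by (auto simp: u_def)
  have d2: "(norm (1 - s * u))\<^sup>2 \<ge> 1 / 4" using power_mono[OF d, of 2] by (simp add: power2_eq_square)
  have "norm (1 + 6 * u - 2 * s * u\<^sup>2) \<le> 1 + 6 * norm u + 2 * norm s * (norm u)\<^sup>2"
    using norm_triangle_ineq4[of "1 + 6 * u" "2 * s * u\<^sup>2"] norm_triangle_ineq[of 1 "6 * u"]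
    by (simp add: norm_mult norm_power)
  also have "\<dots> \<le> 1 + 6 * K + 2 * R * K\<^sup>2"
    using u' assms r0 K by (intro add_mono mult_mono power_mono) auto
  finally have n: "norm (1 + 6 * u - 2 * s * u\<^sup>2) \<le> 1 + 6 * K + 2 * R * K\<^sup>2" .
  have "norm (wp_term n q s) = norm u * norm (1 + 6 * u - 2 * s * u\<^sup>2) / (norm (1 - s * u))\<^sup>2"
    by (simp add: wp_term_def u_def norm_mult norm_divide norm_power)
  also have "\<dots> \<le> (r ^ Suc n * K) * (1 + 6 * K + 2 * R * K\<^sup>2) / (1 / 4)"
    using u n d2 r0 K by (intro frac_le mult_mono) auto
  finally show "norm (wp_term n q s) \<le> r ^ Suc n * (4 / (1 - r)\<^sup>2 * (1 + 6 / (1 - r)\<^sup>2 + 2 * R * (1 / (1 - r)\<^sup>2)\<^sup>2))"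
    by (simp add: K_def mult_ac)
qed

text \<open>Only terms of large index are estimated. Finitely many earlier terms may have poles in
  the region, where division by zero returns 0; they cancel in the difference between a late partial
  sum and the series.\<close>

lemma wp_tail_uniform:
  assumes "0 < r" "r < 1"
  shows "uniform_limit (cball 0 r \<times> cball 0 R) (\<lambda>M (q, s). \<Sum>n<M. wp_term n q s) (\<lambda>(q, s). wp_tail q s) sequentially"
proof -
  have "(\<lambda>n. R * (r ^ Suc n / (1 - r)\<^sup>2)) \<longlonglongrightarrow> R * (0 / (1 - r)\<^sup>2)"
    using assms by (intro tendsto_intros LIMSEQ_Suc LIMSEQ_power_zero) auto
  hence ev: "eventually (\<lambda>n. R * (r ^ Suc n / (1 - r)\<^sup>2) < 1 / 2) sequentially"
    by (intro order_tendstoD) auto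
  have "uniform_limit (cball 0 r \<times> cball 0 R) (\<lambda>M x. \<Sum>n<M. case x of (q, s) \<Rightarrow> wp_term n q s)
      (\<lambda>x. \<Sum>n. case x of (q, s) \<Rightarrow> wp_term n q s) sequentially"
  proof (rule Weierstrass_m_test_ev)
    show "\<forall>\<^sub>F n in sequentially. \<forall>x\<in>cball 0 r \<times> cball 0 R. norm (case x of (q, s) \<Rightarrow> wp_term n q s) \<le>
        r ^ Suc n * (4 / (1 - r)\<^sup>2 * (1 + 6 / (1 - r)\<^sup>2 + 2 * R * (1 / (1 - r)\<^sup>2)\<^sup>2))"
      using ev
    proof eventually_elim
      case (elim n)
      show ?case
      proof
        fix x assume "x \<in> cball (0::complex) r \<times> cball (0::complex) R"
        then obtain q s where x: "x = (q, s)" "norm q \<le> r" "norm s \<le> R" by auto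
        show "norm (case x of (q, s) \<Rightarrow> wp_term n q s) \<le>
          r ^ Suc n * (4 / (1 - r)\<^sup>2 * (1 + 6 / (1 - r)\<^sup>2 + 2 * R * (1 / (1 - r)\<^sup>2)\<^sup>2))"
          using norm_wp_term_le(1)[OF x(2) assms(2) x(3)] elim by (simp only: x(1) prod.case)
      qed
    qed
    show "summable (\<lambda>n. r ^ Suc n * (4 / (1 - r)\<^sup>2 * (1 + 6 / (1 - r)\<^sup>2 + 2 * R * (1 / (1 - r)\<^sup>2)\<^sup>2)))"
      using summable_geometric_Suc[of r] assms by (intro summable_mult2) auto
  qed
  thus ?thesis by (simp add: case_prod_unfold wp_tail_def)
qed

lemma wp_tail_LIMSEQ:
  assumes "norm q < 1" shows "(\<lambda>M. \<Sum>n<M. wp_term n q s) \<longlonglongrightarrow> wp_tail q s"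
proof -
  define r where "r = (1 + norm q) / 2"
  have r: "0 < r" "r < 1" "norm q \<le> r" using assms by (auto simp: r_def intro: add_pos_nonneg)
  show ?thesis using tendsto_uniform_limitI[OF wp_tail_uniform[OF r(1,2), of "norm s"], of "(q, s)"] r by simp
qed

lemma wp_tail_sq_expansion: obtains Z where "sq_expansion wp_tail Z" "int_upto2 \<infinity> Z"
proof -
  have "\<exists>B. sq_expansion (wp_term n) B \<and> int_upto2 \<infinity> B" for n
  proof -
    obtain U where U: "sq_expansion (\<lambda>q s. lam n q) (fps_const U)" "disc_fps U" "int_upto \<infinity> U"
      using lam_sq_expansion[of n] by blast
    let ?D = "(1 - fps_X * fps_const U) ^ 2"
    have D: "sq_expansion (\<lambda>q s. (1 - s * lam n q) ^ 2) ?D" "int_upto2 \<infinity> ?D" "fps_nth ?D 0 = 1"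
      using U by (intro sq_expansion_power sq_expansion_diff sq_expansion_mult sq_expansion_1 sq_expansion_X U int_upto2_power
        int_upto2_intros)+
        (auto simp: power2_eq_square)
    obtain I where I: "?D * I = 1" "disc_fps2 I" "int_upto2 \<infinity> ?D \<Longrightarrow> int_upto2 \<infinity> I"
      by (rule fps2_inverse_ex[of ?D]) (use D in \<open>auto simp: sq_expansion_def\<close>)
    have six: "sq_expansion (\<lambda>q s. 6) 6" "sq_expansion (\<lambda>q s. 2) 2"
      using sq_expansion_const[of 6] sq_expansion_const[of 2] by (simp_all add: numeral_fps_const)
    have "sq_expansion (\<lambda>q s. lam n q * (1 + 6 * lam n q - 2 * s * lam n q ^ 2) * inverse ((1 - s * lam n q)\<^sup>2))
       (fps_const U * (1 + 6 * fps_const U - 2 * fps_X * fps_const U ^ 2) * I)"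
      by (intro sq_expansion_mult sq_expansion_add sq_expansion_diff sq_expansion_power sq_expansion_inverse[OF D(1) I(1,2)]
        U sq_expansion_1 sq_expansion_X six)
    hence "sq_expansion (wp_term n) (fps_const U * (1 + 6 * fps_const U - 2 * fps_X * fps_const U ^ 2) * I)"
      unfolding wp_term_def divide_inverse .
    moreover have "int_upto2 \<infinity> (fps_const U * (1 + 6 * fps_const U - 2 * fps_X * fps_const U ^ 2) * I)"
      using U I D by (intro int_upto2_intros int_upto2_power int_upto2_numeral) auto
    ultimately show ?thesis by blast
  qed
  then obtain B where B: "\<And>n. sq_expansion (wp_term n) (B n)" "\<And>n. int_upto2 \<infinity> (B n)" by metis
  have 1: "sq_expansion (\<lambda>q s. \<Sum>n<M. wp_term n q s) (\<Sum>n<M. B n)" for M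
    by (intro sq_expansion_sum B)
  have 2: "int_upto2 \<infinity> (\<Sum>n<M. B n)" for M
    by (intro int_upto2_sum B)
  have 3: "\<exists>e>0. (\<forall>M. \<forall>q\<in>cball 0 r. (\<lambda>s. \<Sum>n<M. wp_term n q s) holomorphic_on ball 0 e) \<and>
        uniform_limit (cball 0 r \<times> ball 0 e) (\<lambda>M (q, s). \<Sum>n<M. wp_term n q s) (\<lambda>(q, s). wp_tail q s) sequentially"
    if r: "0 < r" "r < 1" for r
  \<comment> \<open>For \<open>s\<close> inside this radius the estimate
    \<open>norm_wp_term_le\<close> applies to every index, so none of the terms has a pole.\<close>
  proof (intro exI[of _ "(1 - r)\<^sup>2 / 2"] conjI allI ballI)
    have nz: "1 - s * lam n q \<noteq> 0" if "q \<in> cball 0 r" "s \<in> ball 0 ((1 - r)\<^sup>2 / 2)" for q s n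
    proof (rule norm_wp_term_le(2))
      have "r ^ Suc n \<le> 1" using r by (intro power_le_one) auto
      thus "(1 - r)\<^sup>2 / 2 * (r ^ Suc n / (1 - r)\<^sup>2) \<le> 1 / 2"
        using r by (simp add: field_simps)
    qed (use that r in auto)
    show "(\<lambda>s. \<Sum>n<M. wp_term n q s) holomorphic_on ball 0 ((1 - r)\<^sup>2 / 2)" if "q \<in> cball 0 r" for q M
      unfolding wp_term_def by (intro holomorphic_intros) (use nz[OF that] in auto)
    show "uniform_limit (cball 0 r \<times> ball 0 ((1 - r)\<^sup>2 / 2)) (\<lambda>M (q, s). \<Sum>n<M. wp_term n q s) (\<lambda>(q, s). wp_tail q s) sequentially"
      by (rule uniform_limit_on_subset[OF wp_tail_uniform[OF r, of "(1 - r)\<^sup>2 / 2"]]) auto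
  qed (use r in auto)
  show ?thesis
    using sq_expansion_limit[OF 1 2 3] that by blast
qed

lemma wp_tail_holomorphic:
  assumes q: "norm q < 1" and A: "open A" and nz: "\<And>s n. s \<in> A \<Longrightarrow> s * lam n q \<noteq> 1"
  shows "wp_tail q holomorphic_on A"
proof (rule holomorphic_uniform_sequence)
  define r where "r = (1 + norm q) / 2"
  have r: "0 < r" "r < 1" "norm q \<le> r" using q by (auto simp: r_def intro: add_pos_nonneg)
  show "open A" by fact
  show "(\<lambda>s. \<Sum>n<M. wp_term n q s) holomorphic_on A" for M
    unfolding wp_term_def by (intro holomorphic_intros) (use nz in fastforce)
  fix x assume "x \<in> A"
  then obtain d where d: "d > 0" "cball x d \<subseteq> A" using A open_contains_cball by blast
  have sub: "cball x d \<subseteq> cball 0 (norm x + d)"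
    by (metis cball_subset_cball_iff add.commute dist_0_norm dist_commute order_refl)
  have "uniform_limit (cball x d) (\<lambda>M s. \<Sum>n<M. wp_term n q s) (wp_tail q) sequentially"
    unfolding uniform_limit_iff
  proof (intro allI impI)
    fix e :: real assume "e > 0"
    from uniform_limitD[OF wp_tail_uniform[OF r(1,2), of "norm x + d"] this]
    show "\<forall>\<^sub>F n in sequentially. \<forall>y\<in>cball x d. dist (\<Sum>i<n. wp_term i q y) (wp_tail q y) < e"
      by eventually_elim (use r sub in auto)
  qed
  thus "\<exists>d>0. cball x d \<subseteq> A \<and> uniform_limit (cball x d) (\<lambda>M s. \<Sum>n<M. wp_term n q s) (wp_tail q) sequentially"
    using d by blast
qed

section \<open>Elliptic functions\<close>

definition ee :: "complex \<Rightarrow> complex" where "ee z = exp (2 * of_real pi * \<i> * z)"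

definition s_of :: "complex \<Rightarrow> complex" where "s_of w = w - 2 + 1 / w"

definition s_at :: "complex \<Rightarrow> complex" where "s_at z = s_of (ee z)"

definition Lattice :: "complex \<Rightarrow> complex set" where
  "Lattice \<tau> = {of_int x * \<tau> + of_int y | x y. True}"

text \<open>\<open>phi21\<close> is the weak Jacobi form \<open>\<phi>\<^sub>-\<^sub>2\<^sub>,\<^sub>1\<close>; \<open>wp0 + 1 / 12\<close> is the Weierstrass function divided by \<open>(2 \<pi>
  i)\<^sup>2\<close>.\<close>

definition phi21 :: "complex \<Rightarrow> complex \<Rightarrow> complex" where
  "phi21 \<tau> z = s_at z * theta_prod (ee \<tau>) (s_at z) ^ 2"

definition wp0 :: "complex \<Rightarrow> complex \<Rightarrow> complex" where
  "wp0 \<tau> z = 1 / s_at z + s_at z * wp_tail (ee \<tau>) (s_at z)"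

lemma ee_nz [simp]: "ee z \<noteq> 0" by (simp add: ee_def)
lemma ee_add: "ee (a + b) = ee a * ee b" by (simp add: ee_def ring_distribs exp_add)
lemma ee_minus: "ee (- a) = inverse (ee a)" by (simp add: ee_def exp_minus)
lemma ee_diff: "ee (a - b) = ee a / ee b" by (simp add: ee_def ring_distribs exp_diff)
lemma ee_0 [simp]: "ee 0 = 1" by (simp add: ee_def)
lemma ee_of_nat_mult: "ee (of_nat n * a) = ee a ^ n"
  by (induction n) (auto simp: ring_distribs ee_add)

lemma ee_eq_1_iff: "ee z = 1 \<longleftrightarrow> z \<in> \<int>"
proof -
  have "ee z = 1 \<longleftrightarrow> (\<exists>n::int. 2 * of_real pi * \<i> * z = of_int (2 * n) * of_real pi * \<i>)"
    unfolding ee_def exp_eq_1 by (auto simp: complex_eq_iff)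
  also have "\<dots> \<longleftrightarrow> (\<exists>n::int. z = of_int n)"
    by (auto simp: field_simps)
  finally show ?thesis by (auto simp: Ints_def)
qed

lemma ee_of_int [simp]: "ee (of_int n) = 1" by (simp add: ee_eq_1_iff)
lemma ee_1 [simp]: "ee 1 = 1" by (simp add: ee_eq_1_iff)

lemma ee_add_int [simp]: "ee (z + of_int n) = ee z" by (simp add: ee_add)

lemma norm_ee: "norm (ee z) = exp (- 2 * pi * Im z)"
  by (simp add: ee_def)

lemma norm_ee_less_1: "Im \<tau> > 0 \<Longrightarrow> norm (ee \<tau>) < 1"
  by (simp add: norm_ee)

lemma ee_surj: assumes "q \<noteq> 0" obtains \<tau> where "ee \<tau> = q"
  using that[of "Ln q / (2 * of_real pi * \<i>)"] assms by (simp add: ee_def)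

lemma ee_holomorphic [holomorphic_intros]: "f holomorphic_on A \<Longrightarrow> (\<lambda>z. ee (f z)) holomorphic_on A"
  unfolding ee_def by (intro holomorphic_intros)

lemma s_at_holomorphic [holomorphic_intros]: "f holomorphic_on A \<Longrightarrow> (\<lambda>z. s_at (f z)) holomorphic_on A"
  unfolding s_at_def s_of_def by (intro holomorphic_intros) auto

lemma s_of_alt: "w \<noteq> 0 \<Longrightarrow> s_of w = (1 - w)\<^sup>2 / w"
  by (simp add: s_of_def field_simps power2_eq_square)

lemma s_of_inverse: "s_of (inverse w) = s_of w"
  by (simp add: s_of_def field_simps)

lemma s_at_minus [simp]: "s_at (- z) = s_at z"
  by (simp add: s_at_def ee_minus s_of_inverse)

lemma s_at_add_1 [simp]: "s_at (z + 1) = s_at z"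
  by (simp add: s_at_def ee_add)

lemma s_at_0 [simp]: "s_at 0 = 0" by (simp add: s_at_def s_of_def)

lemma s_at_eq_0_iff: "s_at z = 0 \<longleftrightarrow> z \<in> \<int>"
  by (simp add: s_at_def s_of_alt ee_eq_1_iff[symmetric])

lemma one_minus_s_of_lam:
  assumes "w \<noteq> 0" "norm q < 1"
  shows "1 - s_of w * lam n q = (1 - q ^ Suc n * w) * (1 - q ^ Suc n / w) / (1 - q ^ Suc n)\<^sup>2"
proof -
  define x where "x = q ^ Suc n"
  have "1 - x \<noteq> 0" using power_Suc_neq_1[OF assms(2), of n] by (simp add: x_def)
  define v where "v = 1 / w"
  have wv: "w * v = 1" using assms(1) by (simp add: v_def)
  have "(1 - x)\<^sup>2 - (w - 2 + v) * x = (1 - x * w) * (1 - x * v)"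
    using wv by algebra
  hence "(1 - x)\<^sup>2 - s_of w * x = (1 - x * w) * (1 - x / w)" by (simp add: v_def s_of_def)
  moreover have "1 - s_of w * (x / (1 - x)\<^sup>2) = ((1 - x)\<^sup>2 - s_of w * x) / (1 - x)\<^sup>2"
    using \<open>1 - x \<noteq> 0\<close> by (simp add: diff_divide_distrib)
  ultimately show ?thesis unfolding lam_def x_def[symmetric] by simp
qed

lemma s_at_lam_eq_1_iff:
  assumes "Im \<tau> > 0"
  shows "(\<exists>n. s_at z * lam n (ee \<tau>) = 1) \<longleftrightarrow> (\<exists>n. of_nat (Suc n) * \<tau> + z \<in> \<int> \<or> of_nat (Suc n) * \<tau> - z \<in> \<int>)"
proof -
  have "s_at z * lam n (ee \<tau>) = 1 \<longleftrightarrow> of_nat (Suc n) * \<tau> + z \<in> \<int> \<or> of_nat (Suc n) * \<tau> - z \<in> \<int>" for n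
  proof -
    have "s_at z * lam n (ee \<tau>) = 1 \<longleftrightarrow> 1 - s_of (ee z) * lam n (ee \<tau>) = 0" by (auto simp: s_at_def)
    also have "\<dots> \<longleftrightarrow> 1 - ee \<tau> ^ Suc n * ee z = 0 \<or> 1 - ee \<tau> ^ Suc n / ee z = 0"
      using power_Suc_neq_1[OF norm_ee_less_1[OF assms], of n]
      by (subst one_minus_s_of_lam) (auto simp: norm_ee_less_1 assms)
    also have "ee \<tau> ^ Suc n * ee z = ee (of_nat (Suc n) * \<tau> + z)" by (simp only: ee_add ee_of_nat_mult)
    also have "ee \<tau> ^ Suc n / ee z = ee (of_nat (Suc n) * \<tau> - z)" by (simp only: ee_diff ee_of_nat_mult)
    finally show ?thesis by (auto simp: ee_eq_1_iff[symmetric] simp del: of_nat_Suc)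
  qed
  thus ?thesis by blast
qed

text \<open>Lattice points \<open>x * \<tau> + y\<close> are sorted by \<open>x\<close>: the value 0
  gives the zeros of \<open>s_at\<close>, and \<open>Suc n\<close> and \<open>- Suc n\<close>
  together give the zeros of the n-th factor, which is even in \<open>z\<close>.\<close>

lemma Lattice_iff_s_at:
  assumes "Im \<tau> > 0"
  shows "z \<in> Lattice \<tau> \<longleftrightarrow> s_at z = 0 \<or> (\<exists>n. s_at z * lam n (ee \<tau>) = 1)"
  unfolding s_at_lam_eq_1_iff[OF assms] s_at_eq_0_iff
proof
  assume "z \<in> Lattice \<tau>"
  then obtain x y :: int where z: "z = of_int x * \<tau> + of_int y" by (auto simp: Lattice_def)
  consider "x = 0" | n where "x = int (Suc n)" | n where "x = - int (Suc n)"
    by (metis int_cases neg_0_equal_iff_equal of_nat_0 old.nat.exhaust)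
  thus "z \<in> \<int> \<or> (\<exists>n. of_nat (Suc n) * \<tau> + z \<in> \<int> \<or> of_nat (Suc n) * \<tau> - z \<in> \<int>)"
  proof cases
    case 1 thus ?thesis by (simp add: z)
  next
    case 2
    hence "of_nat (Suc n) * \<tau> - z = of_int (- y)" unfolding z by simp
    thus ?thesis by (metis Ints_of_int)
  next
    case 3
    have "of_nat (Suc n) * \<tau> + z = of_int y" unfolding z 3 by (simp add: algebra_simps)
    thus ?thesis by (metis Ints_of_int)
  qed
next
  assume "z \<in> \<int> \<or> (\<exists>n. of_nat (Suc n) * \<tau> + z \<in> \<int> \<or> of_nat (Suc n) * \<tau> - z \<in> \<int>)"
  then consider y where "z = of_int y" | n y where "of_nat (Suc n) * \<tau> + z = of_int y"
    | n y where "of_nat (Suc n) * \<tau> - z = of_int y" by (auto elim!: Ints_cases)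
  hence "\<exists>x y. z = of_int x * \<tau> + of_int y"
  proof cases
    case 1 thus ?thesis by (intro exI[of _ 0] exI[of _ y]) auto
  next
    case (2 n y) thus ?thesis by (intro exI[of _ "- int (Suc n)"] exI[of _ y]) (auto simp: algebra_simps)
  next
    case (3 n y) thus ?thesis by (intro exI[of _ "int (Suc n)"] exI[of _ "-y"]) (auto simp: algebra_simps)
  qed
  thus "z \<in> Lattice \<tau>" by (auto simp: Lattice_def)
qed

lemma phi21_eq_0_iff: "Im \<tau> > 0 \<Longrightarrow> phi21 \<tau> z = 0 \<longleftrightarrow> z \<in> Lattice \<tau>"
  by (auto simp: phi21_def Lattice_iff_s_at theta_prod_eq_0_iff norm_ee_less_1)

lemma Lattice_add_int: "z \<in> Lattice \<tau> \<Longrightarrow> z + of_int x * \<tau> + of_int y \<in> Lattice \<tau>"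
proof -
  assume "z \<in> Lattice \<tau>"
  then obtain a b where "z = of_int a * \<tau> + of_int b" by (auto simp: Lattice_def)
  hence "z + of_int x * \<tau> + of_int y = of_int (a + x) * \<tau> + of_int (b + y)" by (simp add: algebra_simps)
  thus ?thesis unfolding Lattice_def by blast
qed

lemma Lattice_add_iff: "z + of_int x * \<tau> + of_int y \<in> Lattice \<tau> \<longleftrightarrow> z \<in> Lattice \<tau>"
  using Lattice_add_int[of z \<tau> x y] Lattice_add_int[of "z + of_int x * \<tau> + of_int y" \<tau> "-x" "-y"]
  by (auto simp: algebra_simps)

lemma Lattice_add_1 [simp]: "z + 1 \<in> Lattice \<tau> \<longleftrightarrow> z \<in> Lattice \<tau>"
  and Lattice_add_tau [simp]: "z + \<tau> \<in> Lattice \<tau> \<longleftrightarrow> z \<in> Lattice \<tau>"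
  using Lattice_add_iff[of z 0 \<tau> 1] Lattice_add_iff[of z 1 \<tau> 0] by auto

lemma Lattice_0 [simp]: "0 \<in> Lattice \<tau>" unfolding Lattice_def by (auto intro!: exI[of _ 0])

lemma Lattice_S: assumes "\<tau> \<noteq> 0" shows "z / \<tau> \<in> Lattice (- 1 / \<tau>) \<longleftrightarrow> z \<in> Lattice \<tau>"
proof
  assume "z / \<tau> \<in> Lattice (- 1 / \<tau>)"
  then obtain x y where "z / \<tau> = of_int x * (- 1 / \<tau>) + of_int y" by (auto simp: Lattice_def)
  hence "z = of_int y * \<tau> + of_int (- x)" using assms by (simp add: field_simps)
  thus "z \<in> Lattice \<tau>" unfolding Lattice_def by blast
next
  assume "z \<in> Lattice \<tau>"
  then obtain x y where "z = of_int x * \<tau> + of_int y" by (auto simp: Lattice_def)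
  hence "z / \<tau> = of_int (-y) * (- 1 / \<tau>) + of_int x" using assms by (simp add: field_simps)
  thus "z / \<tau> \<in> Lattice (- 1 / \<tau>)" unfolding Lattice_def by blast
qed

lemma theta_prod_s_at_holomorphic: assumes "Im \<tau> > 0" shows "(\<lambda>z. theta_prod (ee \<tau>) (s_at z)) holomorphic_on A"
proof -
  have "(theta_prod (ee \<tau>) \<circ> s_at) holomorphic_on A"
    by (rule holomorphic_on_compose[OF s_at_holomorphic[OF holomorphic_on_ident]
      theta_prod_holomorphic[OF norm_ee_less_1[OF assms]]])
  thus ?thesis by (simp add: o_def)
qed

lemma phi21_holomorphic: "Im \<tau> > 0 \<Longrightarrow> phi21 \<tau> holomorphic_on A"
  unfolding phi21_def by (intro holomorphic_intros theta_prod_s_at_holomorphic)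

lemma open_Compl_Lattice: assumes "Im \<tau> > 0" shows "open (- Lattice \<tau>)"
proof -
  have "continuous_on UNIV (phi21 \<tau>)" by (rule holomorphic_on_imp_continuous_on[OF phi21_holomorphic[OF assms]])
  hence "open (phi21 \<tau> -` (- {0}))" by (intro open_vimage) auto
  also have "phi21 \<tau> -` (- {0}) = - Lattice \<tau>" using phi21_eq_0_iff[OF assms] by auto
  finally show ?thesis .
qed

text \<open>Passing from \<open>w\<close> to \<open>q * w\<close> turns each factor
  \<open>1 - q ^ Suc n * w\<close> into the next one and each \<open>1 - q ^ Suc n / w\<close> into
  the previous one, so partial products change only by boundary factors, two of which tend to
  1.\<close>

lemma theta_prod_zeta_shift:
  assumes q: "norm q < 1" "q \<noteq> 0" and w: "w \<noteq> 0"
  shows "theta_prod q (s_of (q * w)) * (1 - q * w) = theta_prod q (s_of w) * (1 - 1 / w)"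
proof -
  have fin: "(\<Prod>n<M. 1 - s_of (q * w) * lam n q) * (1 - q * w) * (1 - q ^ M / w) =
      (\<Prod>n<M. 1 - s_of w * lam n q) * (1 - q ^ Suc M * w) * (1 - 1 / w)" for M
  proof (induction M)
    case (Suc M)
    have d: "1 - q ^ Suc M \<noteq> 0" using power_Suc_neq_1[OF q(1), of M] by simp
    have a: "1 - s_of (q * w) * lam M q = (1 - q ^ Suc (Suc M) * w) * (1 - q ^ M / w) / (1 - q ^ Suc M)\<^sup>2"
      using q w by (subst one_minus_s_of_lam) (auto simp: field_simps)
    have b: "1 - s_of w * lam M q = (1 - q ^ Suc M * w) * (1 - q ^ Suc M / w) / (1 - q ^ Suc M)\<^sup>2"
      using q w by (intro one_minus_s_of_lam)
    define P1 P2 where "P1 = (\<Prod>n<M. 1 - s_of (q * w) * lam n q)" "P2 = (\<Prod>n<M. 1 - s_of w * lam n q)"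
    have "(\<Prod>n<Suc M. 1 - s_of (q * w) * lam n q) * (1 - q * w) * (1 - q ^ Suc M / w) =
      (P1 * (1 - q * w) * (1 - q ^ M / w)) * (1 - q ^ Suc (Suc M) * w) * (1 - q ^ Suc M / w) / (1 - q ^ Suc M)\<^sup>2"
      by (simp only: prod.lessThan_Suc a P1_P2_def) (simp add: mult_ac)
    also have "P1 * (1 - q * w) * (1 - q ^ M / w) = P2 * (1 - q ^ Suc M * w) * (1 - 1 / w)"
      using Suc by (simp only: P1_P2_def)
    also have "P2 * (1 - q ^ Suc M * w) * (1 - 1 / w) * (1 - q ^ Suc (Suc M) * w) * (1 - q ^ Suc M / w) / (1 - q ^ Suc M)\<^sup>2
       = (\<Prod>n<Suc M. 1 - s_of w * lam n q) * (1 - q ^ Suc (Suc M) * w) * (1 - 1 / w)"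
      by (simp only: prod.lessThan_Suc b P1_P2_def) (simp add: mult_ac)
    finally show ?case .
  qed auto
  have z: "(\<lambda>M. q ^ M) \<longlonglongrightarrow> 0" using q by (intro LIMSEQ_power_zero)
  have 1: "(\<lambda>M. (\<Prod>n<M. 1 - s_of (q * w) * lam n q) * (1 - q * w) * (1 - q ^ M / w))
     \<longlonglongrightarrow> theta_prod q (s_of (q * w)) * (1 - q * w) * (1 - 0 / w)"
    by (intro tendsto_intros theta_prod_LIMSEQ z q w)
  have 2: "(\<lambda>M. (\<Prod>n<M. 1 - s_of w * lam n q) * (1 - q ^ Suc M * w) * (1 - 1 / w))
     \<longlonglongrightarrow> theta_prod q (s_of w) * (1 - 0 * w) * (1 - 1 / w)"
    by (intro tendsto_intros theta_prod_LIMSEQ LIMSEQ_Suc[OF z] q)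
  show ?thesis using LIMSEQ_unique[OF 1[unfolded fin] 2] by simp
qed

lemma phi21_add_1 [simp]: "phi21 \<tau> (z + 1) = phi21 \<tau> z"
  and phi21_minus [simp]: "phi21 \<tau> (- z) = phi21 \<tau> z"
  by (simp_all add: phi21_def)

text \<open>The factor \<open>s_of w = (1 - w)\<^sup>2 / w\<close> supplies exactly the boundary
  factors left over in the square of the theta product.\<close>

lemma phi21_add_tau:
  assumes "Im \<tau> > 0"
  shows "phi21 \<tau> (z + \<tau>) = phi21 \<tau> z * ee (- \<tau> - 2 * z)"
proof -
  define q w where "q = ee \<tau>" "w = ee z"
  have qw: "norm q < 1" "q \<noteq> 0" "w \<noteq> 0" using norm_ee_less_1[OF assms] by (auto simp: q_w_def)
  have svt: "s_at (z + \<tau>) = s_of (q * w)" "s_at z = s_of w" by (auto simp: s_at_def q_w_def ee_add mult_ac)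
  have "phi21 \<tau> (z + \<tau>) * q * w = (theta_prod q (s_of (q * w)) * (1 - q * w))\<^sup>2"
    using qw by (simp add: phi21_def svt q_w_def[symmetric] s_of_alt power_mult_distrib)
  also have "\<dots> = (theta_prod q (s_of w) * (1 - 1 / w))\<^sup>2" by (simp only: theta_prod_zeta_shift[OF qw])
  also have "\<dots> = phi21 \<tau> z / w"
    using qw by (simp add: phi21_def svt q_w_def[symmetric] s_of_alt field_simps power2_eq_square)
  finally have "phi21 \<tau> (z + \<tau>) = phi21 \<tau> z / (q * w\<^sup>2)" using qw by (simp add: field_simps power2_eq_square)
  also have "\<dots> = phi21 \<tau> z * ee (- \<tau> - 2 * z)"
    using ee_of_nat_mult[of 2 z] by (simp add: q_w_def ee_diff ee_minus field_simps)
  finally show ?thesis .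
qed

section \<open>Periodicity of the Weierstrass function\<close>

definition koebe :: "complex \<Rightarrow> complex" where "koebe x = x / (1 - x)\<^sup>2"

lemma koebe_inverse: "x \<noteq> 0 \<Longrightarrow> koebe (1 / x) = koebe x"
  by (cases "x = 1") (simp_all add: koebe_def field_simps power2_eq_square)

lemma s_of_koebe: "w \<noteq> 0 \<Longrightarrow> 1 / s_of w = koebe w"
  by (simp add: s_of_alt koebe_def)

text \<open>Origin of the formula for \<open>wp_term\<close>: the right-hand side is symmetric under
  inversion of \<open>w\<close>, hence a function of \<open>s_of w\<close>, and it vanishes at
  \<open>w = 1\<close> because \<open>lam n q = koebe (q ^ Suc n)\<close>. It is therefore divisible
  by \<open>s_of w\<close>.\<close>

lemma s_of_wp_term:
  assumes "w \<noteq> 0" "norm q < 1" "1 - q ^ Suc n * w \<noteq> 0" "1 - q ^ Suc n / w \<noteq> 0"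
  shows "s_of w * wp_term n q (s_of w) = koebe (q ^ Suc n * w) + koebe (q ^ Suc n / w) - 2 * lam n q"
proof -
  define x where "x = q ^ Suc n"
  have x1: "1 - x \<noteq> 0" using power_Suc_neq_1[OF assms(2), of n] by (simp add: x_def)
  have a: "1 - x * w \<noteq> 0" "w - x \<noteq> 0"
    using assms(1,3) assms(4)[folded x_def] by (auto simp: x_def)
  define u where "u = lam n q"
  define s where "s = s_of w"
  have u: "u * (1 - x)\<^sup>2 = x" using x1 unfolding u_def lam_def x_def[symmetric] by simp
  have sw: "s * w = (1 - w)\<^sup>2" using assms(1) by (simp add: s_def s_of_alt)
  have d: "(1 - s * u) * (w * (1 - x)\<^sup>2) = (1 - x * w) * (w - x)"
  proof -
    have "(1 - s * u) * (w * (1 - x)\<^sup>2) = w * (1 - x)\<^sup>2 - (s * w) * (u * (1 - x)\<^sup>2)" by (simp add: algebra_simps)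
    also have "\<dots> = (1 - x * w) * (w - x)" unfolding u sw by (simp add: algebra_simps power2_eq_square)
    finally show ?thesis .
  qed
  have d0: "1 - s * u \<noteq> 0" using d a by auto
  have "koebe (x * w) + koebe (x / w) = (x * w * (w - x)\<^sup>2 + x * w * (1 - x * w)\<^sup>2) / ((1 - x * w) * (w - x))\<^sup>2"
    using a assms(1) by (simp add: koebe_def divide_simps) (simp add: algebra_simps power2_eq_square)
  also have "\<dots> = (x * w * (w - x)\<^sup>2 + x * w * (1 - x * w)\<^sup>2) / ((1 - s * u) * (w * (1 - x)\<^sup>2))\<^sup>2"
    by (simp only: d)
  also have "\<dots> = (s * u * (1 + 6 * u - 2 * s * u\<^sup>2) + 2 * u * (1 - s * u)\<^sup>2) / (1 - s * u)\<^sup>2"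
  proof -
    have "x * w * (w - x)\<^sup>2 + x * w * (1 - x * w)\<^sup>2 =
        (s * u * (1 + 6 * u - 2 * s * u\<^sup>2) + 2 * u * (1 - s * u)\<^sup>2) * (w * (1 - x)\<^sup>2)\<^sup>2"
    proof -
      \<comment> \<open>One extra factor \<open>e\<close> clears the cube of \<open>u\<close> in the
        term with \<open>s\<^sup>2 * u ^ 3\<close>; afterwards \<open>u\<close> occurs only through
        \<open>u * e = x\<close> and the known product \<open>d\<close>.\<close>
      define e where "e = (1 - x)\<^sup>2"
      have "(s * u * (1 + 6 * u - 2 * s * u\<^sup>2) + 2 * u * (1 - s * u)\<^sup>2) * (w * e)\<^sup>2 * e =
         (s * w) * (u * e) * (w * e + 6 * w * (u * e)) * e - 2 * (s * w)\<^sup>2 * (u * e) ^ 3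
          + 2 * (u * e) * ((1 - s * u) * (w * e))\<^sup>2"
        by (simp add: algebra_simps power2_eq_square power3_eq_cube)
      also have "\<dots> = (1 - w)\<^sup>2 * x * (w * e + 6 * w * x) * e - 2 * ((1 - w)\<^sup>2)\<^sup>2 * x ^ 3
          + 2 * x * ((1 - x * w) * (w - x))\<^sup>2"
        unfolding e_def by (simp only: u sw d)
      also have "\<dots> = (x * w * (w - x)\<^sup>2 + x * w * (1 - x * w)\<^sup>2) * e"
        unfolding e_def by (simp add: algebra_simps power2_eq_square power3_eq_cube)
      finally have "(s * u * (1 + 6 * u - 2 * s * u\<^sup>2) + 2 * u * (1 - s * u)\<^sup>2) * (w * e)\<^sup>2 * e =
         (x * w * (w - x)\<^sup>2 + x * w * (1 - x * w)\<^sup>2) * e" .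
      moreover have "e \<noteq> 0" using x1 by (simp add: e_def)
      ultimately show ?thesis unfolding e_def[symmetric] by simp
    qed
    thus ?thesis using assms(1) x1 d0 by (simp add: power_mult_distrib)
  qed
  also have "\<dots> = s * wp_term n q s + 2 * u"
    using d0 by (simp add: wp_term_def u_def[symmetric] add_divide_distrib)
  finally show ?thesis by (simp add: x_def u_def s_def)
qed

text \<open>The sum over the two families of \<open>koebe\<close> terms telescopes. The symmetry
  \<open>koebe_inverse\<close> joins them at index 0, and the remaining terms at index
  \<open>M\<close> tend to 0.\<close>

lemma wp0_zeta_shift:
  assumes q: "norm q < 1" "q \<noteq> 0" and w: "w \<noteq> 0"
    and nz: "\<And>n. 1 - q ^ n * w \<noteq> 0" "\<And>n. 1 - q ^ n / w \<noteq> 0"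
  shows "1 / s_of (q * w) + s_of (q * w) * wp_tail q (s_of (q * w)) = 1 / s_of w + s_of w * wp_tail q (s_of w)"
proof -
  have A: "s_of w * (\<Sum>n<M. wp_term n q (s_of w)) = (\<Sum>n<M. koebe (q ^ Suc n * w) + koebe (q ^ Suc n / w) - 2 * lam n q)" for M
    unfolding sum_distrib_left by (intro sum.cong refl s_of_wp_term w q nz)
  have B: "s_of (q * w) * (\<Sum>n<M. wp_term n q (s_of (q * w))) = (\<Sum>n<M. koebe (q ^ Suc (Suc n) * w) + koebe (q ^ n / w)
    - 2 * lam n q)" for M
  proof -
    have "s_of (q * w) * wp_term n q (s_of (q * w)) = koebe (q ^ Suc n * (q * w)) + koebe (q ^ Suc n / (q * w))
      - 2 * lam n q" for n
      using nz(1)[of "Suc (Suc n)"] nz(2)[of n] q w by (intro s_of_wp_term) (auto simp: mult_ac)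
    thus ?thesis unfolding sum_distrib_left using q by (simp add: mult_ac)
  qed
  have fin: "(1 / s_of (q * w) + s_of (q * w) * (\<Sum>n<M. wp_term n q (s_of (q * w)))) -
     (1 / s_of w + s_of w * (\<Sum>n<M. wp_term n q (s_of w))) = koebe (q ^ Suc M * w) - koebe (q ^ M / w)" for M
    unfolding A B using w q
    by (induction M) (simp_all add: s_of_koebe koebe_inverse algebra_simps)
  have z: "(\<lambda>M. q ^ M) \<longlonglongrightarrow> 0" using q by (intro LIMSEQ_power_zero)
  have 1: "(\<lambda>M. koebe (q ^ Suc M * w) - koebe (q ^ M / w)) \<longlonglongrightarrow> 0 * w / (1 - 0 * w)\<^sup>2 - (0 / w) / (1 - 0 / w)\<^sup>2"
    unfolding koebe_def by (intro tendsto_intros LIMSEQ_Suc[OF z] z w) auto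
  have 2: "(\<lambda>M. (1 / s_of (q * w) + s_of (q * w) * (\<Sum>n<M. wp_term n q (s_of (q * w)))) -
     (1 / s_of w + s_of w * (\<Sum>n<M. wp_term n q (s_of w)))) \<longlonglongrightarrow> (1 / s_of (q * w) + s_of (q * w) * wp_tail q (s_of (q * w)))
       - (1 / s_of w + s_of w * wp_tail q (s_of w))"
    by (intro tendsto_intros wp_tail_LIMSEQ q)
  show ?thesis using LIMSEQ_unique[OF 1 2[unfolded fin]] by simp
qed

lemma wp0_add_1 [simp]: "wp0 \<tau> (z + 1) = wp0 \<tau> z"
  by (simp add: wp0_def)

lemma wp0_add_tau:
  assumes "Im \<tau> > 0" "z \<notin> Lattice \<tau>" shows "wp0 \<tau> (z + \<tau>) = wp0 \<tau> z"
proof -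
  have nl: "of_int n * \<tau> + z \<notin> \<int>" for n
  proof
    assume "of_int n * \<tau> + z \<in> \<int>"
    then obtain y where "of_int n * \<tau> + z = of_int y" by (auto elim: Ints_cases)
    hence "z = of_int (- n) * \<tau> + of_int y" by (simp add: algebra_simps)
    thus False using assms(2) unfolding Lattice_def by blast
  qed
  have 1: "1 - ee \<tau> ^ n * ee z \<noteq> 0" for n
    using nl[of "int n"] ee_eq_1_iff[of "of_nat n * \<tau> + z"] by (auto simp: ee_add ee_of_nat_mult)
  have 2: "1 - ee \<tau> ^ n / ee z \<noteq> 0" for n
  proof -
    have "of_nat n * \<tau> - z \<notin> \<int>"
      using nl[of "- int n"] Ints_minus[of "of_nat n * \<tau> - z"] by (auto simp: algebra_simps)
    thus ?thesis using ee_eq_1_iff[of "of_nat n * \<tau> - z"] by (auto simp: ee_diff ee_of_nat_mult)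
  qed
  have "s_at (z + \<tau>) = s_of (ee \<tau> * ee z)" by (simp add: s_at_def ee_add mult_ac)
  thus ?thesis
    using wp0_zeta_shift[OF norm_ee_less_1[OF assms(1)] ee_nz ee_nz 1 2] by (simp add: wp0_def s_at_def)
qed

lemma wp0_holomorphic: assumes "Im \<tau> > 0" shows "wp0 \<tau> holomorphic_on - Lattice \<tau>"
proof -
  let ?q = "ee \<tau>"
  have q: "norm ?q < 1" by (rule norm_ee_less_1[OF assms])
  have op: "open {s. theta_prod ?q s \<noteq> 0}"
  proof -
    have "continuous_on UNIV (theta_prod ?q)" by (rule holomorphic_on_imp_continuous_on[OF theta_prod_holomorphic[OF q]])
    hence "open (theta_prod ?q -` (- {0}))" by (intro open_vimage) auto
    thus ?thesis by (simp add: vimage_def)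
  qed
  have "wp_tail ?q holomorphic_on {s. theta_prod ?q s \<noteq> 0}"
    by (rule wp_tail_holomorphic[OF q op]) (use theta_prod_eq_0_iff[OF q] in auto)
  hence "(\<lambda>z. wp_tail ?q (s_at z)) holomorphic_on - Lattice \<tau>"
    by (intro holomorphic_on_compose_gen[of s_at "- Lattice \<tau>" "wp_tail ?q" "{s. theta_prod ?q s \<noteq> 0}", unfolded o_def]
       s_at_holomorphic holomorphic_on_ident) (auto simp: Lattice_iff_s_at[OF assms] theta_prod_eq_0_iff[OF q])
  thus ?thesis unfolding wp0_def
    by (intro holomorphic_intros) (auto simp: Lattice_iff_s_at[OF assms])
qed

section \<open>Liouville's theorem for elliptic functions\<close>

lemma eventually_not_Lattice:
  assumes "Im \<tau> > 0" shows "eventually (\<lambda>z. z \<notin> Lattice \<tau>) (at 0)"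
proof -
  have c: "continuous_on UNIV (\<lambda>z. theta_prod (ee \<tau>) (s_at z))"
    by (intro holomorphic_on_imp_continuous_on theta_prod_s_at_holomorphic assms)
  have "open ((\<lambda>z. theta_prod (ee \<tau>) (s_at z)) -` (- {0}))" by (intro open_vimage c) auto
  moreover have "0 \<in> (\<lambda>z. theta_prod (ee \<tau>) (s_at z)) -` (- {0})" by simp
  ultimately have 1: "eventually (\<lambda>z. z \<in> (\<lambda>z. theta_prod (ee \<tau>) (s_at z)) -` (- {0})) (at 0)"
    by (rule eventually_at_in_open')
  have 2: "eventually (\<lambda>z. z \<in> ball 0 1 - {0}) (at (0::complex))"
    by (intro eventually_at_in_open) auto
  show ?thesis using 1 2
  proof eventually_elim
    case (elim z)
    have "z \<notin> \<int>" using elim(2) by (auto elim!: Ints_cases)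
    thus ?case using elim theta_prod_eq_0_iff[OF norm_ee_less_1[OF assms], of "s_at z"]
      by (auto simp: Lattice_iff_s_at[OF assms] s_at_eq_0_iff)
  qed
qed

text \<open>The limit makes the singularity at 0 removable, periodicity repeats this at every
  lattice point, and the resulting entire function takes all its values on one compact period
  parallelogram.\<close>

lemma elliptic_constant:
  assumes tau: "Im \<tau> > 0" and hol: "g holomorphic_on - Lattice \<tau>"
    and per1: "\<And>z. z \<notin> Lattice \<tau> \<Longrightarrow> g (z + 1) = g z"
    and pert: "\<And>z. z \<notin> Lattice \<tau> \<Longrightarrow> g (z + \<tau>) = g z"
    and lim: "(g \<longlongrightarrow> L) (at 0)" and z: "z \<notin> Lattice \<tau>"
  shows "g z = L"
proof -
  define h where "h = (\<lambda>z. if z \<in> Lattice \<tau> then L else g z)"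
  have h1: "h (z + 1) = h z" "h (z + \<tau>) = h z" for z by (auto simp: h_def per1 pert)
  have hn1: "h (z + of_nat n) = h z" for z n
    using h1(1)[of "z + of_nat m" for m] by (induction n) (auto simp: algebra_simps)
  have hnt: "h (z + of_nat n * \<tau>) = h z" for z n
    using h1(2)[of "z + of_nat m * \<tau>" for m] by (induction n) (auto simp: algebra_simps)
  have hi1: "h (z + of_int n) = h z" for z n
    using hn1[of z "nat n"] hn1[of "z + of_int n" "nat (- n)"] by (cases "n \<ge> 0") auto
  have hit: "h (z + of_int n * \<tau>) = h z" for z n
    using hnt[of z "nat n"] hnt[of "z + of_int n * \<tau>" "nat (- n)"] by (cases "n \<ge> 0") (auto simp: algebra_simps)
  have per: "h (z + (of_int x * \<tau> + of_int y)) = h z" for z x y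
    using hi1[of "z + of_int x * \<tau>" y] hit[of z x] by (simp add: add.assoc)
  obtain e where e: "e > 0" "\<And>z. z \<in> ball 0 e \<Longrightarrow> z \<noteq> 0 \<Longrightarrow> z \<notin> Lattice \<tau>"
    using eventually_not_Lattice[OF tau] by (auto simp: eventually_at dist_norm)
  have hol0: "h holomorphic_on ball 0 e"
  proof -
    have "(\<lambda>y. if y = 0 then L else g y) holomorphic_on ball 0 e"
      by (rule removable_singularity[OF _ _ lim])
         (use e in \<open>auto intro: holomorphic_on_subset[OF hol]\<close>)
    thus ?thesis by (rule holomorphic_transform) (use e in \<open>auto simp: h_def\<close>)
  qed
  have "h holomorphic_on UNIV"
  proof -
    have "\<exists>U. open U \<and> x \<in> U \<and> h holomorphic_on U" for x
    proof (cases "x \<in> Lattice \<tau>")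
      case False
      have "h holomorphic_on - Lattice \<tau>" by (rule holomorphic_transform[OF hol]) (auto simp: h_def)
      thus ?thesis using False open_Compl_Lattice[OF tau] by blast
    next
      case True
      then obtain a b where x: "x = of_int a * \<tau> + of_int b" by (auto simp: Lattice_def)
      have "(\<lambda>y. h (y - x)) holomorphic_on ball x e"
        by (intro holomorphic_on_compose_gen[OF _ hol0, of "\<lambda>y. y - x" "ball x e", unfolded o_def] holomorphic_intros)
           (auto simp: dist_norm norm_minus_commute)
      moreover have "h (y - x) = h y" for y using per[of "y - x" a b] by (simp add: x)
      ultimately show ?thesis using e by (intro exI[of _ "ball x e"]) auto
    qed
    hence "h field_differentiable (at x)" for x using holomorphic_on_imp_differentiable_at by blast
    thus ?thesis by (simp add: holomorphic_on_def)
  qed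
  moreover have "bounded (range h)"
  proof -
    let ?K = "(\<lambda>p. of_real (fst p) * \<tau> + of_real (snd p)) ` (cbox (0, 0) (1 :: real, 1 :: real))"
    have "compact ?K"
      by (intro compact_continuous_image compact_cbox continuous_intros)
    moreover have "continuous_on ?K h"
      by (rule holomorphic_on_imp_continuous_on[OF holomorphic_on_subset[OF \<open>h holomorphic_on UNIV\<close> subset_UNIV]])
    ultimately have "compact (h ` ?K)" by (rule compact_continuous_image[rotated])
    moreover have "range h \<subseteq> h ` ?K"
    proof
      fix y assume "y \<in> range h"
      then obtain w where y: "y = h w" by auto
      define a where "a = Im w / Im \<tau>"
      define b where "b = Re w - a * Re \<tau>"
      have w: "w = of_real a * \<tau> + of_real b" using tau by (auto simp: complex_eq_iff a_def b_def)
      have "w = (of_real (frac a) * \<tau> + of_real (frac b)) + (of_int \<lfloor>a\<rfloor> * \<tau> + of_int \<lfloor>b\<rfloor>)"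
        by (subst w) (simp add: frac_def algebra_simps)
      hence "y = h (of_real (frac a) * \<tau> + of_real (frac b))" unfolding y using per by metis
      moreover have "(frac a, frac b) \<in> cbox (0, 0) (1, 1)"
        by (auto simp: frac_ge_0 less_imp_le[OF frac_lt_1])
      ultimately show "y \<in> h ` ?K" by force
    qed
    ultimately show ?thesis using bounded_subset compact_imp_bounded by blast
  qed
  ultimately have "h constant_on UNIV" by (rule Liouville_theorem)
  then obtain c where "\<And>x. h x = c" by (auto simp: constant_on_def)
  from this[of z] this[of 0] show ?thesis using z by (simp add: h_def)
qed

section \<open>Modular transformations and the Eisenstein series\<close>

text \<open>Expansion coefficients at the origin are handled as limits of such quotients; these are
  easy to compare after a substitution such as \<open>z / \<tau>\<close> or
  \<open>s_at z\<close>.\<close>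

lemma ratio_tendsto:
  fixes f :: "complex \<Rightarrow> complex"
  assumes "f has_fps_expansion F" "\<And>i. i < n \<Longrightarrow> fps_nth F i = 0"
  shows "((\<lambda>z. f z / z ^ n) \<longlongrightarrow> fps_nth F n) (at 0)"
proof (cases "F = 0")
  case True
  hence "eventually (\<lambda>z. f z = 0) (nhds 0)" using assms(1) by (simp add: has_fps_expansion_0_iff)
  hence "eventually (\<lambda>z. f z / z ^ n = 0) (at 0)" by (auto simp: eventually_at_filter elim: eventually_mono)
  thus ?thesis using True by (simp add: tendsto_eventually)
next
  case False
  hence "n \<le> subdegree F" using assms(2) by (simp add: subdegree_geI)
  hence "(\<lambda>z. if z = 0 then fps_nth F n else f z / z ^ n) has_fps_expansion fps_shift n F"
    by (intro has_fps_expansion_shift assms(1)) auto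
  from has_fps_expansion_imp_tendsto_0[OF this]
  have "((\<lambda>z. if z = 0 then fps_nth F n else f z / z ^ n) \<longlongrightarrow> fps_nth F n) (nhds 0)"
    by (simp only: fps_shift_nth add_0)
  hence "((\<lambda>z. if z = 0 then fps_nth F n else f z / z ^ n) \<longlongrightarrow> fps_nth F n) (at 0)"
    by (rule filterlim_mono[OF _ order_refl at_within_le_nhds])
  thus ?thesis by (rule Lim_transform_eventually) (simp add: eventually_at_filter)
qed

section \<open>Taylor expansions at the origin\<close>

definition cos_s :: "complex \<Rightarrow> complex" where "cos_s v = 2 * cos v - 2"

lemma s_at_cos_s: "s_at z = cos_s (2 * of_real pi * z)"
proof -
  have *: "cos (2 * of_real pi * z) = (ee z + 1 / ee z) / 2"
    unfolding cos_exp_eq ee_def by (simp add: exp_minus inverse_eq_divide mult.assoc mult.left_commute[of \<i>])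
  hence "ee z + 1 / ee z = 2 * cos (2 * of_real pi * z)" unfolding * by simp
  thus ?thesis unfolding s_at_def s_of_def cos_s_def by simp
qed

lemma cos_s_expansion: "cos_s has_fps_expansion 2 * fps_cos 1 - 2"
  unfolding cos_s_def[abs_def] by (intro fps_expansion_intros has_fps_expansion_cos')

lemma less_8_cases: "i < (8::nat) \<Longrightarrow> i = 0 \<or> i = 1 \<or> i = 2 \<or> i = 3 \<or> i = 4 \<or> i = 5 \<or> i = 6 \<or> i = 7"
  by linarith

lemma cos_s_tendsto_2: "((\<lambda>v. cos_s v / v ^ 2) \<longlongrightarrow> - 1) (at 0)"
proof -
  have "((\<lambda>v. cos_s v / v ^ 2) \<longlongrightarrow> fps_nth (2 * fps_cos 1 - 2) 2) (at 0)"
    by (rule ratio_tendsto[OF cos_s_expansion])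
       (auto simp: fps_cos_def less_2_cases_iff fps_numeral_nth)
  thus ?thesis by (simp add: fps_cos_def fps_numeral_nth)
qed

lemma cos_s_tendsto_4: "((\<lambda>v. (cos_s v + v ^ 2) / v ^ 4) \<longlongrightarrow> 1 / 12) (at 0)"
proof -
  have "((\<lambda>v. (cos_s v + v ^ 2) / v ^ 4) \<longlongrightarrow> fps_nth (2 * fps_cos 1 - 2 + fps_X ^ 2) 4) (at 0)"
  proof (rule ratio_tendsto)
    show "(\<lambda>v. cos_s v + v ^ 2) has_fps_expansion 2 * fps_cos 1 - 2 + fps_X ^ 2"
      by (intro fps_expansion_intros cos_s_expansion)
    fix i :: nat assume "i < 4"
    hence "i = 0 \<or> i = 1 \<or> i = 2 \<or> i = 3" by linarith
    thus "fps_nth (2 * fps_cos 1 - 2 + fps_X ^ 2) i = (0 :: complex)"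
      by (auto simp: fps_cos_def fps_numeral_nth)
  qed
  thus ?thesis by (simp add: fps_cos_def fps_numeral_nth fact_numeral)
qed

text \<open>The numerator is \<open>12 * v\<^sup>2 * cos_s v * cos_reg v\<close> with the function
  \<open>cos_reg\<close> introduced below.\<close>

lemma cos_s_tendsto_6: "((\<lambda>v. (12 * v ^ 2 + 12 * cos_s v + v ^ 2 * cos_s v) / v ^ 6) \<longlongrightarrow> 1 / 20) (at 0)"
proof -
  let ?F = "12 * fps_X ^ 2 + 12 * (2 * fps_cos 1 - 2) + fps_X ^ 2 * (2 * fps_cos 1 - 2) :: complex fps"
  have "((\<lambda>v. (12 * v ^ 2 + 12 * cos_s v + v ^ 2 * cos_s v) / v ^ 6) \<longlongrightarrow> fps_nth ?F 6) (at 0)"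
  proof (rule ratio_tendsto)
    show "(\<lambda>v. 12 * v ^ 2 + 12 * cos_s v + v ^ 2 * cos_s v) has_fps_expansion ?F"
      by (intro fps_expansion_intros cos_s_expansion)
    fix i :: nat assume "i < 6"
    hence "i = 0 \<or> i = 1 \<or> i = 2 \<or> i = 3 \<or> i = 4 \<or> i = 5" by linarith
    thus "fps_nth ?F i = 0"
      by (auto simp: fps_cos_def fps_numeral_nth fps_X_power_mult_nth fact_numeral)
  qed
  thus ?thesis by (simp add: fps_cos_def fps_numeral_nth fps_X_power_mult_nth fact_numeral)
qed

text \<open>The numerator is
  \<open>240 * v\<^sup>2 * cos_s v * (cos_reg v + v\<^sup>2 / 240)\<close>, so this limit yields the
  second coefficient of \<open>cos_reg\<close>.\<close>

lemma cos_s_tendsto_8: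
  "((\<lambda>v. (20 * (12 * v ^ 2 + 12 * cos_s v + v ^ 2 * cos_s v) + v ^ 4 * cos_s v) / v ^ 8) \<longlongrightarrow> 5 / 126) (at 0)"
proof -
  let ?F = "20 * (12 * fps_X ^ 2 + 12 * (2 * fps_cos 1 - 2) + fps_X ^ 2 * (2 * fps_cos 1 - 2))
    + fps_X ^ 4 * (2 * fps_cos 1 - 2) :: complex fps"
  have "((\<lambda>v. (20 * (12 * v ^ 2 + 12 * cos_s v + v ^ 2 * cos_s v) + v ^ 4 * cos_s v) / v ^ 8) \<longlongrightarrow> fps_nth ?F 8) (at 0)"
  proof (rule ratio_tendsto)
    show "(\<lambda>v. 20 * (12 * v ^ 2 + 12 * cos_s v + v ^ 2 * cos_s v) + v ^ 4 * cos_s v) has_fps_expansion ?F"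
      by (intro fps_expansion_intros cos_s_expansion)
    fix i :: nat assume "i < 8"
    from less_8_cases[OF this] show "fps_nth ?F i = 0"
      by (auto simp: fps_cos_def fps_numeral_nth fps_X_power_mult_nth fact_numeral)
  qed
  thus ?thesis by (simp add: fps_cos_def fps_numeral_nth fps_X_power_mult_nth fact_numeral)
qed

text \<open>As \<open>cos_s v = - 4 * sin (v / 2) ^ 2\<close>, the expansion of
  \<open>1 / cos_s v\<close> begins with \<open>- 1 / v\<^sup>2 - 1 / 12\<close>. This constant is
  the origin of the 1/12 between \<open>wp0\<close> and \<open>wp\<close>.\<close>

definition cos_reg :: "complex \<Rightarrow> complex" where "cos_reg v = 1 / cos_s v + 1 / v ^ 2 + 1 / 12"

lemma eventually_cos_s_nz: "eventually (\<lambda>v. v \<noteq> 0 \<and> cos_s v \<noteq> 0) (at 0)"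
proof -
  have "eventually (\<lambda>v. cos_s v / v ^ 2 \<noteq> 0) (at 0)"
    by (rule tendsto_imp_eventually_ne[OF cos_s_tendsto_2]) simp
  thus ?thesis by eventually_elim auto
qed

lemma cos_reg_tendsto_2: "((\<lambda>v. cos_reg v / v ^ 2) \<longlongrightarrow> - 1 / 240) (at 0)"
proof -
  have "((\<lambda>v. (12 * v ^ 2 + 12 * cos_s v + v ^ 2 * cos_s v) / v ^ 6 / (12 * (cos_s v / v ^ 2))) \<longlongrightarrow> 1 / 20 / (12 * - 1)) (at 0)"
    by (intro tendsto_intros cos_s_tendsto_6 cos_s_tendsto_2) auto
  also have "?this \<longleftrightarrow> ((\<lambda>v. cos_reg v / v ^ 2) \<longlongrightarrow> 1 / 20 / (12 * - 1)) (at 0)"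
  proof (rule filterlim_cong[OF refl refl])
    show "\<forall>\<^sub>F v in at 0. (12 * v ^ 2 + 12 * cos_s v + v ^ 2 * cos_s v) / v ^ 6 / (12 * (cos_s v / v ^ 2)) = cos_reg v / v ^ 2"
      using eventually_cos_s_nz
    proof eventually_elim
      case (elim v)
      define c where "c = cos_s v"
      show ?case using elim unfolding cos_reg_def c_def[symmetric]
        by (simp add: divide_simps)
    qed
  qed
  finally show ?thesis by simp
qed

lemma cos_reg_tendsto_4: "((\<lambda>v. (cos_reg v + v ^ 2 / 240) / v ^ 4) \<longlongrightarrow> - 1 / 6048) (at 0)"
proof -
  have "((\<lambda>v. (20 * (12 * v ^ 2 + 12 * cos_s v + v ^ 2 * cos_s v) + v ^ 4 * cos_s v) / v ^ 8 / (240 * (cos_s v / v ^ 2)))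
    \<longlongrightarrow> 5 / 126 / (240 * - 1)) (at 0)"
    by (intro tendsto_intros cos_s_tendsto_8 cos_s_tendsto_2) auto
  also have "?this \<longleftrightarrow> ((\<lambda>v. (cos_reg v + v ^ 2 / 240) / v ^ 4) \<longlongrightarrow> 5 / 126 / (240 * - 1)) (at 0)"
  proof (rule filterlim_cong[OF refl refl])
    show "\<forall>\<^sub>F v in at 0. (20 * (12 * v ^ 2 + 12 * cos_s v + v ^ 2 * cos_s v) + v ^ 4 * cos_s v)
      / v ^ 8 / (240 * (cos_s v / v ^ 2)) = (cos_reg v + v ^ 2 / 240) / v ^ 4"
      using eventually_cos_s_nz
    proof eventually_elim
      case (elim v)
      define c where "c = cos_s v"
      show ?case using elim unfolding cos_reg_def c_def[symmetric]
        by (simp add: divide_simps)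
    qed
  qed
  finally show ?thesis by simp
qed

section \<open>Eisenstein series as Laurent coefficients\<close>

definition wp_tail_fps :: "complex fps fps" where "wp_tail_fps = (SOME Z. sq_expansion wp_tail Z \<and> int_upto2 \<infinity> Z)"
definition theta_fps :: "complex fps fps" where "theta_fps = (SOME K. sq_expansion theta_prod K \<and> int_upto2 \<infinity> K \<and> fps_nth K 0
  = 1)"

lemma wp_tail_fps: "sq_expansion wp_tail wp_tail_fps" "int_upto2 \<infinity> wp_tail_fps"
proof -
  have "\<exists>Z. sq_expansion wp_tail Z \<and> int_upto2 \<infinity> Z" using wp_tail_sq_expansion by blast
  from someI_ex[OF this] show "sq_expansion wp_tail wp_tail_fps" "int_upto2 \<infinity> wp_tail_fps" by (auto simp: wp_tail_fps_def)
qed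

lemma theta_fps: "sq_expansion theta_prod theta_fps" "int_upto2 \<infinity> theta_fps" "fps_nth theta_fps 0 = 1"
proof -
  have "\<exists>K. sq_expansion theta_prod K \<and> int_upto2 \<infinity> K \<and> fps_nth K 0 = 1" using theta_prod_sq_expansion by blast
  from someI_ex[OF this] show "sq_expansion theta_prod theta_fps" "int_upto2 \<infinity> theta_fps" "fps_nth theta_fps 0 = 1"
    by (auto simp: theta_fps_def)
qed

text \<open>At \<open>s = 0\<close> the term \<open>wp_term n\<close> is
  \<open>lam + 6 * lam\<^sup>2\<close>, that is, the sum of d^3 x^d for
  \<open>x = q ^ Suc n\<close>. So \<open>Z0\<close> is the series of the divisor sums sigma_3(n)
  q^n; likewise \<open>Z0 + 12 * Z1\<close> is the series of sigma_5(n) q^n. The series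
  \<open>E4\<close> and \<open>E6\<close> below are thus the normalised Eisenstein series of weights
  4 and 6.\<close>

definition Z0 :: "complex fps" where "Z0 = fps_nth wp_tail_fps 0"
definition Z1 :: "complex fps" where "Z1 = fps_nth wp_tail_fps 1"

lemma Z0_Z1: "disc_fps Z0" "disc_fps Z1" "int_upto \<infinity> Z0" "int_upto \<infinity> Z1"
  using wp_tail_fps by (auto simp: Z0_def Z1_def sq_expansion_def disc_fps2_def int_upto2_def)

text \<open>\<open>- E4 / 240\<close> and \<open>- E6 / 6048\<close> are the coefficients of \<open>v\<^sup>2\<close> and \<open>v ^ 4\<close>, \<open>v = 2 \<pi> z\<close>, in the Laurent
  expansion of the Weierstrass function, so their modularity comes from its transformation under \<open>\<tau> \<mapsto> - 1
  / \<tau>\<close>.\<close>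

definition E4 :: "complex fps" where "E4 = 1 + 240 * Z0"
definition E6 :: "complex fps" where "E6 = 1 - 504 * Z0 - 6048 * Z1"

lemma eval_E46:
  assumes "norm q < 1"
  shows "eval_fps E4 q = 1 + 240 * eval_fps Z0 q"
    "eval_fps E6 q = 1 - 504 * eval_fps Z0 q - 6048 * eval_fps Z1 q"
  using assms Z0_Z1 by (simp_all add: E4_def E6_def ev_simps disc_fps_mult disc_fps_diff)

definition twopi :: "complex \<Rightarrow> complex" where "twopi z = 2 * of_real pi * z"

lemma filterlim_twopi: "filterlim twopi (at 0) (at 0)"
  unfolding filterlim_at twopi_def by (auto simp: eventually_at_filter intro!: tendsto_eq_intros)

lemma s_at_tendsto: "((\<lambda>z. s_at z / twopi z ^ 2) \<longlongrightarrow> - 1) (at 0)"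
  using filterlim_compose[OF cos_s_tendsto_2 filterlim_twopi] by (simp add: s_at_cos_s twopi_def)

lemma filterlim_s_at: "filterlim s_at (at 0) (at 0)"
proof -
  have "isCont s_at 0"
    using holomorphic_on_imp_continuous_on[OF s_at_holomorphic[OF holomorphic_on_ident, of UNIV]]
    by (simp add: continuous_on_eq_continuous_at)
  moreover have "eventually (\<lambda>z. s_at z \<noteq> 0) (at 0)"
    using eventually_cos_s_nz filterlim_twopi unfolding filterlim_iff
      by (fastforce simp: s_at_cos_s twopi_def elim: eventually_mono)
  ultimately show ?thesis by (auto simp: filterlim_at isCont_def elim: eventually_mono)
qed

lemma phi21_tendsto: assumes "Im \<tau> > 0" shows "((\<lambda>z. phi21 \<tau> z / twopi z ^ 2) \<longlongrightarrow> - 1) (at 0)"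
proof -
  have "isCont (\<lambda>z. theta_prod (ee \<tau>) (s_at z)) 0"
    using holomorphic_on_imp_continuous_on[OF theta_prod_s_at_holomorphic[OF assms, of UNIV]]
    by (simp add: continuous_on_eq_continuous_at)
  hence "((\<lambda>z. theta_prod (ee \<tau>) (s_at z)) \<longlongrightarrow> 1) (at 0)" by (simp add: isCont_def)
  hence "((\<lambda>z. s_at z / twopi z ^ 2 * theta_prod (ee \<tau>) (s_at z) ^ 2) \<longlongrightarrow> - 1 * 1 ^ 2) (at 0)"
    by (intro tendsto_intros s_at_tendsto)
  thus ?thesis by (simp add: phi21_def)
qed

section \<open>The transformation \<tau> to -1/\<tau>\<close>

lemma Im_S: "Im \<tau> > 0 \<Longrightarrow> Im (- 1 / \<tau>) > 0"
  by (simp add: Im_divide complex_is_Real_iff power2_eq_square sum_squares_gt_zero_iff zero_less_divide_iff)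

lemma filterlim_div_tau: "\<tau> \<noteq> 0 \<Longrightarrow> filterlim (\<lambda>z::complex. z / \<tau>) (at 0) (at 0)"
  unfolding filterlim_at by (auto simp: eventually_at_filter intro!: tendsto_eq_intros)

lemma phi21_sub_tau:
  assumes "Im \<tau> > 0" shows "phi21 \<tau> (z - \<tau>) = phi21 \<tau> z * ee (2 * z - \<tau>)"
proof -
  have "phi21 \<tau> z = phi21 \<tau> (z - \<tau>) * ee (- \<tau> - 2 * (z - \<tau>))"
    using phi21_add_tau[OF assms, of "z - \<tau>"] by simp
  hence "phi21 \<tau> z * ee (2 * z - \<tau>) = phi21 \<tau> (z - \<tau>) * (ee (- \<tau> - 2 * (z - \<tau>)) * ee (2 * z - \<tau>))" by simp
  also have "ee (- \<tau> - 2 * (z - \<tau>)) * ee (2 * z - \<tau>) = 1" by (simp add: ee_add[symmetric] algebra_simps)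
  finally show ?thesis by simp
qed

text \<open>Outside the lattice the quotient of the two sides is elliptic: the exponential factor
  compensates the index 1 multipliers in both periods. Both sides behave like
  \<open>- (2 * pi * z / \<tau>)\<^sup>2\<close> at the origin, so the constant is 1. On the lattice
  both sides vanish.\<close>

lemma phi21_S:
  assumes tau: "Im \<tau> > 0"
  shows "phi21 (- 1 / \<tau>) (z / \<tau>) = ee (z\<^sup>2 / \<tau>) / \<tau>\<^sup>2 * phi21 \<tau> z"
proof (cases "z \<in> Lattice \<tau>")
  case True
  have t0: "\<tau> \<noteq> 0" using tau by auto
  show ?thesis using True phi21_eq_0_iff[OF tau, of z] phi21_eq_0_iff[OF Im_S[OF tau], of "z / \<tau>"] Lattice_S[OF t0, of z] by simp
next
  case False
  have t0: "\<tau> \<noteq> 0" using tau by auto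
  let ?t = "- 1 / \<tau>"
  have It: "Im ?t > 0" by (rule Im_S[OF tau])
  define g where "g = (\<lambda>z. phi21 ?t (z / \<tau>) * ee (- (z\<^sup>2 / \<tau>)) * \<tau>\<^sup>2 / phi21 \<tau> z)"
  have "g z = 1"
  proof (rule elliptic_constant[OF tau, where g = g])
    show "g holomorphic_on - Lattice \<tau>"
    proof -
      have hd: "(\<lambda>z. z / \<tau>) holomorphic_on - Lattice \<tau>" using t0 by (intro holomorphic_intros)
      have "(\<lambda>z. phi21 ?t (z / \<tau>)) holomorphic_on - Lattice \<tau>"
        using holomorphic_on_compose[OF hd phi21_holomorphic[OF It]] unfolding o_def .
      thus ?thesis unfolding g_def
        by (intro holomorphic_intros phi21_holomorphic[OF tau]) (use phi21_eq_0_iff[OF tau] t0 in auto)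
    qed
    fix z
    have "phi21 ?t ((z + 1) / \<tau>) = phi21 ?t (z / \<tau> - ?t)" by (simp add: add_divide_distrib)
    also have "\<dots> = phi21 ?t (z / \<tau>) * ee (2 * (z / \<tau>) - ?t)" by (rule phi21_sub_tau[OF It])
    finally have 1: "phi21 ?t ((z + 1) / \<tau>) = phi21 ?t (z / \<tau>) * ee (2 * (z / \<tau>) - ?t)" .
    have "ee (2 * (z / \<tau>) - ?t) * ee (- ((z + 1)\<^sup>2 / \<tau>)) = ee (- (z\<^sup>2 / \<tau>))"
      unfolding ee_add[symmetric] using t0 by (intro arg_cong[where f = ee]) (simp add: field_simps power2_eq_square)
    thus "g (z + 1) = g z" unfolding g_def 1 by (simp add: mult.assoc)
    have "phi21 ?t ((z + \<tau>) / \<tau>) = phi21 ?t (z / \<tau> + 1)" using t0 by (simp add: add_divide_distrib)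
    hence 2: "phi21 ?t ((z + \<tau>) / \<tau>) = phi21 ?t (z / \<tau>)" by simp
    have "ee (- ((z + \<tau>)\<^sup>2 / \<tau>)) = ee (- (z\<^sup>2 / \<tau>)) * ee (- \<tau> - 2 * z)"
      unfolding ee_add[symmetric] using t0 by (intro arg_cong[where f = ee]) (simp add: field_simps power2_eq_square)
    thus "g (z + \<tau>) = g z" unfolding g_def 2 phi21_add_tau[OF tau] by simp
  next
    have "((\<lambda>z. phi21 ?t (z / \<tau>) / twopi (z / \<tau>) ^ 2) \<longlongrightarrow> - 1) (at 0)"
      by (rule filterlim_compose[OF phi21_tendsto[OF It] filterlim_div_tau[OF t0]])
    moreover have "isCont (\<lambda>z. ee (- (z\<^sup>2 / \<tau>))) 0" unfolding ee_def using t0 by (intro continuous_intros) auto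
    hence "((\<lambda>z. ee (- (z\<^sup>2 / \<tau>))) \<longlongrightarrow> 1) (at 0)" by (simp add: isCont_def)
    ultimately have "((\<lambda>z. (phi21 ?t (z / \<tau>) / twopi (z / \<tau>) ^ 2) * ee (- (z\<^sup>2 / \<tau>)) / (phi21 \<tau> z / twopi z ^ 2)) \<longlongrightarrow> - 1 * 1 / - 1)
      (at 0)"
      by (intro tendsto_intros phi21_tendsto[OF tau]) auto
    moreover have "eventually (\<lambda>z. (phi21 ?t (z / \<tau>) / twopi (z / \<tau>) ^ 2) * ee (- (z\<^sup>2 / \<tau>)) / (phi21 \<tau> z / twopi z ^ 2) = g z)
      (at 0)"
      unfolding eventually_at_filter
      by (rule always_eventually) (use t0 in \<open>auto simp: g_def twopi_def power_divide power_mult_distrib\<close>)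
    ultimately show "(g \<longlongrightarrow> 1) (at 0)" by (simp add: filterlim_cong)
  qed fact
  thus ?thesis using t0 phi21_eq_0_iff[OF tau] False by (simp add: g_def ee_minus field_simps)
qed

definition wp :: "complex \<Rightarrow> complex \<Rightarrow> complex" where "wp \<tau> z = wp0 \<tau> z + 1 / 12"

definition wp_reg :: "complex \<Rightarrow> complex \<Rightarrow> complex" where "wp_reg \<tau> z = wp \<tau> z + 1 / twopi z ^ 2"

lemma wp_reg_eq: "wp_reg \<tau> z = cos_reg (twopi z) + s_at z * wp_tail (ee \<tau>) (s_at z)"
  by (simp add: wp_reg_def wp_def wp0_def cos_reg_def s_at_cos_s twopi_def)

lemma wp_tail_expansion: "Im \<tau> > 0 \<Longrightarrow> wp_tail (ee \<tau>) has_fps_expansion eval_q (ee \<tau>) wp_tail_fps"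
  using wp_tail_fps norm_ee_less_1 by (auto simp: sq_expansion_def)

lemma wp_tail_tendsto_0:
  assumes "Im \<tau> > 0" shows "((\<lambda>z. wp_tail (ee \<tau>) (s_at z)) \<longlongrightarrow> eval_fps Z0 (ee \<tau>)) (at 0)"
  using filterlim_compose[OF ratio_tendsto[OF wp_tail_expansion[OF assms], of 0] filterlim_s_at] by (simp add: Z0_def)

lemma wp_tail_tendsto_1:
  assumes "Im \<tau> > 0"
  shows "((\<lambda>z. (wp_tail (ee \<tau>) (s_at z) - eval_fps Z0 (ee \<tau>)) / s_at z) \<longlongrightarrow> eval_fps Z1 (ee \<tau>)) (at 0)"
proof -
  have "(\<lambda>s. wp_tail (ee \<tau>) s - eval_fps Z0 (ee \<tau>)) has_fps_expansion eval_q (ee \<tau>) wp_tail_fps - fps_const (eval_fps Z0 (ee \<tau>))"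
    by (intro fps_expansion_intros wp_tail_expansion[OF assms])
  from filterlim_compose[OF ratio_tendsto[OF this, of 1] filterlim_s_at]
  show ?thesis by (simp add: Z0_def Z1_def)
qed

lemma wp_reg_tendsto_2:
  assumes "Im \<tau> > 0" shows "((\<lambda>z. wp_reg \<tau> z / twopi z ^ 2) \<longlongrightarrow> - eval_fps E4 (ee \<tau>) / 240) (at 0)"
proof -
  have "((\<lambda>z. cos_reg (twopi z) / twopi z ^ 2 + (s_at z / twopi z ^ 2) * wp_tail (ee \<tau>) (s_at z)) \<longlongrightarrow> - 1 / 240 + (- 1)
    * eval_fps Z0 (ee \<tau>)) (at 0)"
    by (intro tendsto_intros filterlim_compose[OF cos_reg_tendsto_2 filterlim_twopi] s_at_tendsto wp_tail_tendsto_0 assms)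
  moreover have "- 1 / 240 + (- 1) * eval_fps Z0 (ee \<tau>) = - eval_fps E4 (ee \<tau>) / 240"
    unfolding eval_E46[OF norm_ee_less_1[OF assms]] by (simp add: field_simps)
  ultimately show ?thesis by (simp add: wp_reg_eq add_divide_distrib)
qed

text \<open>With \<open>s = - v\<^sup>2 + v ^ 4 / 12 + ...\<close> and the tail
  \<open>a + b * s + ...\<close>, the product of \<open>s\<close> and the tail contributes
  \<open>a / 12 + b\<close> in degree 4; \<open>cos_reg\<close> contributes - 1/6048.\<close>

lemma wp_reg_tendsto_4:
  assumes "Im \<tau> > 0"
  shows "((\<lambda>z. (wp_reg \<tau> z + eval_fps E4 (ee \<tau>) / 240 * twopi z ^ 2) / twopi z ^ 4) \<longlongrightarrow> - eval_fps E6 (ee \<tau>) / 6048) (at 0)"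
proof -
  define a b where "a = eval_fps Z0 (ee \<tau>)" "b = eval_fps Z1 (ee \<tau>)"
  have e: "eval_fps E4 (ee \<tau>) / 240 = 1 / 240 + a" "- eval_fps E6 (ee \<tau>) / 6048 = - 1 / 6048 + (a / 12 + b)"
    unfolding eval_E46[OF norm_ee_less_1[OF assms]] a_b_def by (simp_all add: field_simps)
  have "((\<lambda>z. (cos_reg (twopi z) + twopi z ^ 2 / 240) / twopi z ^ 4 + (a * ((s_at z + twopi z ^ 2) / twopi z ^ 4) +
     (s_at z / twopi z ^ 2) ^ 2 * ((wp_tail (ee \<tau>) (s_at z) - a) / s_at z))) \<longlongrightarrow> - 1 / 6048 + (a * (1 / 12) + (- 1) ^ 2 * b))
       (at 0)"
  proof (intro tendsto_add tendsto_mult tendsto_power tendsto_const s_at_tendsto)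
    show "((\<lambda>z. (cos_reg (twopi z) + twopi z ^ 2 / 240) / twopi z ^ 4) \<longlongrightarrow> - 1 / 6048) (at 0)"
      by (rule filterlim_compose[OF cos_reg_tendsto_4 filterlim_twopi])
    show "((\<lambda>z. (s_at z + twopi z ^ 2) / twopi z ^ 4) \<longlongrightarrow> 1 / 12) (at 0)"
      using filterlim_compose[OF cos_s_tendsto_4 filterlim_twopi] by (simp add: s_at_cos_s twopi_def)
    show "((\<lambda>z. (wp_tail (ee \<tau>) (s_at z) - a) / s_at z) \<longlongrightarrow> b) (at 0)"
      using wp_tail_tendsto_1[OF assms] by (simp add: a_b_def)
  qed
  also have "- 1 / 6048 + (a * (1 / 12) + (- 1) ^ 2 * b) = - eval_fps E6 (ee \<tau>) / 6048" unfolding e by simp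
  also have "((\<lambda>z. (cos_reg (twopi z) + twopi z ^ 2 / 240) / twopi z ^ 4 + (a * ((s_at z + twopi z ^ 2) / twopi z ^ 4) +
     (s_at z / twopi z ^ 2) ^ 2 * ((wp_tail (ee \<tau>) (s_at z) - a) / s_at z))) \<longlongrightarrow> - eval_fps E6 (ee \<tau>) / 6048) (at 0) \<longleftrightarrow> ?thesis"
  proof (rule filterlim_cong[OF refl refl])
    have "eventually (\<lambda>z. s_at z \<noteq> 0) (at 0)" "eventually (\<lambda>z. twopi z \<noteq> 0) (at 0)"
      using filterlim_s_at filterlim_twopi by (auto simp: filterlim_at elim: eventually_mono)
    thus "\<forall>\<^sub>F z in at 0. (cos_reg (twopi z) + twopi z ^ 2 / 240) / twopi z ^ 4 + (a * ((s_at z + twopi z ^ 2) / twopi z ^ 4) +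
     (s_at z / twopi z ^ 2) ^ 2 * ((wp_tail (ee \<tau>) (s_at z) - a) / s_at z)) = (wp_reg \<tau> z + eval_fps E4 (ee \<tau>)
       / 240 * twopi z ^ 2) / twopi z ^ 4"
    proof eventually_elim
      case (elim z)
      define v s y where "v = twopi z" "s = s_at z" "y = wp_tail (ee \<tau>) (s_at z)"
      have "(s / v ^ 2) ^ 2 * ((y - a) / s) = s * (y - a) / v ^ 4"
        using elim by (simp add: v_s_y_def power2_eq_square power4_eq_xxxx)
      hence "(cos_reg v + v ^ 2 / 240) / v ^ 4 + (a * ((s + v ^ 2) / v ^ 4) + (s / v ^ 2) ^ 2 * ((y - a) / s)) =
          (cos_reg v + v ^ 2 / 240) / v ^ 4 + (a * (s + v ^ 2) / v ^ 4 + s * (y - a) / v ^ 4)" by simp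
      also have "\<dots> = (cos_reg v + s * y + (1 / 240 + a) * v ^ 2) / v ^ 4"
        by (simp only: add_divide_distrib[symmetric]) (simp add: algebra_simps)
      finally show ?case unfolding wp_reg_eq e v_s_y_def .
    qed
  qed
  finally show ?thesis .
qed

lemma wp_add_1 [simp]: "wp \<tau> (z + 1) = wp \<tau> z" by (simp add: wp_def)

lemma wp_add_tau: "Im \<tau> > 0 \<Longrightarrow> z \<notin> Lattice \<tau> \<Longrightarrow> wp \<tau> (z + \<tau>) = wp \<tau> z"
  by (simp add: wp_def wp0_add_tau)

lemma wp_reg_tendsto_0: assumes "Im \<tau> > 0" shows "(wp_reg \<tau> \<longlongrightarrow> 0) (at 0)"
proof -
  have "(twopi \<longlongrightarrow> 0) (at 0)" using filterlim_twopi by (simp add: filterlim_at)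
  hence "((\<lambda>z. wp_reg \<tau> z / twopi z ^ 2 * twopi z ^ 2) \<longlongrightarrow> - eval_fps E4 (ee \<tau>) / 240 * 0 ^ 2) (at 0)"
    by (intro tendsto_intros wp_reg_tendsto_2 assms)
  moreover have "eventually (\<lambda>z. wp_reg \<tau> z / twopi z ^ 2 * twopi z ^ 2 = wp_reg \<tau> z) (at 0)"
    by (auto simp: eventually_at_filter twopi_def intro!: always_eventually)
  ultimately show ?thesis by (simp add: filterlim_cong)
qed

lemma wp_reg_S:
  assumes "\<tau> \<noteq> 0"
  shows "wp_reg (- 1 / \<tau>) (z / \<tau>) - \<tau>\<^sup>2 * wp_reg \<tau> z = wp (- 1 / \<tau>) (z / \<tau>) - \<tau>\<^sup>2 * wp \<tau> z"
  using assms by (simp add: wp_reg_def twopi_def power_divide power_mult_distrib algebra_simps)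

text \<open>The double poles cancel in the difference of the two sides. Its constant value is 0
  because \<open>wp_reg\<close> tends to 0 at the origin, which is the effect of the constant 1/12
  in \<open>wp\<close>.\<close>

lemma wp_S:
  assumes tau: "Im \<tau> > 0" and z: "z \<notin> Lattice \<tau>"
  shows "wp (- 1 / \<tau>) (z / \<tau>) = \<tau>\<^sup>2 * wp \<tau> z"
proof -
  have t0: "\<tau> \<noteq> 0" using tau by auto
  let ?t = "- 1 / \<tau>"
  have It: "Im ?t > 0" by (rule Im_S[OF tau])
  define g where "g = (\<lambda>z. wp ?t (z / \<tau>) - \<tau>\<^sup>2 * wp \<tau> z)"
  have "g z = 0"
  proof (rule elliptic_constant[OF tau, where g = g])
    have "(wp0 ?t \<circ> (\<lambda>z. z / \<tau>)) holomorphic_on - Lattice \<tau>"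
      by (rule holomorphic_on_compose_gen[OF _ wp0_holomorphic[OF It]])
         (use t0 Lattice_S[OF t0] in \<open>auto intro!: holomorphic_intros\<close>)
    thus "g holomorphic_on - Lattice \<tau>" unfolding g_def wp_def
      by (intro holomorphic_intros wp0_holomorphic[OF tau]) (simp add: o_def)
    fix z assume z: "z \<notin> Lattice \<tau>"
    have z': "z / \<tau> \<notin> Lattice ?t" using z Lattice_S[OF t0] by simp
    have "z / \<tau> - ?t \<notin> Lattice ?t" using z' Lattice_add_tau[of "z / \<tau> - ?t" ?t] by simp
    hence "wp ?t (z / \<tau> - ?t + ?t) = wp ?t (z / \<tau> - ?t)" by (rule wp_add_tau[OF It])
    moreover have "(z + 1) / \<tau> = z / \<tau> - ?t" by (simp add: add_divide_distrib)
    ultimately show "g (z + 1) = g z" by (simp add: g_def)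
    have "(z + \<tau>) / \<tau> = z / \<tau> + 1" using t0 by (simp add: add_divide_distrib)
    thus "g (z + \<tau>) = g z" by (simp add: g_def wp_add_tau[OF tau z])
  next
    have "((\<lambda>z. wp_reg ?t (z / \<tau>) - \<tau>\<^sup>2 * wp_reg \<tau> z) \<longlongrightarrow> 0 - \<tau>\<^sup>2 * 0) (at 0)"
      by (intro tendsto_intros filterlim_compose[OF wp_reg_tendsto_0[OF It] filterlim_div_tau[OF t0]] wp_reg_tendsto_0[OF tau])
    thus "(g \<longlongrightarrow> 0) (at 0)" unfolding wp_reg_S[OF t0] g_def by simp
  qed fact
  thus ?thesis by (simp add: g_def)
qed

text \<open>A level one form is stored as its expansion in \<open>q\<close>: invariance under \<tau>
  + 1 and holomorphy at the cusp are built into a power series converging on the unit disc, so only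
  the law for -1/\<tau> is stated.\<close>

definition modular_fps :: "int \<Rightarrow> complex fps \<Rightarrow> bool" where
  "modular_fps w F \<longleftrightarrow> disc_fps F \<and> (\<forall>\<tau>. Im \<tau> > 0 \<longrightarrow> eval_fps F (ee (- 1 / \<tau>)) = \<tau> powi w * eval_fps F (ee \<tau>))"

lemma wp_reg_S': assumes "Im \<tau> > 0" "z \<notin> Lattice \<tau>" shows "wp_reg (- 1 / \<tau>) (z / \<tau>) = \<tau>\<^sup>2 * wp_reg \<tau> z"
  using wp_reg_S[of \<tau> z] wp_S[OF assms] assms(1) by (cases "\<tau> = 0") auto

lemma modular_fps_E4: "modular_fps 4 E4"
  unfolding modular_fps_def
proof (intro conjI allI impI)
  show "disc_fps E4" using Z0_Z1 by (auto simp: E4_def)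
  fix \<tau> :: complex assume tau: "Im \<tau> > 0"
  have t0: "\<tau> \<noteq> 0" using tau by auto
  have "((\<lambda>z. wp_reg (- 1 / \<tau>) (z / \<tau>) / twopi (z / \<tau>) ^ 2) \<longlongrightarrow> - eval_fps E4 (ee (- 1 / \<tau>)) / 240) (at 0)"
    by (rule filterlim_compose[OF wp_reg_tendsto_2[OF Im_S[OF tau]] filterlim_div_tau[OF t0]])
  moreover have "((\<lambda>z. \<tau> ^ 4 * (wp_reg \<tau> z / twopi z ^ 2)) \<longlongrightarrow> \<tau> ^ 4 * (- eval_fps E4 (ee \<tau>) / 240)) (at 0)"
    by (intro tendsto_intros wp_reg_tendsto_2 tau)
  moreover have "eventually (\<lambda>z. wp_reg (- 1 / \<tau>) (z / \<tau>) / twopi (z / \<tau>) ^ 2 = \<tau> ^ 4 * (wp_reg \<tau> z / twopi z ^ 2)) (at 0)"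
    using eventually_not_Lattice[OF tau]
  proof eventually_elim
    case (elim z)
    show ?case unfolding wp_reg_S'[OF tau elim] twopi_def using t0
      by (simp add: power_divide power_mult_distrib power4_eq_xxxx power2_eq_square)
  qed
  ultimately have "- eval_fps E4 (ee (- 1 / \<tau>)) / 240 = \<tau> ^ 4 * (- eval_fps E4 (ee \<tau>) / 240)"
    by (intro tendsto_unique[of "at (0::complex)"]) (auto simp: filterlim_cong)
  thus "eval_fps E4 (ee (- 1 / \<tau>)) = \<tau> powi 4 * eval_fps E4 (ee \<tau>)" by simp
qed

lemma modular_fps_E6: "modular_fps 6 E6"
  unfolding modular_fps_def
proof (intro conjI allI impI)
  show "disc_fps E6" using Z0_Z1 by (auto simp: E6_def)
  fix \<tau> :: complex assume tau: "Im \<tau> > 0"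
  have t0: "\<tau> \<noteq> 0" using tau by auto
  let ?t = "- 1 / \<tau>"
  have e4: "eval_fps E4 (ee ?t) = \<tau> ^ 4 * eval_fps E4 (ee \<tau>)" using modular_fps_E4 tau by (simp add: modular_fps_def)
  have "((\<lambda>z. (wp_reg ?t (z / \<tau>) + eval_fps E4 (ee ?t) / 240 * twopi (z / \<tau>) ^ 2) / twopi (z / \<tau>) ^ 4) \<longlongrightarrow> - eval_fps E6 (ee ?t)
    / 6048) (at 0)"
    by (rule filterlim_compose[OF wp_reg_tendsto_4[OF Im_S[OF tau]] filterlim_div_tau[OF t0]])
  moreover have "((\<lambda>z. \<tau> ^ 6 * ((wp_reg \<tau> z + eval_fps E4 (ee \<tau>) / 240 * twopi z ^ 2) / twopi z ^ 4))
    \<longlongrightarrow> \<tau> ^ 6 * (- eval_fps E6 (ee \<tau>) / 6048)) (at 0)"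
    by (intro tendsto_intros wp_reg_tendsto_4 tau)
  moreover have "eventually (\<lambda>z. (wp_reg ?t (z / \<tau>) + eval_fps E4 (ee ?t) / 240 * twopi (z / \<tau>) ^ 2) / twopi (z / \<tau>) ^ 4
    = \<tau> ^ 6 * ((wp_reg \<tau> z + eval_fps E4 (ee \<tau>) / 240 * twopi z ^ 2) / twopi z ^ 4)) (at 0)"
    using eventually_not_Lattice[OF tau]
  proof eventually_elim
    case (elim z)
    have v: "twopi (z / \<tau>) = twopi z / \<tau>" by (simp add: twopi_def)
    have t6: "\<tau> ^ 6 = \<tau>\<^sup>2 * \<tau> ^ 4" by (simp add: power_add[symmetric])
    have "wp_reg ?t (z / \<tau>) + eval_fps E4 (ee ?t) / 240 * twopi (z / \<tau>) ^ 2 = \<tau>\<^sup>2 * (wp_reg \<tau> z + eval_fps E4 (ee \<tau>)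
      / 240 * twopi z ^ 2)"
      unfolding wp_reg_S'[OF tau elim] e4 v using t0 by (simp add: power_divide algebra_simps power4_eq_xxxx power2_eq_square)
    thus ?case unfolding v t6 using t0 by (simp add: power_divide)
  qed
  ultimately have "- eval_fps E6 (ee ?t) / 6048 = \<tau> ^ 6 * (- eval_fps E6 (ee \<tau>) / 6048)"
    by (intro tendsto_unique[of "at (0::complex)"]) (auto simp: filterlim_cong)
  thus "eval_fps E6 (ee ?t) = \<tau> powi 6 * eval_fps E6 (ee \<tau>)" by simp
qed

section \<open>Integral modular forms of level one\<close>

lemma euler_product_ex:
  obtains G where "disc_fps G" "int_upto \<infinity> G"
    "\<And>q. norm q < 1 \<Longrightarrow> (\<lambda>M. \<Prod>n<M. 1 - q ^ Suc n) \<longlonglongrightarrow> eval_fps G q"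
    "\<And>q. norm q < 1 \<Longrightarrow> eval_fps G q \<noteq> 0" "fps_nth G 0 = 1"
proof -
  define F where "F = (\<lambda>M. \<Prod>n<M. 1 - fps_X ^ Suc n :: complex fps)"
  have F: "disc_fps (F M)" "int_upto \<infinity> (F M)" for M
    unfolding F_def by (intro disc_fps_prod int_upto_prod disc_fps_diff disc_fps_power int_upto_diff int_upto_power
      disc_fps_1 disc_fps_X int_upto_1 int_upto_X)+
  have evF: "eval_fps (F M) q = (\<Prod>n<M. 1 - q ^ Suc n)" if "norm q < 1" for M q
    unfolding F_def using that
    by (subst ev_prod) (auto simp: ev_diff ev_power disc_fps_power simp del: power_Suc)
  define g where "g = (\<lambda>q::complex. \<Prod>n. 1 - q ^ Suc n)"
  have cp: "convergent_prod (\<lambda>n. 1 - q ^ Suc n)" if "norm q < 1" for q :: complex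
  proof -
    have "summable (\<lambda>n. norm (- (q ^ Suc n)))"
      using summable_geometric_Suc[of "norm q"] that by (simp add: norm_mult norm_power)
    hence "convergent_prod (\<lambda>n. 1 + (- (q ^ Suc n)))"
      by (intro abs_convergent_prod_imp_convergent_prod summable_imp_abs_convergent_prod) auto
    thus ?thesis by simp
  qed
  have lim: "(\<lambda>M. \<Prod>n<M. 1 - q ^ Suc n) \<longlonglongrightarrow> g q" if "norm q < 1" for q
    unfolding g_def using convergent_prod_has_prod[OF cp[OF that]] by (rule has_prod_imp_tendsto')
  have ul: "uniform_limit (cball 0 r) (\<lambda>M q. eval_fps (F M) q) g sequentially" if r: "0 < r" "r < 1" for r
  proof -
    have bnd: "norm (norm (- (q ^ Suc n))) \<le> r ^ Suc n" if "q \<in> cball 0 r" for q :: complex and n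
      using that power_mono[of "norm q" r "Suc n"] by (simp add: norm_mult norm_power)
    have "uniformly_convergent_on (cball 0 r) (\<lambda>N q. \<Sum>n<N. norm (- (q ^ Suc n :: complex)))"
      by (rule Weierstrass_m_test'[OF bnd]) (use summable_geometric_Suc[of r] r in auto)
    hence "uniformly_convergent_on (cball 0 r) (\<lambda>N q. \<Prod>n<N. 1 + - (q ^ Suc n :: complex))"
      by (intro uniformly_convergent_on_prod) (auto intro!: continuous_intros)
    then obtain l where l: "uniform_limit (cball 0 r) (\<lambda>N q. \<Prod>n<N. 1 + - (q ^ Suc n :: complex)) l sequentially"
      by (auto simp: uniformly_convergent_on_def)
    have lg: "l q = g q" if "q \<in> cball 0 r" for q
    proof (rule LIMSEQ_unique)
      show "(\<lambda>M. \<Prod>n<M. 1 + - (q ^ Suc n)) \<longlonglongrightarrow> l q" by (rule tendsto_uniform_limitI[OF l that])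
      show "(\<lambda>M. \<Prod>n<M. 1 + - (q ^ Suc n)) \<longlonglongrightarrow> g q" using lim[of q] that r by simp
    qed
    show ?thesis unfolding uniform_limit_iff
    proof (intro allI impI)
      fix e :: real assume "e > 0"
      from uniform_limitD[OF l this] show "\<forall>\<^sub>F n in sequentially. \<forall>x\<in>cball 0 r. dist (eval_fps (F n) x) (g x) < e"
      proof eventually_elim
        case (elim n)
        show ?case
        proof
          fix x :: complex assume x: "x \<in> cball 0 r"
          hence "norm x < 1" using r by simp
          thus "dist (eval_fps (F n) x) (g x) < e" using bspec[OF elim x] lg[OF x] by (simp add: evF[OF \<open>norm x < 1\<close>])
        qed
      qed
    qed
  qed
  obtain G where G: "disc_fps G" "int_upto \<infinity> G" "\<And>q. norm q < 1 \<Longrightarrow> eval_fps G q = g q"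
    using disc_fps_limit[OF F ul] by blast
  show ?thesis
  proof (rule that[OF G(1,2)])
    show "norm q < 1 \<Longrightarrow> (\<lambda>M. \<Prod>n<M. 1 - q ^ Suc n) \<longlonglongrightarrow> eval_fps G q" for q using lim G(3) by simp
    show "norm q < 1 \<Longrightarrow> eval_fps G q \<noteq> 0" for q
      using G(3)[of q] prodinf_nonzero[OF cp[of q]] power_Suc_neq_1[of q] by (auto simp: g_def simp del: power_Suc)
    have "eval_fps G 0 = g 0" by (rule G(3)) simp
    thus "fps_nth G 0 = 1" by (simp add: eval_fps_at_0 g_def)
  qed
qed

text \<open>For \<open>q = t\<^sup>2\<close> and \<open>x = q ^ Suc n\<close> the three n-th factors
  multiply to \<open>(1 - x\<^sup>2)\<^sup>2 * (1 - x\<^sup>2 * q) * (1 - x\<^sup>2 / q) / (1 - x) ^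
  8\<close>. Even powers of \<open>q\<close> occur squared and odd powers occur in two neighbouring
  factors, so the numerators build up the square of the Euler product.\<close>

lemma theta_prod_two_torsion:
  assumes t: "norm t < 1" "t \<noteq> 0" and P: "(\<lambda>M. \<Prod>n<M. 1 - (t\<^sup>2) ^ Suc n) \<longlonglongrightarrow> P"
  shows "theta_prod (t\<^sup>2) (s_of (- 1)) * theta_prod (t\<^sup>2) (s_of t) * theta_prod (t\<^sup>2) (s_of (- t)) * P ^ 8 * (1 - t\<^sup>2) = P\<^sup>2"
proof -
  define q where "q = t\<^sup>2"
  have q: "norm q < 1" "q \<noteq> 0" using t by (auto simp: q_def norm_power power_less_one_iff abs_square_less_1)
  define a where "a = (\<lambda>M. \<Prod>n<M. 1 - q ^ Suc n)"
  define b where "b = (\<lambda>M. (\<Prod>n<M. 1 - s_of (- 1) * lam n q) * (\<Prod>n<M. 1 - s_of t * lam n q) * (\<Prod>n<M. 1 - s_of (- t) * lam n q))"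
  \<comment> \<open>The factor \<open>1 - q\<close> would otherwise occur only once, and
    \<open>1 - q ^ (2 * M + 1)\<close> is the odd factor still waiting for its partner.\<close>
  have fin: "b M * a M ^ 8 * (1 - q) = a (2 * M) ^ 2 * (1 - q ^ (2 * M + 1))" for M
  proof (induction M)
    case (Suc M)
    define x where "x = q ^ Suc M"
    have x: "1 - x \<noteq> 0" using power_Suc_neq_1[OF q(1), of M] by (simp add: x_def)
    have f1: "1 - s_of (- 1) * lam M q = (1 + x)\<^sup>2 / (1 - x)\<^sup>2"
      using one_minus_s_of_lam[of "- 1" q M] q by (simp add: x_def power2_eq_square)
    have f2: "1 - s_of t * lam M q = (1 - x * t) * (1 - x / t) / (1 - x)\<^sup>2"
      using one_minus_s_of_lam[of t q M] q t by (simp add: x_def)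
    have f3: "1 - s_of (- t) * lam M q = (1 + x * t) * (1 + x / t) / (1 - x)\<^sup>2"
      using one_minus_s_of_lam[of "- t" q M] q t by (simp add: x_def)
    have xt: "(1 - x * t) * (1 + x * t) = 1 - x\<^sup>2 * q" "(1 - x / t) * (1 + x / t) = 1 - x\<^sup>2 / q"
      using t by (simp_all add: q_def field_simps power2_eq_square)
    have xq: "x\<^sup>2 / q = q ^ (2 * M + 1)" "x\<^sup>2 * q = q ^ (2 * Suc M + 1)" "x\<^sup>2 = q ^ (2 * M + 2)"
      using q by (simp_all add: x_def power_mult[symmetric] power2_eq_square power_add mult_2)
    have aS: "a (Suc M) = a M * (1 - x)" by (simp add: a_def x_def)
    have a2: "a (2 * Suc M) = a (2 * M) * (1 - x\<^sup>2 / q) * (1 - x\<^sup>2)"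
      unfolding xq by (simp add: a_def)
    have bS: "b (Suc M) = b M * ((1 + x)\<^sup>2 / (1 - x)\<^sup>2 * ((1 - x\<^sup>2 * q) * (1 - x\<^sup>2 / q)) / (1 - x) ^ 4)"
    proof -
      have "b (Suc M) = b M * ((1 - s_of (- 1) * lam M q) * (1 - s_of t * lam M q) * (1 - s_of (- t) * lam M q))"
        by (simp add: b_def mult_ac)
      also have "(1 - s_of (- 1) * lam M q) * (1 - s_of t * lam M q) * (1 - s_of (- t) * lam M q) =
         (1 + x)\<^sup>2 / (1 - x)\<^sup>2 * (((1 - x * t) * (1 + x * t)) * ((1 - x / t) * (1 + x / t))) / (1 - x) ^ 4"
        unfolding f1 f2 f3 by (simp add: power4_eq_xxxx power2_eq_square mult_ac)
      finally show ?thesis by (simp only: xt)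
    qed
    have "b (Suc M) * a (Suc M) ^ 8 * (1 - q) =
       (b M * a M ^ 8 * (1 - q)) * ((1 + x)\<^sup>2 * (1 - x)\<^sup>2 * ((1 - x\<^sup>2 * q) * (1 - x\<^sup>2 / q)))"
    proof -
      define y where "y = 1 - x"
      show ?thesis unfolding bS aS power_mult_distrib y_def[symmetric] using x
        by (simp add: y_def[symmetric] divide_eq_eq mult_ac)
    qed
    also have "(1 + x)\<^sup>2 * (1 - x)\<^sup>2 = (1 - x\<^sup>2)\<^sup>2" by (simp add: power2_eq_square algebra_simps)
    also have "b M * a M ^ 8 * (1 - q) = a (2 * M) ^ 2 * (1 - x\<^sup>2 / q)" unfolding xq(1) by (rule Suc)
    finally have "b (Suc M) * a (Suc M) ^ 8 * (1 - q) = a (2 * Suc M) ^ 2 * (1 - x\<^sup>2 * q)"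
      unfolding a2 by (simp add: power2_eq_square mult_ac)
    thus ?case by (simp only: xq(2))
  qed (simp add: a_def b_def)
  have la: "a \<longlonglongrightarrow> P" using P by (simp add: a_def q_def)
  have "filterlim (\<lambda>M::nat. 2 * M) sequentially sequentially"
    by (rule filterlim_subseq) (auto simp: strict_mono_def)
  note la2 = filterlim_compose[OF la this]
  have "(\<lambda>M. q ^ (2 * M + 1)) \<longlonglongrightarrow> 0"
  proof -
    have "(\<lambda>M. (q\<^sup>2) ^ M * q) \<longlonglongrightarrow> 0 * q"
      by (intro tendsto_intros LIMSEQ_power_zero)
         (use q in \<open>auto simp: norm_power abs_square_less_1\<close>)
    moreover have "(q\<^sup>2) ^ M * q = q ^ (2 * M + 1)" for M by (simp only: power_add power_mult power_one_right)
    ultimately show ?thesis by simp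
  qed
  hence "(\<lambda>M. a (2 * M) ^ 2 * (1 - q ^ (2 * M + 1))) \<longlonglongrightarrow> P ^ 2 * (1 - 0)"
    by (intro tendsto_intros la2)
  moreover have "(\<lambda>M. b M * a M ^ 8 * (1 - q)) \<longlonglongrightarrow> theta_prod q (s_of (- 1)) * theta_prod q (s_of t) * theta_prod q (s_of (- t))
    * P ^ 8 * (1 - q)"
    unfolding b_def by (intro tendsto_intros la theta_prod_LIMSEQ q)
  ultimately show ?thesis unfolding fin q_def[symmetric] using LIMSEQ_unique by fastforce
qed

text \<open>The product of the values of \<open>phi21\<close> at the three 2-torsion points, squared and multiplied by \<open>q\<close>, is \<open>16
  / \<Delta>\<close>; the transformation permutes these points.\<close>

lemma Delta_ex:
  "\<exists>G. disc_fps G \<and> int_upto \<infinity> G \<and> fps_nth G 0 = 1 \<and> (\<forall>q. norm q < 1 \<longrightarrow> eval_fps G q \<noteq> 0) \<and> modular_fps 12 (fps_X * G)"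
proof -
  obtain P where P: "disc_fps P" "int_upto \<infinity> P"
    "\<And>q. norm q < 1 \<Longrightarrow> (\<lambda>M. \<Prod>n<M. 1 - q ^ Suc n) \<longlonglongrightarrow> eval_fps P q"
    "\<And>q. norm q < 1 \<Longrightarrow> eval_fps P q \<noteq> 0" "fps_nth P 0 = 1" using euler_product_ex by blast
  define V where "V = (\<lambda>\<tau>. (phi21 \<tau> (1 / 2) * phi21 \<tau> (\<tau> / 2) * phi21 \<tau> ((\<tau> + 1) / 2))\<^sup>2 * ee \<tau>)"
  have V: "V \<tau> * eval_fps (fps_X * P ^ 24) (ee \<tau>) = 16" if tau: "Im \<tau> > 0" for \<tau>
  proof -
    define t q p where "t = ee (\<tau> / 2)" "q = ee \<tau>" "p = eval_fps P (ee \<tau>)"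
    have q: "q = t\<^sup>2" using ee_of_nat_mult[of 2 "\<tau> / 2"] by (simp add: t_q_p_def)
    have q1: "norm q < 1" "t \<noteq> 0" using norm_ee_less_1[OF tau] by (auto simp: t_q_p_def)
    have t1: "norm t < 1" using tau by (simp add: t_q_p_def norm_ee_less_1)
    have half: "ee (1 / 2) = - 1" by (simp add: ee_def)
    have s1: "s_at (1 / 2) = s_of (- 1)" by (simp add: s_at_def half)
    have s2: "s_at (\<tau> / 2) = s_of t" by (simp add: s_at_def t_q_p_def)
    have s3: "s_at ((\<tau> + 1) / 2) = s_of (- t)" by (simp add: s_at_def t_q_p_def add_divide_distrib ee_add half)
    define k where "k = theta_prod q (s_of (- 1)) * theta_prod q (s_of t) * theta_prod q (s_of (- t))"
    have p0: "p \<noteq> 0" using P(4)[OF norm_ee_less_1[OF tau]] by (simp add: t_q_p_def)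
    have "k * p ^ 8 * (1 - q) = p\<^sup>2"
      using theta_prod_two_torsion[OF t1 q1(2), of p] P(3)[of q] q1 unfolding k_def q
        by (simp add: t_q_p_def(3) q[symmetric] t_q_p_def(2)[symmetric])
    hence "(k * p ^ 6 * (1 - q)) * p\<^sup>2 = 1 * p\<^sup>2"
      using power_add[of p 6 2] by (simp add: mult_ac)
    hence k: "k * p ^ 6 * (1 - q) = 1" using p0 by (simp del: mult_1)
    have "s_of (- 1) * s_of t * s_of (- t) = 4 * (1 - q)\<^sup>2 / q"
      using q1 unfolding q by (simp add: s_of_alt field_simps power2_eq_square)
    moreover have "phi21 \<tau> (1 / 2) * phi21 \<tau> (\<tau> / 2) * phi21 \<tau> ((\<tau> + 1) / 2) = (s_of (- 1) * s_of t * s_of (- t)) * k\<^sup>2"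
      unfolding phi21_def s1 s2 s3 k_def t_q_p_def(2)[symmetric] by (simp only: power_mult_distrib mult_ac)
    ultimately have "phi21 \<tau> (1 / 2) * phi21 \<tau> (\<tau> / 2) * phi21 \<tau> ((\<tau> + 1) / 2) = 4 * (1 - q)\<^sup>2 / q * k\<^sup>2"
      by simp
    hence "V \<tau> = (4 * (1 - q)\<^sup>2 / q * k\<^sup>2)\<^sup>2 * q" by (simp add: V_def t_q_p_def)
    also have "\<dots> = 16 * k ^ 4 * (1 - q) ^ 4 / q"
      using q1 unfolding q by (simp add: power_mult_distrib power_divide power_mult[symmetric] power2_eq_square power4_eq_xxxx)
    finally have "V \<tau> * (q * p ^ 24) = 16 * k ^ 4 * (1 - q) ^ 4 * p ^ 24"
      using q1 unfolding q by simp
    also have "\<dots> = 16 * (k * p ^ 6 * (1 - q)) ^ 4" by (simp add: power_mult_distrib power_mult[symmetric])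
    also have "\<dots> = 16" by (simp add: k)
    finally have "V \<tau> * (q * p ^ 24) = 16" .
    moreover have "eval_fps (fps_X * P ^ 24) (ee \<tau>) = q * p ^ 24"
      using norm_ee_less_1[OF tau] P(1) by (simp add: ev_mult ev_power disc_fps_power t_q_p_def)
    ultimately show ?thesis by simp
  qed
  have VS: "\<tau> ^ 12 * V (- 1 / \<tau>) = V \<tau>" if tau: "Im \<tau> > 0" for \<tau>
  proof -
    have t0: "\<tau> \<noteq> 0" using tau by auto
    have e: "1 / 2 = \<tau> / 2 / \<tau>" "- 1 / \<tau> / 2 = (- 1 / 2) / \<tau>" "(- 1 / \<tau> + 1) / 2 = ((\<tau> + 1) / 2 - 1) / \<tau>"
      using t0 by (simp_all add: field_simps)
    have 1: "phi21 (- 1 / \<tau>) (1 / 2) = ee (\<tau> / 4) / \<tau>\<^sup>2 * phi21 \<tau> (\<tau> / 2)"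
      unfolding e(1) phi21_S[OF tau] using t0 by (simp add: power2_eq_square)
    have 2: "phi21 (- 1 / \<tau>) (- 1 / \<tau> / 2) = ee (1 / (4 * \<tau>)) / \<tau>\<^sup>2 * phi21 \<tau> (1 / 2)"
      unfolding e(2) phi21_S[OF tau] using phi21_minus[of \<tau> "1 / 2"] by (simp add: power2_eq_square)
    have 3: "phi21 (- 1 / \<tau>) ((- 1 / \<tau> + 1) / 2) = ee (((\<tau> - 1) / 2)\<^sup>2 / \<tau>) / \<tau>\<^sup>2 * phi21 \<tau> ((\<tau> + 1) / 2)"
    proof -
      have 0: "(\<tau> + 1) / 2 - 1 = (\<tau> - 1) / 2" by (simp add: field_simps)
      have "phi21 \<tau> ((\<tau> + 1) / 2) = phi21 \<tau> ((\<tau> - 1) / 2)" using phi21_add_1[of \<tau> "(\<tau> - 1) / 2"] 0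
        by (metis diff_add_cancel)
      thus ?thesis unfolding e(3) phi21_S[OF tau] 0 by simp
    qed
    have "V (- 1 / \<tau>) = (ee (\<tau> / 4) * ee (1 / (4 * \<tau>)) * ee (((\<tau> - 1) / 2)\<^sup>2 / \<tau>))\<^sup>2 * ee (- 1 / \<tau>) / \<tau> ^ 12 *
        (phi21 \<tau> (1 / 2) * phi21 \<tau> (\<tau> / 2) * phi21 \<tau> ((\<tau> + 1) / 2))\<^sup>2"
      unfolding V_def 1 2 3 by (simp add: power_mult_distrib power_divide power_mult[symmetric] mult_ac)
    \<comment> \<open>The exponents add up to \<open>\<tau> - 1\<close>. This is why
      \<open>V\<close> carries the factor \<open>ee \<tau>\<close>: it absorbs the exponentials
      produced by \<open>phi21_S\<close>.\<close>
    also have "(ee (\<tau> / 4) * ee (1 / (4 * \<tau>)) * ee (((\<tau> - 1) / 2)\<^sup>2 / \<tau>))\<^sup>2 * ee (- 1 / \<tau>) = ee (\<tau> - 1)"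
      unfolding power2_eq_square ee_add[symmetric] using t0
      by (intro arg_cong[where f = ee]) (simp add: field_simps power2_eq_square)
    also have "ee (\<tau> - 1) = ee \<tau>" by (simp add: ee_diff)
    finally show ?thesis using t0 by (simp add: V_def mult_ac)
  qed
  have "modular_fps 12 (fps_X * P ^ 24)"
    unfolding modular_fps_def
  proof (intro conjI allI impI)
    show "disc_fps (fps_X * P ^ 24)" using P by (intro disc_fps_mult disc_fps_power disc_fps_X)
    fix \<tau> :: complex assume tau: "Im \<tau> > 0"
    let ?D = "eval_fps (fps_X * P ^ 24)"
    have "V (- 1 / \<tau>) * ?D (ee (- 1 / \<tau>)) = V \<tau> * ?D (ee \<tau>)" using V[OF tau] V[OF Im_S[OF tau]] by simp
    also have "\<dots> = V (- 1 / \<tau>) * (\<tau> ^ 12 * ?D (ee \<tau>))" using VS[OF tau] by (simp add: mult_ac)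
    finally have "?D (ee (- 1 / \<tau>)) = \<tau> ^ 12 * ?D (ee \<tau>)" using V[OF Im_S[OF tau]] by auto
    thus "?D (ee (- 1 / \<tau>)) = \<tau> powi 12 * ?D (ee \<tau>)" by simp
  qed
  moreover have "int_upto \<infinity> (P ^ 24)" "disc_fps (P ^ 24)" using P by auto
  moreover have "fps_nth (P ^ 24) 0 = 1" using P(5) by (simp add: fps_power_zeroth)
  moreover have "eval_fps (P ^ 24) q \<noteq> 0" if "norm q < 1" for q using that P by (simp add: ev_power)
  ultimately show ?thesis by blast
qed

definition Delta_unit :: "complex fps" where
  "Delta_unit = (SOME G. disc_fps G \<and> int_upto \<infinity> G \<and> fps_nth G 0 = 1 \<and> (\<forall>q. norm q < 1 \<longrightarrow> eval_fps G q \<noteq> 0)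
    \<and> modular_fps 12 (fps_X * G))"

definition Delta_fps :: "complex fps" where "Delta_fps = fps_X * Delta_unit"

lemma Delta_unit: "disc_fps Delta_unit" "int_upto \<infinity> Delta_unit" "fps_nth Delta_unit 0 = 1" "\<And>q. norm q < 1 \<Longrightarrow>
  eval_fps Delta_unit q \<noteq> 0" "modular_fps 12 Delta_fps"
  using someI_ex[OF Delta_ex] by (auto simp: Delta_unit_def[symmetric] Delta_fps_def)

lemma ev_Delta: "norm q < 1 \<Longrightarrow> eval_fps Delta_fps q = q * eval_fps Delta_unit q"
  using Delta_unit by (simp add: Delta_fps_def ev_mult)

section \<open>Ring operations on modular forms\<close>

lemma modular_fps_disc: "modular_fps w F \<Longrightarrow> disc_fps F" by (simp add: modular_fps_def)

lemma modular_fps_S: "modular_fps w F \<Longrightarrow> Im \<tau> > 0 \<Longrightarrow> eval_fps F (ee (- 1 / \<tau>)) = \<tau> powi w * eval_fps F (ee \<tau>)"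
  by (simp add: modular_fps_def)

lemma modular_fps_0 [simp, intro]: "modular_fps w 0" by (simp add: modular_fps_def)

lemma modular_fps_const [intro]: "modular_fps 0 (fps_const c)" by (simp add: modular_fps_def)

lemma modular_fps_1 [simp, intro]: "modular_fps 0 1" by (simp add: modular_fps_def)

lemma modular_fps_add [intro]: "modular_fps w F \<Longrightarrow> modular_fps w G \<Longrightarrow> modular_fps w (F + G)"
  and modular_fps_diff [intro]: "modular_fps w F \<Longrightarrow> modular_fps w G \<Longrightarrow> modular_fps w (F - G)"
  unfolding modular_fps_def
  using ev_add[of F G] ev_diff[of F G] norm_ee_less_1 norm_ee_less_1[OF Im_S]
  by (metis (no_types, lifting) disc_fps_add distrib_left, metis (no_types, lifting) disc_fps_diff right_diff_distrib)

lemma modular_fps_mult: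
  assumes "modular_fps v F" "modular_fps w G" shows "modular_fps (v + w) (F * G)"
  unfolding modular_fps_def
proof (intro conjI allI impI)
  show "disc_fps (F * G)" using assms by (auto simp: modular_fps_def)
  fix \<tau> :: complex assume tau: "Im \<tau> > 0"
  hence "\<tau> \<noteq> 0" by auto
  thus "eval_fps (F * G) (ee (- 1 / \<tau>)) = \<tau> powi (v + w) * eval_fps (F * G) (ee \<tau>)"
    using modular_fps_disc[OF assms(1)] modular_fps_disc[OF assms(2)] norm_ee_less_1[OF tau] norm_ee_less_1[OF Im_S[OF tau]]
      modular_fps_S[OF assms(1) tau] modular_fps_S[OF assms(2) tau]
    by (simp add: ev_mult power_int_add)
qed

lemma modular_fps_mult': "modular_fps v F \<Longrightarrow> modular_fps w G \<Longrightarrow> v + w = u \<Longrightarrow> modular_fps u (F * G)"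
  using modular_fps_mult by blast

lemma modular_fps_cmult [intro]: "modular_fps w F \<Longrightarrow> modular_fps w (fps_const c * F)"
  by (rule modular_fps_mult'[OF modular_fps_const]) auto

lemma modular_fps_power: "modular_fps w F \<Longrightarrow> modular_fps (of_nat n * w) (F ^ n)"
  by (induction n) (auto intro!: modular_fps_mult' simp: algebra_simps)

lemma modular_fps_power': "modular_fps w F \<Longrightarrow> of_nat n * w = v \<Longrightarrow> modular_fps v (F ^ n)"
  using modular_fps_power by blast

text \<open>Below height 1/2, a translation to real part at most 1/2 in absolute value gives squared
  norm at most 1/2, so inversion at least doubles the imaginary part. The induction counts the
  doublings.\<close>

lemma fundamental_strip:
  fixes h :: "complex \<Rightarrow> 'a"
  assumes S: "\<And>\<tau>. Im \<tau> > 0 \<Longrightarrow> h (- 1 / \<tau>) = h \<tau>" and T: "\<And>\<tau> n. h (\<tau> + of_int n) = h \<tau>"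
    and tau: "Im \<tau> > 0"
  shows "\<exists>\<tau>'. Im \<tau>' \<ge> 1 / 2 \<and> h \<tau>' = h \<tau>"
proof -
  have main: "Im \<tau> \<ge> 1 / 2 * (1 / 2) ^ n \<Longrightarrow> \<exists>\<tau>'. Im \<tau>' \<ge> 1 / 2 \<and> h \<tau>' = h \<tau>" for n \<tau>
  proof (induction n arbitrary: \<tau>)
    case (Suc n)
    show ?case
    proof (cases "Im \<tau> \<ge> 1 / 2")
      case False
      define t where "t = \<tau> + of_int (- round (Re \<tau>))"
      have Imt: "Im t = Im \<tau>" by (simp add: t_def)
      have pos: "Im t > 0" unfolding Imt using Suc.prems by (rule less_le_trans[rotated]) simp
      have Ret: "\<bar>Re t\<bar> \<le> 1 / 2" using of_int_round_abs_le[of "Re \<tau>"] by (simp add: t_def abs_minus_commute)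
      have "(Re t)\<^sup>2 \<le> (1 / 2)\<^sup>2" using Ret by (metis abs_le_square_iff abs_of_nonneg zero_le_divide_1_iff zero_le_numeral)
      moreover have "(Im t)\<^sup>2 \<le> (1 / 2)\<^sup>2" using False pos Imt by (intro power_mono) auto
      ultimately have n: "(Re t)\<^sup>2 + (Im t)\<^sup>2 \<le> 1 / 2" by (simp add: power2_eq_square)
      have npos: "(Re t)\<^sup>2 + (Im t)\<^sup>2 > 0" using pos by (simp add: sum_power2_gt_zero_iff)
      have "Im (- 1 / t) = Im t / ((Re t)\<^sup>2 + (Im t)\<^sup>2)" by (simp add: Im_divide)
      also have "\<dots> \<ge> Im t / (1 / 2)" using n npos pos by (intro divide_left_mono) auto
      finally have "Im (- 1 / t) \<ge> 2 * Im \<tau>" using Imt by simp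
      hence "Im (- 1 / t) \<ge> 1 / 2 * (1 / 2) ^ n" using Suc.prems by simp
      from Suc.IH[OF this] obtain \<tau>' where "Im \<tau>' \<ge> 1 / 2" "h \<tau>' = h (- 1 / t)" by blast
      moreover have "h t = h \<tau>" unfolding t_def by (rule T)
      ultimately show ?thesis using S[OF pos] by auto
    next
      case True thus ?thesis by blast
    qed
  next
    case 0
    thus ?case by (intro exI[of _ \<tau>]) simp
  qed
  have "(\<lambda>n. 1 / 2 * (1 / 2) ^ n) \<longlonglongrightarrow> 1 / 2 * (0::real)" by (intro tendsto_intros LIMSEQ_power_zero) auto
  hence "eventually (\<lambda>n. 1 / 2 * (1 / 2) ^ n < Im \<tau>) sequentially" using tau by (intro order_tendstoD) auto
  then obtain n where "1 / 2 * (1 / 2) ^ n < Im \<tau>" using eventually_happens' sequentially_bot by blast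
  thus ?thesis using main[of n \<tau>] by simp
qed

text \<open>If the order of vanishing \<open>r\<close> exceeds w/12, then F^12 / Delta^w is an
  invariant function of \<open>q\<close> on the disc that vanishes at 0. By invariance its modulus
  attains its maximum inside the disc, so it is constant and hence 0. The weight may be
  negative.\<close>

lemma modular_fps_eq_0:
  assumes F: "modular_fps w F" and van: "\<And>n. 12 * int n \<le> w \<Longrightarrow> fps_nth F n = 0"
  shows "F = 0"
proof (rule ccontr)
  assume "F \<noteq> 0"
  define r where "r = subdegree F"
  have rw: "12 * int r > w" using van[of r] \<open>F \<noteq> 0\<close> unfolding r_def by (metis not_le nth_subdegree_nonzero)
  define F' where "F' = fps_shift r F"
  have FF': "F = F' * fps_X ^ r" unfolding F'_def r_def by (simp add: subdegree_decompose)
  have dF': "disc_fps F'" using modular_fps_disc[OF F] by (simp add: F'_def disc_fps_def)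
  \<comment> \<open>\<open>d\<close> is the order of vanishing of F^12 / Delta^w at
    \<open>q = 0\<close>; the function \<open>g\<close> below is this quotient with
    \<open>q ^ d\<close> written out. The twelfth power avoids fractional powers of Delta.\<close>
  define d where "d = nat (12 * int r - w)"
  have d: "d > 0" "int d = 12 * int r - w" using rw by (auto simp: d_def)
  define g where "g = (\<lambda>q. q ^ d * eval_fps F' q ^ 12 * eval_fps Delta_unit q powi (- w))"
  have hol: "g holomorphic_on ball 0 1" unfolding g_def
    by (intro holomorphic_intros holomorphic_ev dF' Delta_unit(1)) (use Delta_unit(4) in auto)
  have g: "g (ee \<tau>) = eval_fps F (ee \<tau>) ^ 12 * eval_fps Delta_fps (ee \<tau>) powi (- w)" if "Im \<tau> > 0" for \<tau>
  proof -
    let ?q = "ee \<tau>"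
    have n: "norm ?q < 1" by (rule norm_ee_less_1[OF that])
    have "eval_fps F ?q ^ 12 * eval_fps Delta_fps ?q powi (- w) =
      eval_fps F' ?q ^ 12 * eval_fps Delta_unit ?q powi (- w) * (?q powi (12 * int r) * ?q powi (- w))"
      using n dF' unfolding FF' ev_Delta[OF n]
      by (simp add: ev_mult power_int_mult_distrib power_mult_distrib disc_fps_power power_mult[symmetric]
          power_int_def nat_mult_distrib mult_ac)
    also have "?q powi (12 * int r) * ?q powi (- w) = ?q powi (int d)"
      unfolding d(2) by (subst power_int_add[symmetric]) auto
    finally show ?thesis by (simp add: g_def mult_ac)
  qed
  have gS: "g (ee (- 1 / \<tau>)) = g (ee \<tau>)" if tau: "Im \<tau> > 0" for \<tau>
  proof -
    have t0: "\<tau> \<noteq> 0" using tau by auto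
    have "(\<tau> powi w) ^ 12 * (\<tau> powi 12) powi (- w) = 1"
      unfolding power_int_power' power_int_mult[symmetric] using t0
      by (subst power_int_add[symmetric]) auto
    hence "(\<tau> powi w * a) ^ 12 * (\<tau> powi 12 * b) powi (- w) = a ^ 12 * b powi (- w)" for a b
      unfolding power_mult_distrib power_int_mult_distrib by (metis mult.assoc mult.left_commute mult_1)
    thus ?thesis unfolding g[OF tau] g[OF Im_S[OF tau]] modular_fps_S[OF F tau] modular_fps_S[OF Delta_unit(5) tau] .
  qed
  \<comment> \<open>The radius \<open>exp (- pi)\<close> corresponds to imaginary part 1/2, so by
    \<open>fundamental_strip\<close> every value of \<open>g\<close> on the punctured disc is
    already taken on \<open>?K\<close>.\<close>
  let ?K = "cball (0::complex) (exp (- pi))"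
  have epi: "exp (- pi) < 1" by simp
  have "continuous_on ?K (\<lambda>q. norm (g q))"
    by (intro continuous_on_norm holomorphic_on_imp_continuous_on holomorphic_on_subset[OF hol])
       (use le_less_trans[OF _ epi] in auto)
  then obtain q0 where q0: "q0 \<in> ?K" "\<And>q. q \<in> ?K \<Longrightarrow> norm (g q) \<le> norm (g q0)"
    using continuous_attains_sup[of ?K "\<lambda>q. norm (g q)"] by auto
  have "norm (g q) \<le> norm (g q0)" if "q \<in> ball 0 1" for q
  proof (cases "q = 0")
    case False
    then obtain \<tau> where q: "q = ee \<tau>" using ee_surj by metis
    have tau: "Im \<tau> > 0" using that pi_gt_zero by (simp add: q norm_ee zero_less_mult_iff)
    obtain \<tau>' where t': "Im \<tau>' \<ge> 1 / 2" "g (ee \<tau>') = g (ee \<tau>)"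
      using fundamental_strip[of "\<lambda>\<tau>. g (ee \<tau>)" \<tau>] gS tau by auto
    have "ee \<tau>' \<in> ?K" using t'(1) by (simp add: norm_ee)
    thus ?thesis using q0(2)[of "ee \<tau>'"] t' q by simp
  qed (use q0 in auto)
  moreover have "q0 \<in> ball 0 1" using q0(1) pi_gt_zero by (auto intro: le_less_trans)
  ultimately have "g constant_on ball 0 1"
    by (intro maximum_modulus_principle[OF hol, of "ball 0 1" q0]) auto
  then obtain c where c: "\<And>q. q \<in> ball 0 1 \<Longrightarrow> g q = c" by (auto simp: constant_on_def)
  have "g 0 = 0" using d(1) by (simp add: g_def)
  hence "c = 0" using c[of 0] by simp
  have "F' = 0"
  proof (rule disc_fps_eqI[OF dF'])
    fix q :: complex assume "norm q < 1" "q \<noteq> 0"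
    hence "q ^ d * eval_fps F' q ^ 12 * eval_fps Delta_unit q powi (- w) = 0" using c[of q] \<open>c = 0\<close> by (simp add: g_def)
    thus "eval_fps F' q = eval_fps 0 q" using \<open>q \<noteq> 0\<close> Delta_unit(4)[OF \<open>norm q < 1\<close>] by (simp add: power_int_eq_0_iff)
  qed auto
  thus False using \<open>F \<noteq> 0\<close> FF' by simp
qed

section \<open>Constant terms, integrality and a value of the Eisenstein series\<close>

lemma wp_tail_0: "wp_tail 0 s = 0"
  by (simp add: wp_tail_def wp_term_def lam_def)

lemma wp_tail_fps_nth_nth_0: "fps_nth (fps_nth wp_tail_fps i) 0 = 0"
proof -
  have "wp_tail 0 has_fps_expansion eval_q 0 wp_tail_fps" using wp_tail_fps(1) by (simp add: sq_expansion_def)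
  moreover have "wp_tail 0 = (\<lambda>_. 0)" by (intro ext wp_tail_0)
  ultimately have "eval_q 0 wp_tail_fps = 0" by (metis fps_expansion_eqI has_fps_expansion_0)
  hence "fps_nth (eval_q 0 wp_tail_fps) i = 0" by simp
  thus ?thesis by (simp add: eval_fps_at_0)
qed

lemma E46_nth_0: "fps_nth E4 0 = 1" "fps_nth E6 0 = 1"
  by (simp_all add: E4_def E6_def Z0_def Z1_def wp_tail_fps_nth_nth_0)

lemma E46_int: "int_upto \<infinity> E4" "int_upto \<infinity> E6"
  unfolding E4_def E6_def
  by (intro int_upto_add int_upto_diff int_upto_mult int_upto_1 int_upto_numeral Z0_Z1)+

text \<open>At \<tau> = \<open>\<i>\<close> the nome is real and positive, so every term of the
  series is nonnegative and the real part is at least 1.\<close>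

lemma E4_at_i: "eval_fps E4 (ee \<i>) \<noteq> 0"
proof -
  define r where "r = exp (- 2 * pi)"
  have r: "0 < r" "r < 1" by (auto simp: r_def)
  have *: "2 * of_real pi * \<i> * \<i> = (of_real (- 2 * pi) :: complex)" by (simp add: mult.assoc)
  have q: "ee \<i> = of_real r" unfolding ee_def r_def exp_of_real * ..
  have n: "norm (ee \<i>) < 1" by (rule norm_ee_less_1) simp
  have "wp_tail (ee \<i>) has_fps_expansion eval_q (ee \<i>) wp_tail_fps" by (rule wp_tail_expansion) simp
  from has_fps_expansion_imp_0_eq_fps_nth_0[OF this] have Z: "wp_tail (ee \<i>) 0 = eval_fps Z0 (ee \<i>)" by (simp add: Z0_def)
  have "(\<lambda>M. Re (\<Sum>n<M. wp_term n (ee \<i>) 0)) \<longlonglongrightarrow> Re (wp_tail (ee \<i>) 0)"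
    by (intro tendsto_intros wp_tail_LIMSEQ n)
  moreover have "0 \<le> Re (\<Sum>n<M. wp_term n (ee \<i>) 0)" for M
  proof -
    have "wp_term n (ee \<i>) 0 = of_real (r ^ Suc n / (1 - r ^ Suc n)\<^sup>2 * (1 + 6 * (r ^ Suc n / (1 - r ^ Suc n)\<^sup>2)))" for n
      by (simp add: wp_term_def lam_def q)
    thus ?thesis using r by (auto intro!: sum_nonneg mult_nonneg_nonneg add_nonneg_nonneg)
  qed
  ultimately have "0 \<le> Re (wp_tail (ee \<i>) 0)" by (intro LIMSEQ_le_const) auto
  hence "Re (eval_fps E4 (ee \<i>)) > 0" unfolding eval_E46[OF n] Z[symmetric] by simp
  thus ?thesis by auto
qed

text \<open>The square has weight 4 and is therefore a multiple of \<open>E4\<close> by comparison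
  of constant terms. The transformation law at its fixed point \<open>\<i>\<close> reads F = - F, so
  the square vanishes there while \<open>E4\<close> does not.\<close>

lemma modular_fps_2_eq_0:
  assumes F: "modular_fps 2 F" shows "F = 0"
proof -
  define a where "a = fps_nth F 0"
  have "F ^ 2 - fps_const (a\<^sup>2) * E4 = 0"
  proof (rule modular_fps_eq_0)
    show "modular_fps 4 (F ^ 2 - fps_const (a\<^sup>2) * E4)"
      by (intro modular_fps_diff modular_fps_cmult modular_fps_E4 modular_fps_power'[OF F]) simp
    fix n assume "12 * int n \<le> 4"
    hence "n = 0" by simp
    thus "fps_nth (F ^ 2 - fps_const (a\<^sup>2) * E4) n = 0" by (simp add: a_def fps_power_zeroth E46_nth_0)
  qed
  hence eq: "F ^ 2 = fps_const (a\<^sup>2) * E4" by simp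
  have n: "norm (ee \<i>) < 1" by (rule norm_ee_less_1) simp
  have "eval_fps F (ee (- 1 / \<i>)) = \<i> powi 2 * eval_fps F (ee \<i>)" by (rule modular_fps_S[OF F]) simp
  hence "eval_fps F (ee \<i>) = 0" by simp
  moreover have "eval_fps (F ^ 2) (ee \<i>) = a\<^sup>2 * eval_fps E4 (ee \<i>)"
    unfolding eq using n modular_fps_disc[OF modular_fps_E4] by (simp add: ev_mult)
  ultimately have "a = 0" using E4_at_i n modular_fps_disc[OF F] by (simp add: ev_power)
  hence "F ^ 2 = 0" using eq by simp
  thus "F = 0" by simp
qed

text \<open>\<open>Delta_fps\<close> is \<open>fps_X\<close> times an integral unit. The shift by
  \<open>Suc\<close> in the last property comes from that factor \<open>fps_X\<close>.\<close>

lemma modular_fps_divide_Delta: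
  assumes F: "modular_fps w F" and F0: "fps_nth F 0 = 0"
  obtains G where "modular_fps (w - 12) G" "F = Delta_fps * G"
    "\<And>N. (\<And>n. ereal (real n) \<le> N \<Longrightarrow> fps_nth F (Suc n) \<in> \<int>) \<Longrightarrow> int_upto N G"
proof -
  obtain I where I: "disc_fps I" "Delta_unit * I = 1" "\<And>q. norm q < 1 \<Longrightarrow> eval_fps I q = inverse (eval_fps Delta_unit q)"
    using disc_fps_inverse[OF Delta_unit(1,4)] by blast
  define G where "G = fps_shift 1 F * I"
  have Fs: "fps_shift 1 F * fps_X = F"
  proof (rule fps_ext)
    fix n show "fps_nth (fps_shift 1 F * fps_X) n = fps_nth F n" using F0 by (cases n) simp_all
  qed
  have "Delta_fps * G = (fps_shift 1 F * fps_X) * (Delta_unit * I)" unfolding G_def Delta_fps_def by (simp only: mult_ac)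
  hence FG: "F = Delta_fps * G" unfolding Fs I(2) by simp
  have dG: "disc_fps G" unfolding G_def using modular_fps_disc[OF F] I(1)
    by (auto simp: disc_fps_def intro!: order_trans[OF _ fps_conv_radius_mult])
  have "modular_fps (w - 12) G"
    unfolding modular_fps_def
  proof (intro conjI allI impI dG)
    fix \<tau> :: complex assume tau: "Im \<tau> > 0"
    have t0: "\<tau> \<noteq> 0" using tau by auto
    have n: "norm (ee \<tau>) < 1" "norm (ee (- 1 / \<tau>)) < 1" using norm_ee_less_1 tau Im_S by blast+
    have D: "eval_fps Delta_fps (ee \<tau>) \<noteq> 0" using n Delta_unit(4) by (simp add: ev_Delta)
    have "eval_fps F (ee (- 1 / \<tau>)) = \<tau> powi w * eval_fps F (ee \<tau>)" by (rule modular_fps_S[OF F tau])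
    hence "\<tau> powi 12 * eval_fps Delta_fps (ee \<tau>) * eval_fps G (ee (- 1 / \<tau>)) = \<tau> powi w * (eval_fps Delta_fps (ee \<tau>)
      * eval_fps G (ee \<tau>))"
      unfolding FG ev_mult[OF modular_fps_disc[OF Delta_unit(5)] dG n(1)] ev_mult[OF modular_fps_disc[OF Delta_unit(5)] dG n(2)]
        modular_fps_S[OF Delta_unit(5) tau] .
    hence "\<tau> powi 12 * eval_fps G (ee (- 1 / \<tau>)) = \<tau> powi w * eval_fps G (ee \<tau>)" using D by simp
    thus "eval_fps G (ee (- 1 / \<tau>)) = \<tau> powi (w - 12) * eval_fps G (ee \<tau>)"
      using t0 by (simp add: power_int_diff field_simps)
  qed
  moreover have "int_upto N G" if "\<And>n. ereal (real n) \<le> N \<Longrightarrow> fps_nth F (Suc n) \<in> \<int>" for N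
    unfolding G_def using that int_upto_inverse[OF I(2) Delta_unit(3) int_upto_mono[OF Delta_unit(2)], of N]
    by (intro int_upto_mult) (auto simp: int_upto_def)
  ultimately show ?thesis using that FG by blast
qed

section \<open>Integrality from finitely many coefficients\<close>

lemma even_weight_cases [consumes 1, case_names neg zero two four six]:
  assumes "even (w::int)"
  obtains "w < 0" | "w = 0" | "w = 2" | a where "w = 4 + 4 * int a" | a where "w = 6 + 4 * int a"
proof -
  obtain k where k: "w = 2 * k" using assms by (elim evenE)
  consider "k < 0" | "k = 0" | "k = 1" | j where "k = 2 + 2 * j" "j \<ge> 0" | j where "k = 3 + 2 * j" "j \<ge> 0"
  proof (cases "even k")
    case True
    then obtain i where "k = 2 * i" by (elim evenE)
    thus thesis using that(1,2) that(4)[of "i - 1"] by (cases "i < 0"; cases "i = 0") auto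
  next
    case False
    then obtain i where "k = 2 * i + 1" by (elim oddE)
    thus thesis using that(1,3) that(5)[of "i - 1"] by (cases "i < 0"; cases "i = 0") auto
  qed
  thus thesis
  proof cases
    case (4 j) thus thesis using that(4)[of "nat j"] k by simp
  next
    case (5 j) thus thesis using that(5)[of "nat j"] k by simp
  qed (use that k in auto)
qed

lemma eisenstein_monomial:
  assumes "w = 0 \<or> w \<ge> 4" "even w"
  obtains g where "modular_fps w g" "int_upto \<infinity> g" "fps_nth g 0 = 1"
  using assms(2)
proof (cases w rule: even_weight_cases)
  case (four a)
  have "modular_fps w (E4 ^ (a + 1))" by (rule modular_fps_power'[OF modular_fps_E4]) (simp add: four)
  moreover have "int_upto \<infinity> (E4 ^ (a + 1))" using E46_int by (intro int_upto_power)
  ultimately show thesis using that[of "E4 ^ (a + 1)"] by (simp add: fps_power_zeroth E46_nth_0)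
next
  case (six a)
  have "modular_fps w (E4 ^ a * E6)" by (rule modular_fps_mult'[OF modular_fps_power[OF modular_fps_E4]
    modular_fps_E6]) (simp add: six)
  moreover have "int_upto \<infinity> (E4 ^ a * E6)" using E46_int by (intro int_upto_mult int_upto_power)
  ultimately show thesis using that[of "E4 ^ a * E6"] by (simp add: fps_power_zeroth E46_nth_0)
next
  case zero
  thus thesis using that[of 1] by auto
qed (use assms in auto)

text \<open>Each step subtracts an integral multiple of an Eisenstein monomial with constant term 1
  and divides by Delta. The coefficient of index n is consumed at weight \<open>w - 12 * n\<close>;
  at weight 2 the remaining form is 0, which explains the exception.\<close>

lemma modular_fps_integral:
  assumes "modular_fps w F" "even w" "\<And>n. 12 * int n \<le> w \<Longrightarrow> w - 12 * int n \<noteq> 2 \<Longrightarrow> fps_nth F n \<in> \<int>"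
  shows "int_upto \<infinity> F"
  using assms
proof (induction "nat w" arbitrary: w F rule: less_induct)
  case (less w F)
  show ?case
  proof (cases "w < 0 \<or> w = 2")
    case True
    hence "F = 0" using modular_fps_eq_0[OF less.prems(1)] modular_fps_2_eq_0 less.prems(1) by force
    thus ?thesis by simp
  next
    case False
    hence w: "w = 0 \<or> w \<ge> 4" using less.prems(2) by (auto elim!: evenE)
    obtain g where g: "modular_fps w g" "int_upto \<infinity> g" "fps_nth g 0 = 1"
      using eisenstein_monomial[OF w less.prems(2)] by blast
    define c where "c = fps_nth F 0"
    have c: "c \<in> \<int>" unfolding c_def using w by (intro less.prems(3)) auto
    define F' where "F' = F - fps_const c * g"
    have F': "modular_fps w F'" unfolding F'_def by (intro modular_fps_diff modular_fps_cmult g less.prems)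
    have cg: "int_upto \<infinity> (fps_const c * g)" by (intro int_upto_mult int_upto_const c g)
    obtain G where G: "modular_fps (w - 12) G" "F' = Delta_fps * G"
      "\<And>N. (\<And>n. ereal (real n) \<le> N \<Longrightarrow> fps_nth F' (Suc n) \<in> \<int>) \<Longrightarrow> int_upto N G"
      by (rule modular_fps_divide_Delta[OF F']) (use g in \<open>auto simp: F'_def c_def\<close>)
    have iG: "int_upto \<infinity> G"
    proof (cases "w = 0")
      case True
      hence "G = 0" using modular_fps_eq_0[OF G(1)] by simp
      thus ?thesis by simp
    next
      case False
      show ?thesis
      proof (rule less.hyps[OF _ G(1)])
        show "nat (w - 12) < nat w" using w False by simp
        show "even (w - 12)" using less.prems(2) by simp
        fix n assume n: "12 * int n \<le> w - 12" "w - 12 - 12 * int n \<noteq> 2"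
        have "int_upto (ereal (real n)) G"
        proof (rule G(3))
          fix i assume "ereal (real i) \<le> ereal (real n)"
          hence i: "i \<le> n" by simp
          \<comment> \<open>For \<open>i < n\<close> the remaining weight is at least 12, so the
            exceptional weight 2 can only be met at \<open>i = n\<close>, where the hypothesis on
            \<open>n\<close> excludes it.\<close>
          have "fps_nth F (Suc i) \<in> \<int>"
            by (rule less.prems(3)) (use i n in \<open>cases "i = n"; simp\<close>)+
          thus "fps_nth F' (Suc i) \<in> \<int>" using cg by (auto simp: F'_def int_upto_def)
        qed
        thus "fps_nth G n \<in> \<int>" by (simp add: int_upto_def)
      qed
    qed
    have "F = fps_const c * g + Delta_fps * G" using G(2) by (simp add: F'_def algebra_simps)
    thus ?thesis using cg iG Delta_unit(2) unfolding Delta_fps_def by (auto intro!: int_upto_add int_upto_mult)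
  qed
qed

section \<open>Integral polynomials in the Weierstrass function\<close>

definition int_poly :: "ereal \<Rightarrow> complex fps poly \<Rightarrow> bool" where
  "int_poly N Q \<longleftrightarrow> (\<forall>i. int_upto N (coeff Q i))"

lemma int_poly_intros [intro]:
  "int_poly N 0" "int_poly N 1"
  "int_poly N P \<Longrightarrow> int_poly N Q \<Longrightarrow> int_poly N (P + Q)"
  "int_poly N P \<Longrightarrow> int_poly N Q \<Longrightarrow> int_poly N (P - Q)"
  "int_poly N P \<Longrightarrow> int_poly N (- P)"
  "int_poly N P \<Longrightarrow> int_poly N Q \<Longrightarrow> int_poly N (P * Q)"
  by (auto simp: int_poly_def coeff_mult coeff_1)

lemma int_poly_power [intro]: "int_poly N P \<Longrightarrow> int_poly N (P ^ n)"
  by (induction n) auto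

lemma int_poly_const [intro]: "int_upto N F \<Longrightarrow> int_poly N [:F:]"
  by (auto simp: int_poly_def coeff_pCons split: nat.splits)

lemma int_poly_numeral [intro]: "int_poly N (numeral n)"
proof -
  have "(numeral n :: complex fps poly) = [:numeral n:]" by (simp add: numeral_poly)
  thus ?thesis using int_poly_const[OF int_upto_numeral] by metis
qed

lemma int_poly_X [intro]: "int_poly N [:0, 1:]"
  by (auto simp: int_poly_def coeff_pCons split: nat.splits)

definition twelfth :: "complex fps" where "twelfth = fps_const (1 / 12)"

definition shift_poly :: "complex fps poly \<Rightarrow> complex fps poly" where "shift_poly Q = pcompose Q [:twelfth, 1:]"

lemma shift_poly_simps [simp]: "shift_poly 0 = 0" "shift_poly 1 = 1" "shift_poly (P + Q) = shift_poly P + shift_poly Q"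
  "shift_poly (P - Q) = shift_poly P - shift_poly Q"
  "shift_poly (P * Q) = shift_poly P * shift_poly Q" "shift_poly [:F:] = [:F:]" "shift_poly (numeral n) = numeral n"
  by (simp_all add: shift_poly_def pcompose_add pcompose_diff pcompose_mult pcompose_1 numeral_poly pcompose_pCons)

lemma shift_poly_power [simp]: "shift_poly (P ^ n) = shift_poly P ^ n"
  by (induction n) auto

lemma shift_poly_X: "shift_poly [:0, 1:] = [:0, 1:] + [:twelfth:]"
  by (simp add: shift_poly_def pcompose_pCons)

lemma degree_shift_poly: "degree Q \<le> m \<Longrightarrow> degree (shift_poly Q) \<le> m"
  by (simp add: shift_poly_def degree_pcompose)

lemma shift_poly_pCons: "shift_poly (pCons a p) = [:a:] + [:twelfth, 1:] * shift_poly p"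
  by (simp add: shift_poly_def pcompose_pCons)

lemma coeff_shift_poly_top: "degree Q \<le> m \<Longrightarrow> coeff (shift_poly Q) m = coeff Q m"
proof (induction m arbitrary: Q)
  case 0
  then obtain a where "Q = [:a:]" using degree_eq_zeroE by auto
  thus ?case by simp
next
  case (Suc m)
  obtain a p where Q: "Q = pCons a p" by (cases Q)
  have p: "degree p \<le> m" using Suc.prems by (auto simp: Q split: if_splits)
  hence "coeff (shift_poly p) (Suc m) = 0" using degree_shift_poly[OF p] by (intro coeff_eq_0) simp
  thus ?case using Suc.IH[OF p] by (simp add: Q shift_poly_pCons)
qed

text \<open>Binomial expansion one degree below the top. The factor \<open>Suc m\<close> times 1/12
  is what makes divisibility by 12 appear in the condition on leading coefficients.\<close>

lemma coeff_shift_poly_next: "degree Q \<le> Suc m \<Longrightarrow> coeff (shift_poly Q) m = coeff Q m + of_nat (Suc m) * twelfth * coeff Q (Suc m)"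
proof (induction m arbitrary: Q)
  case 0
  obtain a p where Q: "Q = pCons a p" by (cases Q)
  have p: "degree p \<le> 0" using 0 by (auto simp: Q split: if_splits)
  thus ?case using coeff_shift_poly_top[OF p] by (simp add: Q shift_poly_pCons)
next
  case (Suc m)
  obtain a p where Q: "Q = pCons a p" by (cases Q)
  have p: "degree p \<le> Suc m" using Suc.prems by (auto simp: Q split: if_splits)
  show ?case using Suc.IH[OF p] coeff_shift_poly_top[OF p] by (simp add: Q shift_poly_pCons algebra_simps)
qed

lemma coeff_mult_top:
  assumes "degree P \<le> m" "degree Q \<le> n"
  shows "coeff (P * Q) (m + n) = coeff P m * coeff Q n"
proof -
  have "coeff (P * Q) (m + n) = (\<Sum>i\<le>m + n. coeff P i * coeff Q (m + n - i))" by (rule coeff_mult)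
  also have "\<dots> = (\<Sum>i\<in>{m}. coeff P i * coeff Q (m + n - i))"
  proof (rule sum.mono_neutral_right)
    show "\<forall>i\<in>{..m + n} - {m}. coeff P i * coeff Q (m + n - i) = 0"
    proof
      fix i assume "i \<in> {..m + n} - {m}"
      hence "i > m \<or> m + n - i > n" by auto
      thus "coeff P i * coeff Q (m + n - i) = 0" using assms by (auto simp: coeff_eq_0)
    qed
  qed auto
  finally show ?thesis by simp
qed

text \<open>\<open>jacobi_poly w m Q\<close>: substituting the Weierstrass function for the variable of \<open>Q\<close> and multiplying by the
  \<open>m\<close>-th power of \<open>phi21\<close> gives a form of weight \<open>w\<close> and index \<open>m\<close>. Its expansion is integral iff
  \<open>shift_poly Q\<close> has integral coefficients, because \<open>wp = wp0 + 1 / 12\<close>.\<close>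

definition jacobi_poly :: "int \<Rightarrow> nat \<Rightarrow> complex fps poly \<Rightarrow> bool" where
  "jacobi_poly w m Q \<longleftrightarrow> degree Q \<le> m \<and> (\<forall>i. modular_fps (w + 2 * (int m - int i)) (coeff Q i))"

lemma jacobi_poly_0 [intro]: "jacobi_poly w m 0" by (simp add: jacobi_poly_def)

lemma jacobi_poly_add [intro]: "jacobi_poly w m P \<Longrightarrow> jacobi_poly w m Q \<Longrightarrow> jacobi_poly w m (P + Q)"
  and jacobi_poly_diff [intro]: "jacobi_poly w m P \<Longrightarrow> jacobi_poly w m Q \<Longrightarrow> jacobi_poly w m (P - Q)"
  by (auto simp: jacobi_poly_def intro: degree_add_le degree_diff_le)

lemma modular_fps_sum: "(\<And>i. i \<in> I \<Longrightarrow> modular_fps w (F i)) \<Longrightarrow> modular_fps w (\<Sum>i\<in>I. F i)"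
  by (induction I rule: infinite_finite_induct) auto

lemma jacobi_poly_mult:
  assumes "jacobi_poly v m P" "jacobi_poly w n Q" shows "jacobi_poly (v + w) (m + n) (P * Q)"
  unfolding jacobi_poly_def
proof (intro conjI allI)
  show "degree (P * Q) \<le> m + n" using assms degree_mult_le[of P Q] by (auto simp: jacobi_poly_def)
  fix i show "modular_fps (v + w + 2 * (int (m + n) - int i)) (coeff (P * Q) i)"
    unfolding coeff_mult
  proof (rule modular_fps_sum)
    fix j assume j: "j \<in> {..i}"
    have 1: "modular_fps (v + 2 * (int m - int j)) (coeff P j)" "modular_fps (w + 2 * (int n - int (i - j))) (coeff Q (i - j))"
      using assms unfolding jacobi_poly_def by blast+
    have *: "v + 2 * (int m - int j) + (w + 2 * (int n - int (i - j))) = v + w + 2 * (int (m + n) - int i)" using j by simp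
    show "modular_fps (v + w + 2 * (int (m + n) - int i)) (coeff P j * coeff Q (i - j))"
      by (rule modular_fps_mult'[OF 1 *])
  qed
qed

lemma jacobi_poly_const: "modular_fps (w + 2 * int m) F \<Longrightarrow> jacobi_poly w m [:F:]"
  by (auto simp: jacobi_poly_def coeff_pCons split: nat.splits)

lemma jacobi_poly_mult': "jacobi_poly v m P \<Longrightarrow> jacobi_poly w n Q \<Longrightarrow> v + w = u \<Longrightarrow> m + n = k \<Longrightarrow> jacobi_poly u k (P * Q)"
  using jacobi_poly_mult by blast

text \<open>The leading coefficients that can be removed from a form without losing integrality. For
  fixed weight and index they form an additive group, and products add weights and indices, so a few
  explicit polynomials generate all that is required.\<close>

definition integral_lead :: "int \<Rightarrow> nat \<Rightarrow> complex fps \<Rightarrow> bool" where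
  "integral_lead w m g \<longleftrightarrow> (\<exists>Q. jacobi_poly w m Q \<and> int_poly \<infinity> (shift_poly Q) \<and> coeff Q m = g)"

lemma integral_lead_I: "jacobi_poly w m Q \<Longrightarrow> int_poly \<infinity> (shift_poly Q) \<Longrightarrow> coeff Q m = g \<Longrightarrow> integral_lead w m g"
  by (auto simp: integral_lead_def)

lemma integral_lead_0: "integral_lead w m 0"
  by (rule integral_lead_I[of _ _ 0]) auto

lemma integral_lead_add: "integral_lead w m g \<Longrightarrow> integral_lead w m h \<Longrightarrow> integral_lead w m (g + h)"
  unfolding integral_lead_def by (metis jacobi_poly_add int_poly_intros(3) shift_poly_simps(3) coeff_add)

lemma integral_lead_diff: "integral_lead w m g \<Longrightarrow> integral_lead w m h \<Longrightarrow> integral_lead w m (g - h)"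
  unfolding integral_lead_def by (metis jacobi_poly_diff int_poly_intros(4) shift_poly_simps(4) coeff_diff)

lemma integral_lead_mult: assumes "integral_lead v m g" "integral_lead w n h" "v + w = u"
  "m + n = k" shows "integral_lead u k (g * h)"
proof -
  obtain P Q where PQ: "jacobi_poly v m P" "int_poly \<infinity> (shift_poly P)" "coeff P m = g" "jacobi_poly w n Q"
    "int_poly \<infinity> (shift_poly Q)" "coeff Q n = h"
    using assms unfolding integral_lead_def by auto
  show ?thesis
  proof (rule integral_lead_I)
    show "jacobi_poly u k (P * Q)" using PQ assms by (intro jacobi_poly_mult')
    show "int_poly \<infinity> (shift_poly (P * Q))" using PQ by auto
    show "coeff (P * Q) k = g * h"
      using coeff_mult_top[of P m Q n] PQ assms by (auto simp: jacobi_poly_def)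
  qed
qed

lemma integral_lead_const: "modular_fps w F \<Longrightarrow> int_upto \<infinity> F \<Longrightarrow> integral_lead w 0 F"
  by (rule integral_lead_I[of _ _ "[:F:]"]) (auto intro!: jacobi_poly_const)

lemma integral_lead_cmult: "integral_lead w m g \<Longrightarrow> c \<in> \<int> \<Longrightarrow> integral_lead w m (fps_const c * g)"
  by (rule integral_lead_mult[of 0 0 _ w m]) (auto intro!: integral_lead_const modular_fps_const int_upto_const)

lemma integral_lead_numeral: "integral_lead w m g \<Longrightarrow> integral_lead w m (numeral n * g)"
  using integral_lead_cmult[of w m g "numeral n"] by (simp add: numeral_fps_const)

lemma const_poly_ring:
  "[:a * b:] = [:a:] * [:b:]" "[:a ^ n:] = [:a:] ^ n" "[:numeral k:] = (numeral k :: complex fps poly)"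
  for a b :: "complex fps"
proof -
  show "[:a * b:] = [:a:] * [:b:]" for a b :: "complex fps" by simp
  note * = this
  show "[:a ^ n:] = [:a:] ^ n"
  proof (induction n)
    case (Suc n)
    show ?case unfolding power_Suc Suc[symmetric] by (rule *)
  qed (simp add: one_pCons)
qed (simp add: numeral_poly)

section \<open>Explicit integral forms of index at most 4\<close>

lemma jacobi_poly_monom:
  assumes "i \<le> m" "modular_fps (w + 2 * (int m - int i)) a" shows "jacobi_poly w m (monom a i)"
  using assms degree_monom_le[of a i] by (auto simp: jacobi_poly_def)

lemma modular_fps_numeral [intro]: "modular_fps w F \<Longrightarrow> modular_fps w (numeral n * F)"
  unfolding numeral_fps_const by (rule modular_fps_cmult)

lemma modular_fps_twelfth [intro]: "modular_fps w F \<Longrightarrow> modular_fps w (twelfth * F)" "modular_fps w F \<Longrightarrow>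
  modular_fps w (twelfth ^ j * F)"
proof -
  show *: "modular_fps w F \<Longrightarrow> modular_fps w (twelfth * F)" for F unfolding twelfth_def by (rule modular_fps_cmult)
  show "modular_fps w F \<Longrightarrow> modular_fps w (twelfth ^ j * F)" by (induction j) (auto simp: mult.assoc intro: *)
qed

lemma modular_fps_num0: "modular_fps 0 (numeral n)"
  using modular_fps_const[of "numeral n"] by (simp add: numeral_fps_const)

lemma modular_fps_E_products: "modular_fps 8 (E4 ^ 2)" "modular_fps 10 (E4 * E6)" "modular_fps 12 (E4 ^ 3)"
  by (auto intro!: modular_fps_power'[OF modular_fps_E4] modular_fps_mult'[OF modular_fps_E4 modular_fps_E6])

lemma shift_poly_monom: "shift_poly (monom a i) = [:a:] * ([:0, 1:] + [:twelfth:]) ^ i"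
proof -
  have "monom a i = smult a ([:0, 1:] ^ i)" by (rule monom_altdef)
  also have "\<dots> = [:a:] * [:0, 1:] ^ i" by (simp only: mult_pCons_left mult_zero_left pCons_0_0 add_0_right)
  finally show ?thesis by (simp only: shift_poly_simps(5,6) shift_poly_power shift_poly_X)
qed

lemma twelfth_poly: "12 * [:twelfth:] = (1 :: complex fps poly)"
proof -
  have "twelfth * 12 = 1" by (simp add: twelfth_def numeral_fps_const)
  thus ?thesis by (simp add: numeral_poly one_pCons)
qed

lemma E46_poly: "[:E4:] = 1 + 240 * [:Z0:]" "[:E6:] = 1 - 504 * [:Z0:] - 6048 * [:Z1:]"
  by (simp_all add: E4_def E6_def numeral_poly one_pCons)

lemma int_poly_gens: "int_poly \<infinity> [:Z0:]" "int_poly \<infinity> [:Z1:]" "int_poly \<infinity> [:E4:]" "int_poly \<infinity> [:E6:]"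
  using Z0_Z1 E46_int by auto

context
  fixes c P R e z X :: "complex fps poly"
  assumes c: "12 * c = 1" and P: "P = 1 + 240 * e" and R: "R = 1 - 504 * e - 6048 * z"
begin

text \<open>With \<open>e = z = 0\<close> the three weight 0 polynomials become
  \<open>6 * X * (X + 2 * c)\<close>, \<open>4 * X\<^sup>2 * (X + 3 * c)\<close> and
  \<open>3 * X ^ 3 * (X + 4 * c)\<close>, which are integral as \<open>12 * c = 1\<close>. They
  correspond to Gritsenko's generators of weight 0 and index 2, 3, 4, whose constant terms in
  \<open>q\<close> are the Laurent polynomials \<zeta> + 4 + 1/\<zeta>, \<zeta> + 2 + 1/\<zeta> and
  \<zeta> + 1 + 1/\<zeta>.\<close>

lemma shift_U2: "6 * (X + c) ^ 2 - 6 * c ^ 2 * P = 6 * X ^ 2 + X - 10 * e"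
  using c P R by algebra

lemma shift_U3: "4 * (X + c) ^ 3 - 12 * c ^ 2 * P * (X + c) + 8 * c ^ 3 * R = 4 * X ^ 3 + X ^ 2 - 20 * e * X - 4 * (e + 7 * z)"
  using c P R by algebra

lemma shift_U4: "3 * (X + c) ^ 4 - 18 * c ^ 2 * P * (X + c) ^ 2 + 24 * c ^ 3 * R * (X + c) - 9 * c ^ 4 * P ^ 2
    = 3 * X ^ 4 + X ^ 3 - 30 * e * X ^ 2 - 12 * (e + 7 * z) * X - e - 7 * z - 25 * e ^ 2"
  using c P R by algebra

text \<open>These polynomials expand \<open>(x - c) ^ j\<close> with \<open>x = X + c\<close>,
  multiplying the i-th power of \<open>c\<close> by a form of weight 4 + 2 i and constant term 1,
  namely \<open>P\<close>, \<open>R\<close>, \<open>P ^ 2\<close>, \<open>P * R\<close>. With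
  \<open>e = z = 0\<close> only \<open>X ^ j\<close> remains, and in the other terms the powers of
  12 cancel.\<close>

lemma shift_A1: "P * (X + c) - c * R = P * X + 62 * e + 504 * z"
  using c P R by algebra

lemma shift_A2: "P * (X + c) ^ 2 - 2 * c * R * (X + c) + c ^ 2 * P ^ 2 =
    P * X ^ 2 + (124 * e + 1008 * z) * X + 12 * e + 84 * z + 400 * e ^ 2"
  using c P R by algebra

lemma shift_A3: "P * (X + c) ^ 3 - 3 * c * R * (X + c) ^ 2 + 3 * c ^ 2 * P ^ 2 * (X + c) - c ^ 3 * (P * R) =
    P * X ^ 3 + (186 * e + 1512 * z) * X ^ 2 + (36 * e + 252 * z + 1200 * e ^ 2) * X + 2 * e + 14 * z + 170 * e ^ 2 + 840 * e * z"
  using c P R by algebra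

text \<open>The same construction starting in weight 6, with the forms \<open>R\<close>,
  \<open>P ^ 2\<close>, \<open>P * R\<close>, \<open>P ^ 3\<close>.\<close>

lemma shift_B1: "R * (X + c) - c * P ^ 2 = R * X - (82 * e + 504 * z + 4800 * e ^ 2)"
  using c P R by algebra

lemma shift_B2: "R * (X + c) ^ 2 - 2 * c * P ^ 2 * (X + c) + c ^ 2 * (P * R) =
    R * X ^ 2 - (164 * e + 1008 * z + 9600 * e ^ 2) * X - (12 * e + 84 * z + 1640 * e ^ 2 + 10080 * e * z)"
  using c P R by algebra

lemma shift_B3: "R * (X + c) ^ 3 - 3 * c * P ^ 2 * (X + c) ^ 2 + 3 * c ^ 2 * (P * R) * (X + c) - c ^ 3 * P ^ 3 =
    R * X ^ 3 - (246 * e + 1512 * z + 14400 * e ^ 2) * X ^ 2 - (36 * e + 252 * z + 4920 * e ^ 2 + 30240 * e * z) * X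
    - (2 * e + 14 * z + 410 * e ^ 2 + 2520 * e * z + 8000 * e ^ 3)"
  using c P R by algebra

end

lemmas shifts = shift_U2[OF twelfth_poly E46_poly] shift_U3[OF twelfth_poly E46_poly] shift_U4[OF twelfth_poly E46_poly]
  shift_A1[OF twelfth_poly E46_poly] shift_A2[OF twelfth_poly E46_poly] shift_A3[OF twelfth_poly E46_poly]
  shift_B1[OF twelfth_poly E46_poly] shift_B2[OF twelfth_poly E46_poly] shift_B3[OF twelfth_poly E46_poly]

lemmas int_poly_rules = int_poly_intros(3-6) int_poly_power int_poly_numeral int_poly_X int_poly_gens
lemmas modular_fps_rules = modular_fps_numeral modular_fps_twelfth modular_fps_num0 modular_fps_E4 modular_fps_E6
  modular_fps_E_products

lemma integral_lead_U2: "integral_lead 0 2 6"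
proof (rule integral_lead_I)
  let ?Q = "monom 6 2 - monom (6 * (twelfth ^ 2 * E4)) 0"
  show "jacobi_poly 0 2 ?Q" by (intro jacobi_poly_add jacobi_poly_diff jacobi_poly_monom) (auto intro!: modular_fps_rules)
  have "shift_poly ?Q = 6 * [:0, 1:] ^ 2 + [:0, 1:] - 10 * [:Z0:]"
    unfolding shifts[symmetric] shift_poly_simps shift_poly_monom const_poly_ring
      by (simp only: power_0 power_one_right mult_1_right mult.assoc)
  thus "int_poly \<infinity> (shift_poly ?Q)" by (simp only:) (intro int_poly_rules)
  show "coeff ?Q 2 = 6" by simp
qed

lemma integral_lead_U3: "integral_lead 0 3 4"
proof (rule integral_lead_I)
  let ?Q = "monom 4 3 - monom (12 * (twelfth ^ 2 * E4)) 1 + monom (8 * (twelfth ^ 3 * E6)) 0"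
  show "jacobi_poly 0 3 ?Q" by (intro jacobi_poly_add jacobi_poly_diff jacobi_poly_monom) (auto intro!: modular_fps_rules)
  have "shift_poly ?Q = 4 * [:0, 1:] ^ 3 + [:0, 1:] ^ 2 - 20 * [:Z0:] * [:0, 1:] - 4 * ([:Z0:] + 7 * [:Z1:])"
    unfolding shifts[symmetric] shift_poly_simps shift_poly_monom const_poly_ring
      by (simp only: power_0 power_one_right mult_1_right mult.assoc)
  thus "int_poly \<infinity> (shift_poly ?Q)" by (simp only:) (intro int_poly_rules)
  show "coeff ?Q 3 = 4" by simp
qed

lemma integral_lead_U4: "integral_lead 0 4 3"
proof (rule integral_lead_I)
  let ?Q = "monom 3 4 - monom (18 * (twelfth ^ 2 * E4)) 2 + monom (24 * (twelfth ^ 3 * E6)) 1 - monom (9 * (twelfth ^ 4 * E4 ^ 2))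
    0"
  show "jacobi_poly 0 4 ?Q" by (intro jacobi_poly_add jacobi_poly_diff jacobi_poly_monom) (auto intro!: modular_fps_rules)
  have "shift_poly ?Q = 3 * [:0, 1:] ^ 4 + [:0, 1:] ^ 3 - 30 * [:Z0:] * [:0, 1:] ^ 2 - 12 * ([:Z0:] + 7 * [:Z1:]) * [:0, 1:]
    - [:Z0:] - 7 * [:Z1:] - 25 * [:Z0:] ^ 2"
    unfolding shifts[symmetric] shift_poly_simps shift_poly_monom const_poly_ring
      by (simp only: power_0 power_one_right mult_1_right mult.assoc)
  thus "int_poly \<infinity> (shift_poly ?Q)" by (simp only:) (intro int_poly_rules)
  show "coeff ?Q 4 = 3" by simp
qed

lemma integral_lead_A1: "integral_lead 4 1 E4"
proof (rule integral_lead_I)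
  let ?Q = "monom E4 1 - monom (twelfth * E6) 0"
  show "jacobi_poly 4 1 ?Q" by (intro jacobi_poly_add jacobi_poly_diff jacobi_poly_monom) (auto intro!: modular_fps_rules)
  have "shift_poly ?Q = [:E4:] * [:0, 1:] + 62 * [:Z0:] + 504 * [:Z1:]"
    unfolding shifts[symmetric] shift_poly_simps shift_poly_monom const_poly_ring
      by (simp only: power_0 power_one_right mult_1_right mult.assoc)
  thus "int_poly \<infinity> (shift_poly ?Q)" by (simp only:) (intro int_poly_rules)
  show "coeff ?Q 1 = E4" by simp
qed

lemma integral_lead_A2: "integral_lead 4 2 E4"
proof (rule integral_lead_I)
  let ?Q = "monom E4 2 - monom (2 * (twelfth * E6)) 1 + monom (twelfth ^ 2 * E4 ^ 2) 0"
  show "jacobi_poly 4 2 ?Q" by (intro jacobi_poly_add jacobi_poly_diff jacobi_poly_monom) (auto intro!: modular_fps_rules)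
  have "shift_poly ?Q = [:E4:] * [:0, 1:] ^ 2 + (124 * [:Z0:] + 1008 * [:Z1:]) * [:0, 1:] + 12 * [:Z0:] + 84 * [:Z1:]
    + 400 * [:Z0:] ^ 2"
    unfolding shifts[symmetric] shift_poly_simps shift_poly_monom const_poly_ring
      by (simp only: power_0 power_one_right mult_1_right mult.assoc)
  thus "int_poly \<infinity> (shift_poly ?Q)" by (simp only:) (intro int_poly_rules)
  show "coeff ?Q 2 = E4" by simp
qed

lemma integral_lead_A3: "integral_lead 4 3 E4"
proof (rule integral_lead_I)
  let ?Q = "monom E4 3 - monom (3 * (twelfth * E6)) 2 + monom (3 * (twelfth ^ 2 * E4 ^ 2)) 1 - monom (twelfth ^ 3 * (E4 * E6)) 0"
  show "jacobi_poly 4 3 ?Q" by (intro jacobi_poly_add jacobi_poly_diff jacobi_poly_monom) (auto intro!: modular_fps_rules)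
  have "shift_poly ?Q = [:E4:] * [:0, 1:] ^ 3 + (186 * [:Z0:] + 1512 * [:Z1:]) * [:0, 1:] ^ 2 + (36 * [:Z0:] + 252 * [:Z1:]
    + 1200 * [:Z0:] ^ 2) * [:0, 1:] + 2 * [:Z0:] + 14 * [:Z1:] + 170 * [:Z0:] ^ 2 + 840 * [:Z0:] * [:Z1:]"
    unfolding shifts[symmetric] shift_poly_simps shift_poly_monom const_poly_ring
      by (simp only: power_0 power_one_right mult_1_right mult.assoc)
  thus "int_poly \<infinity> (shift_poly ?Q)" by (simp only:) (intro int_poly_rules)
  show "coeff ?Q 3 = E4" by simp
qed

lemma integral_lead_B1: "integral_lead 6 1 E6"
proof (rule integral_lead_I)
  let ?Q = "monom E6 1 - monom (twelfth * E4 ^ 2) 0"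
  show "jacobi_poly 6 1 ?Q" by (intro jacobi_poly_add jacobi_poly_diff jacobi_poly_monom) (auto intro!: modular_fps_rules)
  have "shift_poly ?Q = [:E6:] * [:0, 1:] - (82 * [:Z0:] + 504 * [:Z1:] + 4800 * [:Z0:] ^ 2)"
    unfolding shifts[symmetric] shift_poly_simps shift_poly_monom const_poly_ring
      by (simp only: power_0 power_one_right mult_1_right mult.assoc)
  thus "int_poly \<infinity> (shift_poly ?Q)" by (simp only:) (intro int_poly_rules)
  show "coeff ?Q 1 = E6" by simp
qed

lemma integral_lead_B2: "integral_lead 6 2 E6"
proof (rule integral_lead_I)
  let ?Q = "monom E6 2 - monom (2 * (twelfth * E4 ^ 2)) 1 + monom (twelfth ^ 2 * (E4 * E6)) 0"
  show "jacobi_poly 6 2 ?Q" by (intro jacobi_poly_add jacobi_poly_diff jacobi_poly_monom) (auto intro!: modular_fps_rules)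
  have "shift_poly ?Q = [:E6:] * [:0, 1:] ^ 2 - (164 * [:Z0:] + 1008 * [:Z1:] + 9600 * [:Z0:] ^ 2) * [:0, 1:] - (12 * [:Z0:]
    + 84 * [:Z1:] + 1640 * [:Z0:] ^ 2 + 10080 * [:Z0:] * [:Z1:])"
    unfolding shifts[symmetric] shift_poly_simps shift_poly_monom const_poly_ring
      by (simp only: power_0 power_one_right mult_1_right mult.assoc)
  thus "int_poly \<infinity> (shift_poly ?Q)" by (simp only:) (intro int_poly_rules)
  show "coeff ?Q 2 = E6" by simp
qed

lemma integral_lead_B3: "integral_lead 6 3 E6"
proof (rule integral_lead_I)
  let ?Q = "monom E6 3 - monom (3 * (twelfth * E4 ^ 2)) 2 + monom (3 * (twelfth ^ 2 * (E4 * E6))) 1 - monom (twelfth ^ 3 * E4 ^ 3)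
    0"
  show "jacobi_poly 6 3 ?Q" by (intro jacobi_poly_add jacobi_poly_diff jacobi_poly_monom) (auto intro!: modular_fps_rules)
  have "shift_poly ?Q = [:E6:] * [:0, 1:] ^ 3 - (246 * [:Z0:] + 1512 * [:Z1:] + 14400 * [:Z0:] ^ 2) * [:0, 1:] ^ 2 - (36 * [:Z0:]
    + 252 * [:Z1:] + 4920 * [:Z0:] ^ 2 + 30240 * [:Z0:] * [:Z1:]) * [:0, 1:] - (2 * [:Z0:] + 14 * [:Z1:] + 410 * [:Z0:]
    ^ 2 + 2520 * [:Z0:] * [:Z1:] + 8000 * [:Z0:] ^ 3)"
    unfolding shifts[symmetric] shift_poly_simps shift_poly_monom const_poly_ring
      by (simp only: power_0 power_one_right mult_1_right mult.assoc)
  thus "int_poly \<infinity> (shift_poly ?Q)" by (simp only:) (intro int_poly_rules)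
  show "coeff ?Q 3 = E6" by simp
qed

lemma integral_lead_U1: "integral_lead 0 1 12"
proof (rule integral_lead_I)
  let ?Q = "monom 12 1 :: complex fps poly"
  show "jacobi_poly 0 1 ?Q" by (intro jacobi_poly_monom) (auto intro!: modular_fps_rules)
  have "shift_poly ?Q = 12 * [:0, 1:] + 12 * [:twelfth:]"
    unfolding shift_poly_monom const_poly_ring by (simp only: power_one_right ring_distribs)
  hence "shift_poly ?Q = 12 * [:0, 1:] + 1" by (simp only: twelfth_poly)
  thus "int_poly \<infinity> (shift_poly ?Q)" by (simp only:) (intro int_poly_rules int_poly_intros(2))
  show "coeff ?Q 1 = 12" by simp
qed

text \<open>The leading coefficients \<open>4\<close> and \<open>3\<close> available in weight 0 and index 3 and 4 are coprime.\<close>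

lemma integral_lead_all_indices:
  assumes "integral_lead w 0 g" "integral_lead w 1 g" "integral_lead w 2 g" "integral_lead w 3 g" shows "integral_lead w m g"
proof (induction m rule: less_induct)
  case (less m)
  consider "m = 0" | "m = 1" | "m = 2" | "m = 3" | "m \<ge> 4" by linarith
  thus ?case
  proof cases
    case 5
    have "integral_lead w m (4 * g)" by (rule integral_lead_mult[OF integral_lead_U3 less.IH[of "m - 3"]]) (use 5 in auto)
    moreover have "integral_lead w m (3 * g)" by (rule integral_lead_mult[OF integral_lead_U4 less.IH[of "m - 4"]])
      (use 5 in auto)
    ultimately have "integral_lead w m (4 * g - 3 * g)" by (rule integral_lead_diff)
    thus ?thesis by (simp add: left_diff_distrib[symmetric])
  qed (use assms in auto)
qed

lemma integral_lead_E4: "integral_lead 4 m E4"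
  using integral_lead_const[OF modular_fps_E4 E46_int(1)] integral_lead_A1 integral_lead_A2 integral_lead_A3
    by (rule integral_lead_all_indices)

lemma integral_lead_E6: "integral_lead 6 m E6"
  using integral_lead_const[OF modular_fps_E6 E46_int(2)] integral_lead_B1 integral_lead_B2 integral_lead_B3
    by (rule integral_lead_all_indices)

text \<open>The value is the smallest positive b for which 12 divides m b. The generators of index 1
  to 4 lead with 12, 6, 4, 3, and integer combinations of products give the next indices, for
  example 6 * 3 - 4 * 4 = 2 in index 6. The value 1 in index 12 makes the pattern periodic.\<close>

lemma integral_lead_weight_0: "integral_lead 0 m (of_nat (12 div gcd 12 m))"
proof (induction m rule: less_induct)
  case (less m)
  have U0: "integral_lead 0 0 1" by (rule integral_lead_const) auto
  have U5: "integral_lead 0 5 12"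
    using integral_lead_diff[OF integral_lead_mult[OF integral_lead_U1 integral_lead_U4]
      integral_lead_mult[OF integral_lead_U2 integral_lead_U3], of 0 5] by simp
  have U6: "integral_lead 0 6 2"
    using integral_lead_diff[OF integral_lead_mult[OF integral_lead_U2 integral_lead_U4]
      integral_lead_mult[OF integral_lead_U3 integral_lead_U3], of 0 6] by simp
  have U7: "integral_lead 0 7 12"
    using integral_lead_mult[OF integral_lead_U3 integral_lead_U4, of 0 7] by simp
  have U8: "integral_lead 0 8 3"
    using integral_lead_diff[OF integral_lead_mult[OF integral_lead_U2 U6]
      integral_lead_mult[OF integral_lead_U4 integral_lead_U4], of 0 8] by simp
  have U9: "integral_lead 0 9 4"
  proof -
    have "integral_lead 0 9 (4 * (4 * 2))" by (rule integral_lead_numeral, rule integral_lead_mult[OF integral_lead_U3 U6]) auto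
    moreover have "integral_lead 0 9 (3 * 12)" by (rule integral_lead_mult[OF integral_lead_U4 U5]) auto
    ultimately show ?thesis using integral_lead_diff[of 0 9 "3 * 12" "4 * (4 * 2)"] by simp
  qed
  have U10: "integral_lead 0 10 6"
    using integral_lead_mult[OF integral_lead_U4 U6, of 0 10] by simp
  have U11: "integral_lead 0 11 12"
    using integral_lead_diff[OF integral_lead_mult[OF integral_lead_U4 U7] integral_lead_mult[OF U5 U6], of 0 11] by simp
  have U12: "integral_lead 0 12 1"
  proof -
    have "integral_lead 0 12 (2 * (2 * 2))" by (rule integral_lead_numeral, rule integral_lead_mult[OF U6 U6]) auto
    moreover have "integral_lead 0 12 (3 * 3)" by (rule integral_lead_mult[OF integral_lead_U4 U8]) auto
    ultimately show ?thesis using integral_lead_diff[of 0 12 "3 * 3" "2 * (2 * 2)"] by simp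
  qed
  have "m = 0 \<or> m = 1 \<or> m = 2 \<or> m = 3 \<or> m = 4 \<or> m = 5 \<or> m = 6 \<or> m = 7 \<or> m = 8 \<or> m = 9 \<or> m = 10 \<or> m = 11 \<or> m \<ge> 12"
    by presburger
  then consider "m = 0" | "m = 1" | "m = 2" | "m = 3" | "m = 4" | "m = 5"
    | "m = 6" | "m = 7" | "m = 8" | "m = 9" | "m = 10" | "m = 11" | "m \<ge> 12" by blast
  thus ?case
  proof cases
    case 13
    have "gcd 12 (m - 12) = gcd 12 m" using 13 by (metis gcd_add2 le_add_diff_inverse)
    thus ?thesis using integral_lead_mult[OF U12 less.IH[of "m - 12"], of 0 m] 13 by simp
  qed (use U0 integral_lead_U1 integral_lead_U2 integral_lead_U3 integral_lead_U4 U5 U6 U7 U8 U9 U10 U11 in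
      \<open>simp_all add: gcd_non_0_nat gcd_nat.simps[of 12 _]\<close>)
qed

text \<open>A single factor \<open>E4\<close> or \<open>E6\<close> carries the whole index; the
  remaining power of \<open>E4\<close> enters as a form of index 0.\<close>

lemma integral_lead_eisenstein_monomial:
  assumes "w \<ge> 4" "even w"
  obtains g where "modular_fps w g" "int_upto \<infinity> g" "fps_nth g 0 = 1" "\<And>m. integral_lead w m g"
  using assms(2)
proof (cases w rule: even_weight_cases)
  case (four a)
  have m: "modular_fps (4 * int a) (E4 ^ a)" by (rule modular_fps_power'[OF modular_fps_E4]) simp
  have i: "int_upto \<infinity> (E4 ^ a)" using E46_int by (intro int_upto_power)
  show thesis
  proof (rule that[of "E4 ^ a * E4"])
    show "modular_fps w (E4 ^ a * E4)" by (rule modular_fps_mult'[OF m modular_fps_E4]) (simp add: four)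
    show "int_upto \<infinity> (E4 ^ a * E4)" using i E46_int by auto
    show "fps_nth (E4 ^ a * E4) 0 = 1" by (simp add: fps_power_zeroth E46_nth_0)
    show "integral_lead w m (E4 ^ a * E4)" for m
      by (rule integral_lead_mult[OF integral_lead_const[OF m i] integral_lead_E4]) (simp_all add: four)
  qed
next
  case (six a)
  have m: "modular_fps (4 * int a) (E4 ^ a)" by (rule modular_fps_power'[OF modular_fps_E4]) simp
  have i: "int_upto \<infinity> (E4 ^ a)" using E46_int by (intro int_upto_power)
  show thesis
  proof (rule that[of "E4 ^ a * E6"])
    show "modular_fps w (E4 ^ a * E6)" by (rule modular_fps_mult'[OF m modular_fps_E6]) (simp add: six)
    show "int_upto \<infinity> (E4 ^ a * E6)" using i E46_int by auto
    show "fps_nth (E4 ^ a * E6) 0 = 1" by (simp add: fps_power_zeroth E46_nth_0)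
    show "integral_lead w m (E4 ^ a * E6)" for m
      by (rule integral_lead_mult[OF integral_lead_const[OF m i] integral_lead_E6]) (simp_all add: six)
  qed
qed (use assms in auto)

text \<open>Meant for sums of a form of weight w + 2 and a multiple of a form of weight w, which are
  not modular, so that \<open>modular_fps_divide_Delta\<close> does not apply.\<close>

lemma Delta_fps_cancel_int:
  assumes "\<And>n. ereal (real n) \<le> N \<Longrightarrow> fps_nth (Delta_fps * S) (Suc n) \<in> \<int>"
  shows "int_upto N S"
proof -
  obtain I where I: "Delta_unit * I = 1" using disc_fps_inverse[OF Delta_unit(1,4)] by blast
  have "int_upto N I" by (rule int_upto_inverse[OF I Delta_unit(3) int_upto_mono[OF Delta_unit(2)]]) simp
  moreover have "int_upto N (Delta_unit * S)"
    using assms by (simp add: int_upto_def Delta_fps_def mult.assoc)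
  ultimately have "int_upto N (I * (Delta_unit * S))" by (rule int_upto_mult)
  moreover have "I * (Delta_unit * S) = (Delta_unit * I) * S" by (simp only: mult_ac)
  ultimately show ?thesis by (simp add: I)
qed

text \<open>The second coefficient of an integral form with leading coefficient \<open>g\<close>. In
  the descent below, a multiple of it is subtracted from the candidate whenever that multiple of
  \<open>g\<close> is subtracted from the leading coefficient.\<close>

lemma integral_lead_next_coeff:
  assumes "integral_lead w m g"
  obtains C where "modular_fps (w + 2) C" "int_upto \<infinity> (C + of_nat m * twelfth * g)"
proof (cases m)
  case 0
  show thesis by (rule that[of 0]) (auto simp: 0)
next
  case (Suc l)
  obtain Q where Q: "jacobi_poly w m Q" "int_poly \<infinity> (shift_poly Q)" "coeff Q m = g" using assms by (auto simp: integral_lead_def)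
  have "modular_fps (w + 2 * (int m - int l)) (coeff Q l)" using Q(1) unfolding jacobi_poly_def by blast
  hence "modular_fps (w + 2) (coeff Q l)" by (simp add: Suc)
  moreover have "coeff (shift_poly Q) l = coeff Q l + of_nat m * twelfth * g"
    using coeff_shift_poly_next[of Q l] Q by (simp add: jacobi_poly_def Suc)
  hence "int_upto \<infinity> (coeff Q l + of_nat m * twelfth * g)" using Q(2) by (metis int_poly_def)
  ultimately show thesis using that by blast
qed

text \<open>\<open>C\<close> is the candidate for the coefficient after the leading coefficient \<open>F\<close>. Subtracting multiples of
  Eisenstein monomials from both and dividing by \<open>\<Delta>\<close> leads down to weight 0, where \<open>C = 0\<close> and the
  condition says that 12 divides \<open>m F\<close>.\<close>

lemma integral_lead_lift:
  assumes "modular_fps w F" "even w" "int_upto \<infinity> F" "modular_fps (w + 2) C"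
    and "\<And>n. 12 * int n \<le> w \<Longrightarrow> fps_nth (C + of_nat m * twelfth * F) n \<in> \<int>"
  shows "integral_lead w m F"
  using assms
proof (induction "nat w" arbitrary: w F C rule: less_induct)
  case (less w F C)
  consider "w < 0 \<or> w = 2" | "w = 0" | "w \<ge> 4" using less.prems(2) by (auto elim!: evenE) linarith
  thus ?case
  proof cases
    case 1
    hence "F = 0" using modular_fps_eq_0[OF less.prems(1)] modular_fps_2_eq_0 less.prems(1) by force
    thus ?thesis by (simp add: integral_lead_0)
  next
    case 2
    have "C = 0" using less.prems(4) 2 modular_fps_2_eq_0 by simp
    define b where "b = fps_nth F 0"
    have "F - fps_const b = 0" by (rule modular_fps_eq_0[of 0]) (use less.prems(1) 2 in \<open>auto simp: b_def\<close>)
    hence F: "F = fps_const b" by simp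
    have "b \<in> \<int>" using less.prems(3) unfolding b_def int_upto_def by simp
    then obtain B where B: "b = of_int B" by (elim Ints_cases)
    have "fps_nth (of_nat m * twelfth * F) 0 \<in> \<int>" using less.prems(5)[of 0] 2 \<open>C = 0\<close> by simp
    hence "of_nat m / 12 * b \<in> \<int>" by (simp add: F twelfth_def)
    then obtain k where k: "of_nat m / 12 * b = of_int k" by (elim Ints_cases)
    have "of_int (int m * B) = (of_int (12 * k) :: complex)" using k by (simp add: B field_simps)
    hence "int m * B = 12 * k" by (simp only: of_int_eq_iff)
    hence "12 dvd int m * B" by simp
    define d where "d = gcd 12 m"
    have d: "d > 0" "12 = d * (12 div d)" "m = d * (m div d)" "coprime (12 div d) (m div d)"
      unfolding d_def by (auto intro: div_gcd_coprime)
    have "int d * int (12 div d) dvd int d * int (m div d) * B"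
      using \<open>12 dvd int m * B\<close> d(2,3) by (metis of_nat_mult of_nat_numeral)
    hence "int (12 div d) dvd int (m div d) * B" using d(1) by (simp add: mult.assoc)
    hence "int (12 div d) dvd B" using d(4) by (metis coprime_dvd_mult_right_iff coprime_int_iff)
    then obtain l where l: "B = int (12 div d) * l" by (elim dvdE)
    have "integral_lead 0 m (fps_const (of_int l) * of_nat (12 div d))"
      unfolding d_def by (rule integral_lead_cmult[OF integral_lead_weight_0]) simp
    moreover have "fps_const (of_int l) * of_nat (12 div d) = F"
      by (simp add: F B l fps_of_nat[symmetric] mult.commute)
    ultimately show ?thesis using 2 by simp
  next
    case 3
    obtain g where g: "modular_fps w g" "int_upto \<infinity> g" "fps_nth g 0 = 1" "\<And>m. integral_lead w m g"
      using integral_lead_eisenstein_monomial[OF 3 less.prems(2)] by blast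
    define c where "c = fps_nth F 0"
    have c: "c \<in> \<int>" using less.prems(3) by (auto simp: c_def int_upto_def)
    define F' where "F' = F - fps_const c * g"
    have F': "modular_fps w F'" unfolding F'_def by (intro modular_fps_diff modular_fps_cmult g less.prems)
    have cg: "int_upto \<infinity> (fps_const c * g)" by (intro int_upto_mult int_upto_const c g)
    have iF': "int_upto \<infinity> F'" unfolding F'_def by (intro int_upto_diff less.prems cg)
    have F'0: "fps_nth F' 0 = 0" by (simp add: F'_def c_def g)
    obtain G where G: "modular_fps (w - 12) G" "F' = Delta_fps * G"
      "\<And>N. (\<And>n. ereal (real n) \<le> N \<Longrightarrow> fps_nth F' (Suc n) \<in> \<int>) \<Longrightarrow> int_upto N G"
      using modular_fps_divide_Delta[OF F' F'0] by blast
    have iG: "int_upto \<infinity> G" by (rule G(3)) (use iF' in \<open>simp add: int_upto_def\<close>)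
    have "integral_lead (w - 12) m G"
    proof (cases "w < 12")
      case True
      hence "G = 0" by (intro modular_fps_eq_0[OF G(1)]) auto
      thus ?thesis by (simp add: integral_lead_0)
    next
      case False
      obtain Cg where Cg: "modular_fps (w + 2) Cg" "int_upto \<infinity> (Cg + of_nat m * twelfth * g)"
        using integral_lead_next_coeff[OF g(4)[of m]] by blast
      obtain g2 where g2: "modular_fps (w + 2) g2" "int_upto \<infinity> g2" "fps_nth g2 0 = 1"
        using eisenstein_monomial[of "w + 2"] 3 less.prems(2) by auto
      \<comment> \<open>\<open>K\<close> is the candidate for the coefficient after
        \<open>F'\<close>. As \<open>F'\<close> has no constant term, that of \<open>K\<close> is an
        integer \<open>k0\<close>, and \<open>k0 * g2\<close> may be removed: it changes the second
        coefficient by an integral form and leaves the leading one alone. Both can then be divided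
        by Delta.\<close>
      define K where "K = C - fps_const c * Cg"
      define k0 where "k0 = fps_nth K 0"
      have K: "modular_fps (w + 2) (K - fps_const k0 * g2)" unfolding K_def
        by (intro modular_fps_diff modular_fps_cmult less.prems Cg g2)
      have K0: "fps_nth (K - fps_const k0 * g2) 0 = 0" by (simp add: k0_def g2)
      obtain C' where C': "modular_fps (w + 2 - 12) C'" "K - fps_const k0 * g2 = Delta_fps * C'"
        using modular_fps_divide_Delta[OF K K0] by blast
      have eq: "K + of_nat m * twelfth * F' = (C + of_nat m * twelfth * F) - fps_const c * (Cg + of_nat m * twelfth * g)"
        by (simp add: K_def F'_def algebra_simps)
      have Kint: "fps_nth (K + of_nat m * twelfth * F') n \<in> \<int>" if "12 * int n \<le> w" for n
        unfolding eq fps_sub_nth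
      proof (rule Ints_diff)
        show "fps_nth (C + of_nat m * twelfth * F) n \<in> \<int>" by (rule less.prems(5)[OF that])
        have "int_upto \<infinity> (fps_const c * (Cg + of_nat m * twelfth * g))" by (intro int_upto_mult int_upto_const c Cg)
        thus "fps_nth (fps_const c * (Cg + of_nat m * twelfth * g)) n \<in> \<int>" by (simp add: int_upto_def)
      qed
      have "fps_nth (K + of_nat m * twelfth * F') 0 = k0" by (simp add: F'0 k0_def)
      hence k0: "k0 \<in> \<int>" using Kint[of 0] 3 by simp
      have kg2: "int_upto \<infinity> (fps_const k0 * g2)" by (intro int_upto_mult int_upto_const k0 g2)
      have eq2: "Delta_fps * (C' + of_nat m * twelfth * G) = (K + of_nat m * twelfth * F') - fps_const k0 * g2"
        using C'(2) G(2) by (simp add: algebra_simps)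
      show ?thesis
      proof (rule less.hyps[OF _ G(1) _ iG])
        show "nat (w - 12) < nat w" using False by simp
        show "even (w - 12)" using less.prems(2) by simp
        show "modular_fps (w - 12 + 2) C'" using C'(1) by (simp add: algebra_simps)
        fix n assume n: "12 * int n \<le> w - 12"
        have "int_upto (ereal (real n)) (C' + of_nat m * twelfth * G)"
        proof (rule Delta_fps_cancel_int)
          fix i assume "ereal (real i) \<le> ereal (real n)"
          hence "12 * int (Suc i) \<le> w" using n by simp
          from Kint[OF this] show "fps_nth (Delta_fps * (C' + of_nat m * twelfth * G)) (Suc i) \<in> \<int>"
            unfolding eq2 fps_sub_nth using kg2 by (intro Ints_diff) (auto simp: int_upto_def)
        qed
        thus "fps_nth (C' + of_nat m * twelfth * G) n \<in> \<int>" by (simp add: int_upto_def)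
      qed
    qed
    hence "integral_lead w m (Delta_fps * G)"
      using Delta_unit by (intro integral_lead_mult[OF integral_lead_const[OF Delta_unit(5)]]) (auto simp: Delta_fps_def)
    moreover have "F = fps_const c * g + Delta_fps * G" using G(2) by (simp add: F'_def algebra_simps)
    ultimately show ?thesis using integral_lead_add[OF integral_lead_cmult[OF g(4) c]] by simp
  qed
qed

text \<open>The cutoff is at least w/12, so the leading coefficient and the one below it are known
  to be integral at every n with \<open>12 * n \<le> w\<close>, the range required by
  \<open>integral_lead_lift\<close>. The subtracted form is integral without cutoff, so the
  difference satisfies the hypothesis again.\<close>

theorem jacobi_poly_integral:
  assumes "jacobi_poly w m Q" "even w" "int_poly (ereal (real_of_int (w + 2 * int m) / 12)) (shift_poly Q)"
  shows "int_poly \<infinity> (shift_poly Q)"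
  using assms
proof (induction m arbitrary: w Q)
  case 0
  then obtain a where a: "Q = [:a:]" using degree_eq_zeroE by (auto simp: jacobi_poly_def)
  have "modular_fps (w + 2 * (int 0 - int 0)) (coeff Q 0)" using 0 unfolding jacobi_poly_def by blast
  hence ma: "modular_fps w a" by (simp add: a)
  have "int_upto (ereal (real_of_int w / 12)) a" using 0(3) by (auto simp: a int_poly_def dest: spec[of _ 0])
  hence "fps_nth a n \<in> \<int>" if "12 * int n \<le> w" for n
    using that unfolding int_upto_def by (auto simp: field_simps)
  hence "int_upto \<infinity> a" by (intro modular_fps_integral[OF ma 0(2)])
  thus ?case by (auto simp: a)
next
  case (Suc m)
  define N where "N = ereal (real_of_int (w + 2 * int (Suc m)) / 12)"
  have leN: "ereal (real n) \<le> N" if "12 * int n \<le> w" for n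
    using that by (simp add: N_def field_simps)
  define F C where "F = coeff Q (Suc m)" and "C = coeff Q m"
  have deg: "degree Q \<le> Suc m" using Suc.prems(1) by (simp add: jacobi_poly_def)
  have mfs: "modular_fps (w + 2 * (int (Suc m) - int i)) (coeff Q i)" for i using Suc.prems(1) unfolding jacobi_poly_def by blast
  have F: "modular_fps w F" using mfs[of "Suc m"] by (simp add: F_def)
  have C: "modular_fps (w + 2) C" using mfs[of m] by (simp add: C_def)
  have iN: "int_upto N (coeff (shift_poly Q) i)" for i using Suc.prems(3) by (simp add: int_poly_def N_def)
  have "int_upto N F" using iN[of "Suc m"] coeff_shift_poly_top[OF deg] by (simp add: F_def)
  hence iF: "int_upto \<infinity> F"
    by (intro modular_fps_integral[OF F Suc.prems(2)]) (auto simp: int_upto_def leN)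
  have "int_upto N (C + of_nat (Suc m) * twelfth * F)"
    using iN[of m] unfolding coeff_shift_poly_next[OF deg] F_def C_def .
  hence "integral_lead w (Suc m) F"
    by (intro integral_lead_lift[OF F Suc.prems(2) iF C]) (simp add: int_upto_def leN)
  then obtain L where L: "jacobi_poly w (Suc m) L" "int_poly \<infinity> (shift_poly L)" "coeff L (Suc m) = F"
    by (auto simp: integral_lead_def)
  have "jacobi_poly w (Suc m) (Q - L)" by (intro jacobi_poly_diff Suc.prems L)
  hence QL: "degree (Q - L) \<le> Suc m" "\<And>i. modular_fps (w + 2 * (int (Suc m) - int i)) (coeff (Q - L) i)"
    unfolding jacobi_poly_def by blast+
  have "degree (Q - L) \<le> m"
  proof (rule degree_le, intro allI impI)
    fix i assume "m < i"
    thus "coeff (Q - L) i = 0"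
    proof (cases "i = Suc m")
      case True thus ?thesis using L(3) by (simp add: F_def)
    next
      case False
      hence "degree (Q - L) < i" using QL(1) \<open>m < i\<close> by simp
      thus ?thesis by (rule coeff_eq_0)
    qed
  qed
  moreover have "modular_fps (w + 2 + 2 * (int m - int i)) (coeff (Q - L) i)" for i
    using QL(2)[of i] by (simp add: algebra_simps)
  ultimately have J: "jacobi_poly (w + 2) m (Q - L)" by (simp add: jacobi_poly_def)
  have "int_poly \<infinity> (shift_poly (Q - L))"
  proof (rule Suc.IH[OF J])
    show "even (w + 2)" using Suc.prems(2) by simp
    have "int_poly N (shift_poly L)" using L(2) by (auto simp: int_poly_def intro: int_upto_mono)
    hence "int_poly N (shift_poly (Q - L))" using iN by (auto simp: int_poly_def)
    thus "int_poly (ereal (real_of_int (w + 2 + 2 * int m) / 12)) (shift_poly (Q - L))" by (simp add: N_def algebra_simps)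
  qed
  hence "int_poly \<infinity> (shift_poly (Q - L) + shift_poly L)" using L(2) by (rule int_poly_intros(3))
  thus ?case by simp
qed

section \<open>Structure of weak Jacobi forms\<close>

text \<open>Unlike \<open>sq_expansion\<close>, this concerns functions of \<tau> and
  \<open>z\<close>, with \<open>q = ee \<tau>\<close> never 0. Agreement is asked only on a
  punctured neighbourhood of \<open>z = 0\<close>, so products and quotients with removable
  singularities qualify.\<close>

definition local_exp :: "(complex \<Rightarrow> complex \<Rightarrow> complex) \<Rightarrow> complex fps fps \<Rightarrow> bool" where
  "local_exp \<psi> A \<longleftrightarrow> disc_fps2 A \<and> (\<forall>\<tau>. Im \<tau> > 0 \<longrightarrow>
     (\<exists>F. F has_fps_expansion eval_q (ee \<tau>) A \<and> eventually (\<lambda>z. \<psi> \<tau> z = F (s_at z)) (at 0)))"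

lemma local_expD:
  assumes "local_exp \<psi> A" "Im \<tau> > 0"
  obtains F where "F has_fps_expansion eval_q (ee \<tau>) A" "eventually (\<lambda>z. \<psi> \<tau> z = F (s_at z)) (at 0)"
  using assms by (auto simp: local_exp_def)

lemma local_exp_disc2: "local_exp \<psi> A \<Longrightarrow> disc_fps2 A" by (simp add: local_exp_def)

lemma local_exp_const: "disc_fps C \<Longrightarrow> local_exp (\<lambda>\<tau> z. eval_fps C (ee \<tau>)) (fps_const C)"
  by (auto simp: local_exp_def intro!: exI[of _ "\<lambda>_. eval_fps C _"])

lemma local_exp_1: "local_exp (\<lambda>\<tau> z. 1) 1" using local_exp_const[of 1] by simp

lemma local_exp_sq_expansion: "sq_expansion F A \<Longrightarrow> local_exp (\<lambda>\<tau> z. F (ee \<tau>) (s_at z)) A"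
  unfolding local_exp_def sq_expansion_def
proof (intro conjI allI impI)
  fix \<tau> :: complex
  assume "disc_fps2 A \<and> (\<forall>q. norm q < 1 \<longrightarrow> F q has_fps_expansion eval_q q A)" "Im \<tau> > 0"
  thus "\<exists>G. G has_fps_expansion eval_q (ee \<tau>) A \<and> eventually (\<lambda>z. F (ee \<tau>) (s_at z) = G (s_at z)) (at 0)"
    by (intro exI[of _ "F (ee \<tau>)"]) (simp add: norm_ee_less_1)
qed auto

lemma local_exp_cong:
  assumes "local_exp \<psi> A" "\<And>\<tau>. Im \<tau> > 0 \<Longrightarrow> eventually (\<lambda>z. \<psi>' \<tau> z = \<psi> \<tau> z) (at 0)"
  shows "local_exp \<psi>' A"
  unfolding local_exp_def
proof (intro conjI allI impI)
  fix \<tau> :: complex assume tau: "Im \<tau> > 0"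
  obtain F where F: "F has_fps_expansion eval_q (ee \<tau>) A" "eventually (\<lambda>z. \<psi> \<tau> z = F (s_at z)) (at 0)"
    by (rule local_expD[OF assms(1) tau])
  have "eventually (\<lambda>z. \<psi>' \<tau> z = F (s_at z)) (at 0)"
    using F(2) assms(2)[OF tau] by eventually_elim simp
  thus "\<exists>F. F has_fps_expansion eval_q (ee \<tau>) A \<and> eventually (\<lambda>z. \<psi>' \<tau> z = F (s_at z)) (at 0)" using F(1) by blast
qed (rule local_exp_disc2[OF assms(1)])

lemma local_exp_binop:
  assumes "local_exp \<psi> A" "local_exp \<eta> B" "disc_fps2 C"
    and "\<And>F G q. F has_fps_expansion eval_q q A \<Longrightarrow> G has_fps_expansion eval_q q B \<Longrightarrow> norm q < 1 \<Longrightarrow>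
       (\<lambda>s. f (F s) (G s)) has_fps_expansion eval_q q C"
  shows "local_exp (\<lambda>\<tau> z. f (\<psi> \<tau> z) (\<eta> \<tau> z)) C"
  unfolding local_exp_def
proof (intro conjI allI impI)
  fix \<tau> :: complex assume tau: "Im \<tau> > 0"
  obtain F where F: "F has_fps_expansion eval_q (ee \<tau>) A" "eventually (\<lambda>z. \<psi> \<tau> z = F (s_at z)) (at 0)"
    by (rule local_expD[OF assms(1) tau])
  obtain G where G: "G has_fps_expansion eval_q (ee \<tau>) B" "eventually (\<lambda>z. \<eta> \<tau> z = G (s_at z)) (at 0)"
    by (rule local_expD[OF assms(2) tau])
  have "eventually (\<lambda>z. f (\<psi> \<tau> z) (\<eta> \<tau> z) = f (F (s_at z)) (G (s_at z))) (at 0)"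
    using F(2) G(2) by eventually_elim simp
  thus "\<exists>H. H has_fps_expansion eval_q (ee \<tau>) C \<and> eventually (\<lambda>z. f (\<psi> \<tau> z) (\<eta> \<tau> z) = H (s_at z)) (at 0)"
    using assms(4)[OF F(1) G(1) norm_ee_less_1[OF tau]] by (intro exI[of _ "\<lambda>s. f (F s) (G s)"] conjI)
qed fact

lemma local_exp_add: "local_exp \<psi> A \<Longrightarrow> local_exp \<eta> B \<Longrightarrow> local_exp (\<lambda>\<tau> z. \<psi> \<tau> z + \<eta> \<tau> z) (A + B)"
  and local_exp_diff: "local_exp \<psi> A \<Longrightarrow> local_exp \<eta> B \<Longrightarrow> local_exp (\<lambda>\<tau> z. \<psi> \<tau> z - \<eta> \<tau> z) (A - B)"
  and local_exp_mult: "local_exp \<psi> A \<Longrightarrow> local_exp \<eta> B \<Longrightarrow> local_exp (\<lambda>\<tau> z. \<psi> \<tau> z * \<eta> \<tau> z) (A * B)"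
  by (rule local_exp_binop, assumption, assumption,
      use local_exp_disc2 in \<open>auto simp: eval_q_add eval_q_diff eval_q_mult intro!: fps_expansion_intros\<close>)+

lemma local_exp_power: "local_exp \<psi> A \<Longrightarrow> local_exp (\<lambda>\<tau> z. \<psi> \<tau> z ^ n) (A ^ n)"
  by (induction n) (auto intro!: local_exp_mult local_exp_1)

lemma local_exp_0: "local_exp (\<lambda>\<tau> z. 0) 0" using local_exp_const[of 0] by simp

lemma local_exp_sum: "(\<And>i. i \<in> I \<Longrightarrow> local_exp (f i) (A i)) \<Longrightarrow> local_exp (\<lambda>\<tau> z. \<Sum>i\<in>I. f i \<tau> z) (\<Sum>i\<in>I. A i)"
  by (induction I rule: infinite_finite_induct) (auto intro!: local_exp_add local_exp_0)

text \<open>As \<open>z\<close> tends to 0, \<open>s_at z\<close> tends to 0 through nonzero values,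
  so the first coefficient at which two expansions differ would be a limit of zeros. Varying \<tau>
  then identifies the coefficients as series in \<open>q\<close>.\<close>

lemma local_exp_unique:
  assumes "local_exp \<psi> A" "local_exp \<psi> B" shows "A = B"
proof -
  have eq: "eval_q (ee \<tau>) A = eval_q (ee \<tau>) B" if tau: "Im \<tau> > 0" for \<tau>
  proof (rule ccontr)
    assume ne: "eval_q (ee \<tau>) A \<noteq> eval_q (ee \<tau>) B"
    obtain F where F: "F has_fps_expansion eval_q (ee \<tau>) A" "eventually (\<lambda>z. \<psi> \<tau> z = F (s_at z)) (at 0)"
      by (rule local_expD[OF assms(1) tau])
    obtain G where G: "G has_fps_expansion eval_q (ee \<tau>) B" "eventually (\<lambda>z. \<psi> \<tau> z = G (s_at z)) (at 0)"
      by (rule local_expD[OF assms(2) tau])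
    define H where "H = eval_q (ee \<tau>) A - eval_q (ee \<tau>) B"
    define n where "n = subdegree H"
    have H: "fps_nth H n \<noteq> 0" "\<And>i. i < n \<Longrightarrow> fps_nth H i = 0"
    proof -
      have "H \<noteq> 0" using ne by (simp add: H_def)
      thus "fps_nth H n \<noteq> 0" unfolding n_def by (rule nth_subdegree_nonzero)
      show "fps_nth H i = 0" if "i < n" for i using that unfolding n_def by (rule nth_less_subdegree_zero)
    qed
    have "(\<lambda>s. F s - G s) has_fps_expansion H" unfolding H_def by (intro fps_expansion_intros F G)
    from filterlim_compose[OF ratio_tendsto[OF this H(2)] filterlim_s_at]
    have "((\<lambda>z. (F (s_at z) - G (s_at z)) / s_at z ^ n) \<longlongrightarrow> fps_nth H n) (at 0)" .
    moreover have "eventually (\<lambda>z. (F (s_at z) - G (s_at z)) / s_at z ^ n = 0) (at 0)"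
      using F(2) G(2) by eventually_elim simp
    hence "((\<lambda>z. (F (s_at z) - G (s_at z)) / s_at z ^ n) \<longlongrightarrow> 0) (at 0)" by (rule tendsto_eventually)
    ultimately have "fps_nth H n = 0" using tendsto_unique[OF at_neq_bot] by blast
    thus False using H by simp
  qed
  show ?thesis
  proof (rule fps_ext, rule disc_fps_eqI)
    fix i show "disc_fps (fps_nth A i)" "disc_fps (fps_nth B i)"
      using assms by (auto simp: local_exp_def disc_fps2_def)
    fix q :: complex assume q: "norm q < 1" "q \<noteq> 0"
    obtain \<tau> where t: "q = ee \<tau>" using ee_surj[OF q(2)] by metis
    have "Im \<tau> > 0" using q(1) pi_gt_zero by (simp add: t norm_ee zero_less_mult_iff)
    from arg_cong[OF eq[OF this], of "\<lambda>H. fps_nth H i"]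
    show "eval_fps (fps_nth A i) q = eval_fps (fps_nth B i) q" by (simp add: t)
  qed
qed

lemma eventually_s_at_nz: "eventually (\<lambda>z. s_at z \<noteq> 0) (at 0)"
  using filterlim_s_at by (auto simp: filterlim_at elim: eventually_mono)

lemma local_exp_phi21: "local_exp phi21 (fps_X * theta_fps ^ 2)"
  using local_exp_mult[OF local_exp_sq_expansion[OF sq_expansion_X]
    local_exp_power[OF local_exp_sq_expansion[OF theta_fps(1)], of 2]]
  by (rule local_exp_cong) (simp add: phi21_def)

text \<open>Expansion of \<open>phi21 * wp0\<close>: the pole of \<open>wp0\<close> is cancelled by
  one factor \<open>s\<close>, so the constant term is 1. This makes it the pivot of the elimination
  in \<open>elliptic_structure\<close>.\<close>

definition Y_fps :: "complex fps fps" where "Y_fps = theta_fps ^ 2 * (1 + fps_X ^ 2 * wp_tail_fps)"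

lemma local_exp_Y: "local_exp (\<lambda>\<tau> z. phi21 \<tau> z * wp0 \<tau> z) Y_fps"
proof (rule local_exp_cong)
  show "local_exp (\<lambda>\<tau> z. theta_prod (ee \<tau>) (s_at z) ^ 2 * (1 + s_at z ^ 2 * wp_tail (ee \<tau>) (s_at z))) Y_fps"
    unfolding Y_fps_def by (intro local_exp_mult local_exp_add local_exp_1 local_exp_power local_exp_sq_expansion[OF theta_fps(1)]
      local_exp_sq_expansion[OF wp_tail_fps(1)] local_exp_sq_expansion[OF sq_expansion_X])
  show "eventually (\<lambda>z. phi21 \<tau> z * wp0 \<tau> z = theta_prod (ee \<tau>) (s_at z) ^ 2 * (1 + s_at z ^ 2 * wp_tail (ee \<tau>) (s_at z)))
    (at 0)" for \<tau>
    using eventually_s_at_nz by eventually_elim (simp add: phi21_def wp0_def field_simps power2_eq_square)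
qed

lemma theta_fps2_nth_0: "fps_nth (theta_fps ^ 2) 0 = 1" by (simp add: theta_fps(3) power2_eq_square)

lemma Y_fps_nth_0: "fps_nth Y_fps 0 = 1" unfolding Y_fps_def by (simp add: theta_fps2_nth_0)

lemma int_Y_fps: "int_upto2 N Y_fps" "int_upto2 N (fps_X * theta_fps ^ 2)"
proof -
  have "int_upto2 N theta_fps" "int_upto2 N wp_tail_fps" using theta_fps(2) wp_tail_fps(2)
    by (auto simp: int_upto2_def intro: int_upto_mono)
  thus "int_upto2 N Y_fps" "int_upto2 N (fps_X * theta_fps ^ 2)"
    unfolding Y_fps_def by (auto intro!: int_upto2_intros int_upto2_power simp del: power2_eq_square)
qed

text \<open>Since \<open>phi21\<close> is \<open>s\<close> times the square of an integral unit,
  division amounts to dropping the vanishing first coefficient and multiplying by an integral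
  inverse.\<close>

lemma local_exp_divide_phi21:
  assumes A: "local_exp \<psi> A" "fps_nth A 0 = 0"
  obtains B where "local_exp (\<lambda>\<tau> z. \<psi> \<tau> z / phi21 \<tau> z) B" "\<And>N. int_upto2 N A \<Longrightarrow> int_upto2 N B"
proof -
  have dK: "disc_fps2 (theta_fps ^ 2)" using theta_fps(1) by (auto simp: sq_expansion_def)
  obtain I where I: "theta_fps ^ 2 * I = 1" "disc_fps2 I" "int_upto2 \<infinity> (theta_fps ^ 2) \<Longrightarrow> int_upto2 \<infinity> I"
  proof -
    from fps2_inverse_ex[OF theta_fps2_nth_0 dK, of \<infinity>] show ?thesis using that by blast
  qed
  define A' where "A' = fps_shift 1 A"
  have dA': "disc_fps2 A'" using local_exp_disc2[OF A(1)] by (simp add: A'_def disc_fps2_def)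
  have AA': "fps_X * A' = A"
  proof (rule fps_ext)
    fix n show "fps_nth (fps_X * A') n = fps_nth A n" using A(2) by (cases n) (simp_all add: A'_def)
  qed
  have "local_exp (\<lambda>\<tau> z. \<psi> \<tau> z / s_at z) A'"
    unfolding local_exp_def
  proof (intro conjI dA' allI impI)
    fix \<tau> :: complex assume tau: "Im \<tau> > 0"
    have q: "norm (ee \<tau>) < 1" by (rule norm_ee_less_1[OF tau])
    obtain F where F: "F has_fps_expansion eval_q (ee \<tau>) A" "eventually (\<lambda>z. \<psi> \<tau> z = F (s_at z)) (at 0)"
      by (rule local_expD[OF A(1) tau])
    define G where "G = eval_fps (eval_q (ee \<tau>) A')"
    have "eval_q (ee \<tau>) A' = fps_shift 1 (eval_q (ee \<tau>) A)" by (rule fps_ext) (simp add: A'_def)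
    hence "fps_conv_radius (eval_q (ee \<tau>) A') > 0" using F(1) by (simp add: has_fps_expansion_def)
    hence G: "G has_fps_expansion eval_q (ee \<tau>) A'" unfolding G_def by (rule eval_fps_has_fps_expansion)
    have "(\<lambda>s. s * G s) has_fps_expansion fps_X * eval_q (ee \<tau>) A'" by (intro fps_expansion_intros G)
    also have "fps_X * eval_q (ee \<tau>) A' = eval_q (ee \<tau>) A"
      using eval_q_mult[of fps_X A' "ee \<tau>"] dA' q by (simp add: AA' disc_fps2_intros)
    finally have "eventually (\<lambda>s. s * G s = eval_fps (eval_q (ee \<tau>) A) s) (nhds 0)"
      by (auto simp: has_fps_expansion_def elim: eventually_mono)
    moreover have "eventually (\<lambda>s. F s = eval_fps (eval_q (ee \<tau>) A) s) (nhds 0)" using F(1)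
      by (auto simp: has_fps_expansion_def elim: eventually_mono)
    ultimately have "eventually (\<lambda>s. F s = s * G s) (nhds 0)" by eventually_elim simp
    hence "eventually (\<lambda>s. F s = s * G s) (at 0)" by (simp add: eventually_at_filter eventually_mono)
    hence "eventually (\<lambda>z. F (s_at z) = s_at z * G (s_at z)) (at 0)" using filterlim_s_at by (auto simp: filterlim_iff)
    hence "eventually (\<lambda>z. \<psi> \<tau> z / s_at z = G (s_at z)) (at 0)"
      using F(2) eventually_s_at_nz by eventually_elim simp
    thus "\<exists>F. F has_fps_expansion eval_q (ee \<tau>) A' \<and> eventually (\<lambda>z. \<psi> \<tau> z / s_at z = F (s_at z)) (at 0)" using G by blast
  qed
  hence "local_exp (\<lambda>\<tau> z. \<psi> \<tau> z / s_at z * inverse (theta_prod (ee \<tau>) (s_at z) ^ 2)) (A' * I)"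
    by (intro local_exp_mult local_exp_sq_expansion[OF sq_expansion_inverse[OF sq_expansion_power[OF theta_fps(1)] I(1,2)]])
  hence "local_exp (\<lambda>\<tau> z. \<psi> \<tau> z / phi21 \<tau> z) (A' * I)"
    by (rule local_exp_cong) (simp add: phi21_def divide_inverse mult_ac)
  moreover have "int_upto2 N (A' * I)" if "int_upto2 N A" for N
  proof -
    have "int_upto2 \<infinity> I" using I(3) theta_fps(2) by blast
    hence "int_upto2 N I" by (auto simp: int_upto2_def intro: int_upto_mono)
    moreover have "int_upto2 N A'" using that by (simp add: A'_def int_upto2_def)
    ultimately show ?thesis by (rule int_upto2_intros(6)[rotated])
  qed
  ultimately show ?thesis using that by blast
qed

section \<open>Polynomials over power series in \<open>q\<close> and the structure of elliptic
  forms\<close>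

definition eval_q_poly :: "complex \<Rightarrow> complex fps poly \<Rightarrow> complex poly" where
  "eval_q_poly q Q = map_poly (\<lambda>F. eval_fps F q) Q"

definition disc_poly :: "complex fps poly \<Rightarrow> bool" where "disc_poly Q \<longleftrightarrow> (\<forall>i. disc_fps (coeff Q i))"

lemma coeff_eval_q_poly [simp]: "coeff (eval_q_poly q Q) i = eval_fps (coeff Q i) q"
  by (simp add: eval_q_poly_def coeff_map_poly)

lemma eval_q_poly_add: "disc_poly P \<Longrightarrow> disc_poly Q \<Longrightarrow> norm q < 1 \<Longrightarrow> eval_q_poly q (P + Q) = eval_q_poly q P + eval_q_poly q Q"
  by (rule poly_eqI) (simp add: disc_poly_def ev_add)

lemma eval_q_poly_monom: "eval_q_poly q (monom C i) = monom (eval_fps C q) i"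
  by (rule poly_eqI) simp

lemma eval_q_poly_mult: "disc_poly P \<Longrightarrow> disc_poly Q \<Longrightarrow> norm q < 1 \<Longrightarrow> eval_q_poly q (P * Q) = eval_q_poly q P * eval_q_poly q Q"
  by (rule poly_eqI) (simp add: disc_poly_def coeff_mult ev_sum ev_mult disc_fps_mult)

lemma disc_poly_pCons: "disc_poly (pCons a Q) \<longleftrightarrow> disc_fps a \<and> disc_poly Q"
  unfolding disc_poly_def by (metis coeff_pCons_0 coeff_pCons_Suc not0_implies_Suc)

lemma disc_poly_mult: "disc_poly P \<Longrightarrow> disc_poly Q \<Longrightarrow> disc_poly (P * Q)"
  by (auto simp: disc_poly_def coeff_mult)

lemma disc_poly_add: "disc_poly P \<Longrightarrow> disc_poly Q \<Longrightarrow> disc_poly (P + Q)"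
  by (auto simp: disc_poly_def)

lemma eval_q_poly_pCons: "eval_q_poly q (pCons a Q) = pCons (eval_fps a q) (eval_q_poly q Q)"
  by (rule poly_eqI) (simp add: coeff_pCons split: nat.splits)

lemma eval_q_poly_0: "eval_q_poly q 0 = 0"
  by (rule poly_eqI) simp

lemma eval_q_poly_pcompose:
  assumes "disc_poly Q" "disc_fps a" "norm q < 1"
  shows "disc_poly (pcompose Q [:a, 1:])" "poly (eval_q_poly q (pcompose Q [:a, 1:])) x = poly (eval_q_poly q Q) (x
    + eval_fps a q)"
proof -
  have "disc_poly (pcompose Q [:a, 1:]) \<and> poly (eval_q_poly q (pcompose Q [:a, 1:])) x = poly (eval_q_poly q Q) (x
    + eval_fps a q)"
    using assms(1)
  proof (induction Q)
    case 0
    show ?case by (simp add: disc_poly_def eval_q_poly_def)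
  next
    case (pCons b Q)
    have Q: "disc_fps b" "disc_poly Q" using pCons.prems by (auto simp: disc_poly_pCons)
    have d: "disc_poly [:b:]" "disc_poly [:a, 1:]" "disc_poly (pcompose Q [:a, 1:])"
      using Q assms pCons.IH by (auto simp: disc_poly_pCons disc_poly_def[of 0])
    have d2: "disc_poly ([:a, 1:] * pcompose Q [:a, 1:])" by (rule disc_poly_mult[OF d(2,3)])
    have "disc_poly ([:b:] + [:a, 1:] * pcompose Q [:a, 1:])" by (rule disc_poly_add[OF d(1) d2])
    moreover have "poly (eval_q_poly q ([:b:] + [:a, 1:]
      * pcompose Q [:a, 1:])) x = poly (eval_q_poly q (pCons b Q)) (x + eval_fps a q)"
      using pCons.IH[OF Q(2)] assms(3)
      by (simp only: eval_q_poly_add[OF d(1) d2 assms(3)] eval_q_poly_mult[OF d(2,3) assms(3)]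
        eval_q_poly_pCons poly_add poly_mult poly_pCons)
         (simp add: eval_q_poly_def algebra_simps)
    ultimately show ?case by (simp only: pcompose_pCons)
  qed
  thus "disc_poly (pcompose Q [:a, 1:])" "poly (eval_q_poly q (pcompose Q [:a, 1:])) x = poly (eval_q_poly q Q) (x
    + eval_fps a q)" by auto
qed

text \<open>Subtracting \<open>C * Y ^ Suc m\<close>, where \<open>C\<close> is the value at
  \<open>z = 0\<close>, leaves a series in \<open>s\<close> without constant term. It is divisible
  by \<open>phi21\<close>, which lowers the index by one, down to \<open>elliptic_constant\<close>
  at index 0. Every operation respects integrality for each cutoff \<open>N\<close>.\<close>

theorem elliptic_structure:
  assumes "\<And>\<tau>. Im \<tau> > 0 \<Longrightarrow> \<psi> \<tau> holomorphic_on - Lattice \<tau>"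
    and "\<And>\<tau> z. Im \<tau> > 0 \<Longrightarrow> z \<notin> Lattice \<tau> \<Longrightarrow> \<psi> \<tau> (z + 1) = \<psi> \<tau> z"
    and "\<And>\<tau> z. Im \<tau> > 0 \<Longrightarrow> z \<notin> Lattice \<tau> \<Longrightarrow> \<psi> \<tau> (z + \<tau>) = \<psi> \<tau> z * ee (- \<tau> - 2 * z) ^ m"
    and "local_exp \<psi> A"
  shows "\<exists>Q. degree Q \<le> m \<and> disc_poly Q \<and> (\<forall>N. int_upto2 N A \<longrightarrow> int_poly N Q) \<and>
     (\<forall>\<tau> z. Im \<tau> > 0 \<longrightarrow> z \<notin> Lattice \<tau> \<longrightarrow> \<psi> \<tau> z = phi21 \<tau> z ^ m * poly (eval_q_poly (ee \<tau>) Q) (wp0 \<tau> z))"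
  using assms
proof (induction m arbitrary: \<psi> A)
  case (0 \<psi> A)
  let ?C = "fps_nth A 0"
  have "\<psi> \<tau> z = eval_fps ?C (ee \<tau>)" if tau: "Im \<tau> > 0" and z: "z \<notin> Lattice \<tau>" for \<tau> z
  proof (rule elliptic_constant[OF tau, where g = "\<psi> \<tau>"])
    show "\<psi> \<tau> holomorphic_on - Lattice \<tau>" by (rule 0(1)[OF tau])
    show "\<psi> \<tau> (z + 1) = \<psi> \<tau> z" "\<psi> \<tau> (z + \<tau>) = \<psi> \<tau> z" if "z \<notin> Lattice \<tau>" for z
      using 0(2,3)[OF tau that] by auto
    obtain F where F: "F has_fps_expansion eval_q (ee \<tau>) A" "eventually (\<lambda>z. \<psi> \<tau> z = F (s_at z)) (at 0)"
      by (rule local_expD[OF 0(4) tau])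
    have "((\<lambda>z. F (s_at z) / s_at z ^ 0) \<longlongrightarrow> fps_nth (eval_q (ee \<tau>) A) 0) (at 0)"
      by (rule filterlim_compose[OF ratio_tendsto[OF F(1)] filterlim_s_at]) auto
    hence "((\<lambda>z. F (s_at z)) \<longlongrightarrow> eval_fps ?C (ee \<tau>)) (at 0)" by simp
    thus "(\<psi> \<tau> \<longlongrightarrow> eval_fps ?C (ee \<tau>)) (at 0)"
      by (rule Lim_transform_eventually) (use F(2) in \<open>auto elim: eventually_mono\<close>)
  qed fact
  moreover have "disc_fps ?C" using local_exp_disc2[OF 0(4)] by (simp add: disc_fps2_def)
  moreover have "int_poly N [:?C:]" if "int_upto2 N A" for N using that by (auto simp: int_upto2_def)
  ultimately show ?case
    by (intro exI[of _ "[:?C:]"]) (auto simp: disc_poly_pCons disc_poly_def[of 0] eval_q_poly_pCons eval_q_poly_0)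
next
  case (Suc m \<psi> A)
  define C where "C = fps_nth A 0"
  have C: "disc_fps C" using local_exp_disc2[OF Suc.prems(4)] by (simp add: disc_fps2_def C_def)
  define Y where "Y = (\<lambda>\<tau> z. phi21 \<tau> z * wp0 \<tau> z)"
  define \<eta> where "\<eta> = (\<lambda>\<tau> z. \<psi> \<tau> z - eval_fps C (ee \<tau>) * Y \<tau> z ^ Suc m)"
  define A1 where "A1 = A - fps_const C * Y_fps ^ Suc m"
  have l1: "local_exp \<eta> A1" unfolding \<eta>_def A1_def Y_def
    by (intro local_exp_diff local_exp_mult local_exp_const local_exp_power local_exp_Y C Suc.prems(4))
  have "fps_nth A1 0 = 0" unfolding A1_def by (simp add: C_def Y_fps_nth_0 fps_power_zeroth)
  from local_exp_divide_phi21[OF l1 this] obtain B where B: "local_exp (\<lambda>\<tau> z. \<eta> \<tau> z / phi21 \<tau> z) B"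
    "\<And>N. int_upto2 N A1 \<Longrightarrow> int_upto2 N B" by blast
  have hY: "Y \<tau> holomorphic_on - Lattice \<tau>" if "Im \<tau> > 0" for \<tau>
    unfolding Y_def by (intro holomorphic_intros phi21_holomorphic wp0_holomorphic that)
  have Y1: "Y \<tau> (z + 1) = Y \<tau> z" for \<tau> z by (simp add: Y_def)
  have Yt: "Y \<tau> (z + \<tau>) = Y \<tau> z * ee (- \<tau> - 2 * z)" if "Im \<tau> > 0" "z \<notin> Lattice \<tau>" for \<tau> z
    using that by (simp add: Y_def phi21_add_tau wp0_add_tau)
  have "\<exists>Q. degree Q \<le> m \<and> disc_poly Q \<and> (\<forall>N. int_upto2 N B \<longrightarrow> int_poly N Q) \<and>
     (\<forall>\<tau> z. Im \<tau> > 0 \<longrightarrow> z \<notin> Lattice \<tau> \<longrightarrow> \<eta> \<tau> z / phi21 \<tau> z = phi21 \<tau> z ^ m * poly (eval_q_poly (ee \<tau>) Q) (wp0 \<tau> z))"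
  proof (rule Suc.IH[OF _ _ _ B(1)])
    fix \<tau> z :: complex assume tau: "Im \<tau> > 0"
    show "(\<lambda>z. \<eta> \<tau> z / phi21 \<tau> z) holomorphic_on - Lattice \<tau>"
      unfolding \<eta>_def by (intro holomorphic_intros Suc.prems(1) hY phi21_holomorphic tau) (simp add: phi21_eq_0_iff[OF tau])
    assume z: "z \<notin> Lattice \<tau>"
    show "\<eta> \<tau> (z + 1) / phi21 \<tau> (z + 1) = \<eta> \<tau> z / phi21 \<tau> z"
      unfolding \<eta>_def Y1 Suc.prems(2)[OF tau z] by simp
    have "\<eta> \<tau> (z + \<tau>) = \<eta> \<tau> z * ee (- \<tau> - 2 * z) ^ Suc m"
      unfolding \<eta>_def Yt[OF tau z] Suc.prems(3)[OF tau z] by (simp add: power_mult_distrib algebra_simps)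
    thus "\<eta> \<tau> (z + \<tau>) / phi21 \<tau> (z + \<tau>) = \<eta> \<tau> z / phi21 \<tau> z * ee (- \<tau> - 2 * z) ^ m"
      unfolding phi21_add_tau[OF tau] by simp
  qed
  then obtain Q where Q: "degree Q \<le> m" "disc_poly Q" "\<And>N. int_upto2 N B \<Longrightarrow> int_poly N Q"
    "\<And>\<tau> z. Im \<tau> > 0 \<Longrightarrow> z \<notin> Lattice \<tau> \<Longrightarrow> \<eta> \<tau> z / phi21 \<tau> z = phi21 \<tau> z ^ m * poly (eval_q_poly (ee \<tau>) Q) (wp0 \<tau> z)" by blast
  have dm: "disc_poly (monom C (Suc m))" using C by (auto simp: disc_poly_def)
  show ?case
  proof (intro exI[of _ "monom C (Suc m) + Q"] conjI allI impI)
    show "degree (monom C (Suc m) + Q) \<le> Suc m"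
      using Q(1) degree_monom_le[of C "Suc m"] by (intro degree_add_le) auto
    show "disc_poly (monom C (Suc m) + Q)" by (rule disc_poly_add[OF dm Q(2)])
    fix N assume N: "int_upto2 N A"
    have "int_upto N C" using N by (simp add: C_def int_upto2_def)
    moreover from this have "int_upto2 N A1" unfolding A1_def
      by (intro int_upto2_intros int_upto2_power N int_Y_fps)
    ultimately show "int_poly N (monom C (Suc m) + Q)"
      using Q(3)[OF B(2)] by (auto simp: int_poly_def)
  next
    fix \<tau> z :: complex assume tau: "Im \<tau> > 0" and z: "z \<notin> Lattice \<tau>"
    have p0: "phi21 \<tau> z \<noteq> 0" using z phi21_eq_0_iff[OF tau] by simp
    have "\<eta> \<tau> z = phi21 \<tau> z ^ Suc m * poly (eval_q_poly (ee \<tau>) Q) (wp0 \<tau> z)"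
      using Q(4)[OF tau z] p0 by (simp add: field_simps)
    hence "\<psi> \<tau> z = phi21 \<tau> z ^ Suc m * (eval_fps C (ee \<tau>) * wp0 \<tau> z ^ Suc m + poly (eval_q_poly (ee \<tau>) Q) (wp0 \<tau> z))"
      by (simp add: \<eta>_def Y_def power_mult_distrib algebra_simps)
    also have "eval_fps C (ee \<tau>) * wp0 \<tau> z ^ Suc m + poly (eval_q_poly (ee \<tau>) Q) (wp0 \<tau> z) = poly (eval_q_poly (ee \<tau>)
      (monom C (Suc m) + Q)) (wp0 \<tau> z)"
      by (simp only: eval_q_poly_add[OF dm Q(2) norm_ee_less_1[OF tau]] eval_q_poly_monom poly_add poly_monom)
    finally show "\<psi> \<tau> z = phi21 \<tau> z ^ Suc m * poly (eval_q_poly (ee \<tau>) (monom C (Suc m) + Q)) (wp0 \<tau> z)" .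
  qed
qed

lemma poly_sum_atMost:
  fixes p :: "complex poly"
  assumes "degree p \<le> m" shows "poly p x = (\<Sum>i\<le>m. coeff p i * x ^ i)"
  unfolding poly_altdef using assms by (intro sum.mono_neutral_left) (auto simp: coeff_eq_0)

text \<open>Writing \<open>phi21 ^ m * wp0 ^ i\<close> as
  \<open>phi21 ^ (m - i) * (phi21 * wp0) ^ i\<close> absorbs all poles into two integral
  expansions.\<close>

lemma local_exp_of_poly:
  assumes "degree Q \<le> m" "disc_poly Q" "int_poly N Q"
    and "\<And>\<tau> z. Im \<tau> > 0 \<Longrightarrow> z \<notin> Lattice \<tau> \<Longrightarrow> \<psi> \<tau> z = phi21 \<tau> z ^ m * poly (eval_q_poly (ee \<tau>) Q) (wp0 \<tau> z)"
  obtains B where "local_exp \<psi> B" "int_upto2 N B"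
proof -
  define B where "B = (\<Sum>i\<le>m. fps_const (coeff Q i) * (fps_X * theta_fps ^ 2) ^ (m - i) * Y_fps ^ i)"
  have "local_exp (\<lambda>\<tau> z. \<Sum>i\<le>m. eval_fps (coeff Q i) (ee \<tau>) * phi21 \<tau> z ^ (m - i) * (phi21 \<tau> z * wp0 \<tau> z) ^ i) B"
    unfolding B_def using assms(2)
    by (intro local_exp_sum local_exp_mult local_exp_power local_exp_phi21 local_exp_Y local_exp_const) (auto simp: disc_poly_def)
  hence "local_exp \<psi> B"
  proof (rule local_exp_cong)
    fix \<tau> :: complex assume tau: "Im \<tau> > 0"
    show "eventually (\<lambda>z. \<psi> \<tau> z = (\<Sum>i\<le>m. eval_fps (coeff Q i) (ee \<tau>) * phi21 \<tau> z ^ (m - i) * (phi21 \<tau> z * wp0 \<tau> z) ^ i)) (at 0)"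
      using eventually_not_Lattice[OF tau]
    proof eventually_elim
      case (elim z)
      have deg: "degree (eval_q_poly (ee \<tau>) Q) \<le> m" using assms(1) by (intro degree_le) (auto simp: coeff_eq_0)
      have "\<psi> \<tau> z = phi21 \<tau> z ^ m * (\<Sum>i\<le>m. eval_fps (coeff Q i) (ee \<tau>) * wp0 \<tau> z ^ i)"
        unfolding assms(4)[OF tau elim] poly_sum_atMost[OF deg] by simp
      also have "\<dots> = (\<Sum>i\<le>m. eval_fps (coeff Q i) (ee \<tau>) * phi21 \<tau> z ^ (m - i) * (phi21 \<tau> z * wp0 \<tau> z) ^ i)"
        unfolding sum_distrib_left
      proof (rule sum.cong[OF refl])
        fix i assume "i \<in> {..m}"
        hence "phi21 \<tau> z ^ m = phi21 \<tau> z ^ (m - i) * phi21 \<tau> z ^ i" by (simp add: power_add[symmetric])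
        thus "phi21 \<tau> z ^ m * (eval_fps (coeff Q i) (ee \<tau>) * wp0 \<tau> z ^ i) =
           eval_fps (coeff Q i) (ee \<tau>) * phi21 \<tau> z ^ (m - i) * (phi21 \<tau> z * wp0 \<tau> z) ^ i"
          by (simp add: power_mult_distrib mult_ac)
      qed
      finally show ?case .
    qed
  qed
  moreover have "int_upto2 N B" unfolding B_def
    by (intro int_upto2_sum int_upto2_intros int_upto2_power int_Y_fps) (use assms(3) in \<open>auto simp: int_poly_def\<close>)
  ultimately show ?thesis using that by blast
qed

section \<open>Modularity of the coefficients\<close>

lemma wp_at_infinity: assumes "Im \<tau> > 0" shows "filterlim (wp \<tau>) at_infinity (at 0)"
proof -
  have "filterlim (\<lambda>z. inverse (twopi z ^ 2)) at_infinity (at 0)"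
  proof (rule filterlim_compose[OF filterlim_inverse_at_infinity])
    have "(twopi \<longlongrightarrow> 0) (at 0)" "eventually (\<lambda>z. twopi z \<noteq> 0) (at 0)"
      using filterlim_twopi by (auto simp: filterlim_at elim: eventually_mono)
    thus "filterlim (\<lambda>z. twopi z ^ 2) (at 0) (at 0)"
      by (auto simp: filterlim_at intro!: tendsto_eq_intros elim: eventually_mono)
  qed
  hence "filterlim (\<lambda>z. - inverse (twopi z ^ 2)) at_infinity (at 0)"
    by (simp add: filterlim_at_infinity[OF order_refl])
  from tendsto_add_filterlim_at_infinity[OF wp_reg_tendsto_0[OF assms] this]
  show ?thesis by (simp add: wp_reg_def divide_inverse)
qed

text \<open>Near its pole \<open>wp\<close> exceeds every bound on the roots of a nonzero
  polynomial.\<close>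

lemma poly_wp_eq_imp_eq:
  assumes tau: "Im \<tau> > 0" and eq: "\<And>z. z \<notin> Lattice \<tau> \<Longrightarrow> poly p (wp \<tau> z) = poly r (wp \<tau> z)"
  shows "p = r"
proof (rule ccontr)
  assume "p \<noteq> r"
  hence "finite {x. poly (p - r) x = 0}" by (intro poly_roots_finite) simp
  hence "bounded {x. poly (p - r) x = 0}" by (rule finite_imp_bounded)
  then obtain b where b: "\<And>x. poly (p - r) x = 0 \<Longrightarrow> norm x \<le> b" by (auto simp: bounded_iff)
  have "eventually (\<lambda>z. norm (wp \<tau> z) \<ge> max b 0 + 1) (at 0)"
    using wp_at_infinity[OF tau] unfolding filterlim_at_infinity[OF order_refl] by simp
  hence "eventually (\<lambda>z. False) (at (0::complex))"
    using eventually_not_Lattice[OF tau]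
  proof eventually_elim
    case (elim z)
    have "norm (wp \<tau> z) \<le> b" by (rule b) (simp add: eq[OF elim(2)])
    thus False using elim(1) by simp
  qed
  thus False by simp
qed

text \<open>The shift from \<open>wp0\<close> back to \<open>wp\<close> is made because
  \<open>wp\<close> has a clean law of weight 2. As \<open>phi21\<close> has weight -2, comparing
  both sides as polynomials in \<open>wp\<close> gives the coefficient of degree i the weight w + 2
  m - 2 i.\<close>

theorem modular_structure:
  assumes Q: "degree Q \<le> m" "disc_poly Q"
    and psi: "\<And>\<tau> z. Im \<tau> > 0 \<Longrightarrow> z \<notin> Lattice \<tau> \<Longrightarrow> \<psi> \<tau> z = phi21 \<tau> z ^ m * poly (eval_q_poly (ee \<tau>) Q) (wp0 \<tau> z)"
    and S: "\<And>\<tau> z. Im \<tau> > 0 \<Longrightarrow> \<psi> (- 1 / \<tau>) (z / \<tau>) = \<tau> powi w * ee (z\<^sup>2 / \<tau>) ^ m * \<psi> \<tau> z"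
  obtains R where "jacobi_poly w m R" "shift_poly R = Q"
proof -
  define R where "R = pcompose Q [:- twelfth, 1:]"
  have dcc: "disc_fps (- twelfth)" by (auto simp: twelfth_def)
  have dR: "disc_poly R" unfolding R_def using eval_q_poly_pcompose(1)[OF Q(2) dcc, of 0] by simp
  have "shift_poly R = pcompose Q (pcompose [:- twelfth, 1:] [:twelfth, 1:])" unfolding shift_poly_def R_def
    by (rule pcompose_assoc[symmetric])
  also have "pcompose [:- twelfth, 1:] [:twelfth, 1:] = [:0, 1:]" by (simp add: pcompose_pCons)
  finally have shR: "shift_poly R = Q" by (simp add: pcompose_idR)
  have degR: "degree R \<le> m" using Q(1) by (simp add: R_def degree_pcompose)
  have ecc: "eval_fps (- twelfth) q = - 1 / 12" for q
  proof -
    have "- twelfth = fps_const (- 1 / 12)" by (simp add: twelfth_def)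
    thus ?thesis by (simp only: eval_fps_const)
  qed
  have psi': "\<psi> \<tau> z = phi21 \<tau> z ^ m * poly (eval_q_poly (ee \<tau>) R) (wp \<tau> z)" if "Im \<tau> > 0" "z \<notin> Lattice \<tau>" for \<tau> z
    unfolding psi[OF that] R_def eval_q_poly_pcompose(2)[OF Q(2) dcc norm_ee_less_1[OF that(1)]] ecc by (simp add: wp_def)
  have "jacobi_poly w m R"
    unfolding jacobi_poly_def modular_fps_def
  proof (intro conjI allI impI degR)
    fix i
    show "disc_fps (coeff R i)" using dR by (simp add: disc_poly_def)
    fix \<tau> :: complex assume tau: "Im \<tau> > 0"
    have t0: "\<tau> \<noteq> 0" using tau by auto
    let ?t = "- 1 / \<tau>"
    have It: "Im ?t > 0" by (rule Im_S[OF tau])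
    define p where "p = eval_q_poly (ee ?t) R"
    define r where "r = eval_q_poly (ee \<tau>) R"
    have "pcompose p [:0, \<tau>\<^sup>2:] = smult (\<tau> powi (w + 2 * int m)) r"
    proof (rule poly_wp_eq_imp_eq[OF tau])
      fix z assume z: "z \<notin> Lattice \<tau>"
      have z': "z / \<tau> \<notin> Lattice ?t" using z Lattice_S[OF t0] by simp
      have p0: "phi21 \<tau> z \<noteq> 0" using z phi21_eq_0_iff[OF tau] by simp
      have "(ee (z\<^sup>2 / \<tau>) / \<tau>\<^sup>2 * phi21 \<tau> z) ^ m * poly p (\<tau>\<^sup>2 * wp \<tau> z) = \<psi> ?t (z / \<tau>)"
        unfolding psi'[OF It z'] phi21_S[OF tau] wp_S[OF tau z] p_def ..
      also have "\<dots> = \<tau> powi w * ee (z\<^sup>2 / \<tau>) ^ m * (phi21 \<tau> z ^ m * poly r (wp \<tau> z))"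
        unfolding S[OF tau] psi'[OF tau z] r_def ..
      finally have "poly p (\<tau>\<^sup>2 * wp \<tau> z) / (\<tau>\<^sup>2) ^ m = \<tau> powi w * poly r (wp \<tau> z)"
        using p0 t0 by (simp add: power_mult_distrib power_divide field_simps)
      hence "poly p (\<tau>\<^sup>2 * wp \<tau> z) = \<tau> powi w * (\<tau>\<^sup>2) ^ m * poly r (wp \<tau> z)" using t0 by (simp add: field_simps)
      also have "\<tau> powi w * (\<tau>\<^sup>2) ^ m = \<tau> powi (w + 2 * int m)"
      proof -
        have "(\<tau>\<^sup>2) ^ m = \<tau> powi int (2 * m)" by (simp only: power_int_of_nat power_mult)
        thus ?thesis using t0 by (simp add: power_int_add)
      qed
      finally show "poly (pcompose p [:0, \<tau>\<^sup>2:]) (wp \<tau> z) = poly (smult (\<tau> powi (w + 2 * int m)) r) (wp \<tau> z)"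
        by (simp add: poly_pcompose mult.commute)
    qed
    from arg_cong[OF this, of "\<lambda>p. coeff p i"]
    have "(\<tau>\<^sup>2) ^ i * eval_fps (coeff R i) (ee ?t) = \<tau> powi (w + 2 * int m) * eval_fps (coeff R i) (ee \<tau>)"
      by (simp add: p_def r_def coeff_pcompose_linear)
    moreover have "\<tau> powi (w + 2 * int m) = (\<tau>\<^sup>2) ^ i * \<tau> powi (w + 2 * (int m - int i))"
    proof -
      have "(\<tau>\<^sup>2) ^ i = \<tau> powi int (2 * i)" by (simp only: power_int_of_nat power_mult)
      thus ?thesis using t0 by (simp add: power_int_add[symmetric] algebra_simps)
    qed
    ultimately show "eval_fps (coeff R i) (ee ?t) = \<tau> powi (w + 2 * (int m - int i)) * eval_fps (coeff R i) (ee \<tau>)"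
      using t0 by simp
  qed
  thus ?thesis using that shR by blast
qed

section \<open>Fourier coefficients\<close>

text \<open>The last conclusion bounds the rearranged series by the same total of norms; this
  estimate is what allows a second rearrangement, over powers of \<open>q\<close>.\<close>

lemma fubini_complex:
  fixes f :: "'a \<Rightarrow> 'b \<Rightarrow> complex"
  assumes N: "\<And>x. ((\<lambda>y. norm (f x y)) has_sum N x) UNIV" "N summable_on UNIV"
    and g: "\<And>x. (f x has_sum g x) UNIV" "(g has_sum S) UNIV"
  shows "(\<lambda>x. norm (f x y)) summable_on UNIV"
    and "((\<lambda>y. \<Sum>\<^sub>\<infinity>x. f x y) has_sum S) UNIV"
    and "(\<lambda>y. norm (\<Sum>\<^sub>\<infinity>x. f x y)) summable_on UNIV"
    and "(\<Sum>\<^sub>\<infinity>y. norm (\<Sum>\<^sub>\<infinity>x. f x y)) \<le> infsum N UNIV"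
proof -
  have N0: "N x \<ge> 0" for x using N(1)[of x] by (rule has_sum_nonneg) auto
  have iN: "(\<Sum>\<^sub>\<infinity>y. norm (f x y)) = N x" for x using N(1) by (rule infsumI)
  have sp: "(\<lambda>p. norm ((\<lambda>(x, y). f x y) p)) summable_on (UNIV \<times> UNIV)"
    unfolding Infinite_Sum.abs_summable_on_Sigma_iff
    using N N0 by (auto simp: iN summable_on_def)
  have sp': "(\<lambda>p. norm ((\<lambda>(y, x). f x y) p)) summable_on (UNIV \<times> UNIV)"
    using sp by (subst summable_on_swap) (simp add: case_prod_unfold)
  from sp'[unfolded Infinite_Sum.abs_summable_on_Sigma_iff]
  have col: "(\<lambda>x. norm (f x y)) summable_on UNIV" for y by auto
  thus "(\<lambda>x. norm (f x y)) summable_on UNIV" .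
  have colN: "(\<lambda>y. \<Sum>\<^sub>\<infinity>x. norm (f x y)) summable_on UNIV"
    using sp'[unfolded Infinite_Sum.abs_summable_on_Sigma_iff] summable_on_iff_abs_summable_on_real by auto
  have le: "norm (\<Sum>\<^sub>\<infinity>x. f x y) \<le> (\<Sum>\<^sub>\<infinity>x. norm (f x y))" for y
    by (rule norm_infsum_bound[OF col])
  show sn: "(\<lambda>y. norm (\<Sum>\<^sub>\<infinity>x. f x y)) summable_on UNIV"
    by (rule summable_on_comparison_test[OF colN]) (use le in auto)
  have "(\<Sum>\<^sub>\<infinity>y. norm (\<Sum>\<^sub>\<infinity>x. f x y)) \<le> (\<Sum>\<^sub>\<infinity>y. \<Sum>\<^sub>\<infinity>x. norm (f x y))"
    by (rule infsum_mono[OF sn colN le])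
  also have "\<dots> = (\<Sum>\<^sub>\<infinity>x. \<Sum>\<^sub>\<infinity>y. norm (f x y))"
    by (rule infsum_swap_banach[symmetric]) (use sp in \<open>simp add: case_prod_unfold\<close>)
  also have "\<dots> = infsum N UNIV" by (simp add: iN)
  finally show "(\<Sum>\<^sub>\<infinity>y. norm (\<Sum>\<^sub>\<infinity>x. f x y)) \<le> infsum N UNIV" .
  have s: "(\<lambda>(x, y). f x y) summable_on (UNIV \<times> UNIV)"
    using sp by (rule Infinite_Sum.abs_summable_summable)
  have "((\<lambda>(x, y). f x y) has_sum S) (UNIV \<times> UNIV)"
    by (rule has_sum_SigmaI[OF _ g(2) s]) (use g in auto)
  hence "((\<lambda>(y, x). f x y) has_sum S) (UNIV \<times> UNIV)"
    by (subst has_sum_swap) (simp add: case_prod_unfold)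
  thus "((\<lambda>y. \<Sum>\<^sub>\<infinity>x. f x y) has_sum S) UNIV"
  proof (rule has_sum_SigmaD)
    fix y show "((\<lambda>x. (\<lambda>(y, x). f x y) (y, x)) has_sum (\<Sum>\<^sub>\<infinity>x. f x y)) UNIV"
      using Infinite_Sum.abs_summable_summable[OF col[of y]] by (simp add: summable_iff_has_sum_infsum)
  qed
qed

section \<open>Uniqueness of Laurent series on the punctured plane\<close>

lemma summable_on_pos_ints:
  fixes f :: "int \<Rightarrow> complex"
  assumes "f summable_on (UNIV :: int set)"
  shows "(\<lambda>n. f (int n)) summable_on UNIV" "(\<lambda>n. f (- int (Suc n))) summable_on UNIV"
proof -
  have "f summable_on (range int)" "f summable_on (range (\<lambda>n. - int (Suc n)))"
    using assms by (rule summable_on_subset_banach, simp)+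
  thus "(\<lambda>n. f (int n)) summable_on UNIV" "(\<lambda>n. f (- int (Suc n))) summable_on UNIV"
    by (subst (asm) summable_on_reindex, simp add: inj_on_def, simp add: o_def)+
qed

lemma disc_fps_of_summable:
  assumes "\<And>r. 0 < r \<Longrightarrow> r < 1 \<Longrightarrow> summable (\<lambda>n. c n * complex_of_real r ^ n)"
  shows "disc_fps (Abs_fps c)"
  unfolding disc_fps_def fps_conv_radius_def
  by (rule conv_radius_geI_ex') (use assms in \<open>auto simp: one_ereal_def\<close>)

text \<open>The part with nonnegative exponents is entire and equals minus the other part, a
  continuous function of 1/w on the closed unit disc. It is therefore bounded inside and outside the
  unit circle, hence constant; the other part has no constant term, so both vanish.\<close>

lemma laurent_unique:
  assumes z: "\<And>w. w \<noteq> 0 \<Longrightarrow> ((\<lambda>l. b l * w powi l) has_sum 0) (UNIV :: int set)"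
  shows "b l = (0 :: complex)"
proof -
  define Fp where "Fp = Abs_fps (\<lambda>n. b (int n))"
  define Fm where "Fm = Abs_fps (\<lambda>n. b (- int (Suc n)))"
  have sp: "summable (\<lambda>n. b (int n) * w ^ n)" if "w \<noteq> 0" for w
    using summable_on_imp_summable[OF summable_on_pos_ints(1)[of "\<lambda>l. b l * w powi l"]] z[OF that]
    by (auto simp: summable_on_def)
  have sm: "summable (\<lambda>n. b (- int (Suc n)) * w ^ n)" if "w \<noteq> 0" for w
  proof -
    have "summable (\<lambda>n. b (- int (Suc n)) * inverse w powi (- int (Suc n)))"
      using summable_on_imp_summable[OF summable_on_pos_ints(2)[of "\<lambda>l. b l * inverse w powi l"]] z[of "inverse w"] that
      by (auto simp: summable_on_def)
    moreover have "b (- int (Suc n)) * inverse w powi (- int (Suc n)) = w * (b (- int (Suc n)) * w ^ n)" for n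
      by (simp only: power_int_minus power_int_of_nat power_inverse inverse_inverse_eq) (simp add: mult_ac)
    ultimately have "summable (\<lambda>n. w * (b (- int (Suc n)) * w ^ n))" by (simp only:)
    thus ?thesis using that by (rule summable_mult_D)
  qed
  have cp: "fps_conv_radius Fp = \<infinity>" "fps_conv_radius Fm = \<infinity>"
    unfolding Fp_def Fm_def fps_conv_radius_def
    by (rule conv_radius_inftyI'', rename_tac w, case_tac "w = 0", use sp sm in \<open>auto intro: summable_0_powser\<close>)+
  have eq: "eval_fps Fp w + inverse w * eval_fps Fm (inverse w) = 0" if w: "w \<noteq> 0" for w
  proof -
    have 1: "((\<lambda>n. b (int n) * w ^ n) has_sum eval_fps Fp w) UNIV"
      unfolding eval_fps_def Fp_def
      by (rule norm_summable_imp_has_sum, use norm_summable_fps[of w Fp] cp in \<open>simp add: Fp_def\<close>)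
         (simp add: summable_sums sp w)
    have 2: "((\<lambda>n. b (- int (Suc n)) * inverse w ^ n) has_sum eval_fps Fm (inverse w)) UNIV"
      unfolding eval_fps_def Fm_def
      by (rule norm_summable_imp_has_sum, use norm_summable_fps[of "inverse w" Fm] cp in \<open>simp add: Fm_def\<close>)
         (use summable_sums[OF sm[of "inverse w"]] w in simp)
    have 3: "((\<lambda>l. b l * w powi l) has_sum eval_fps Fp w) (range int)"
      using 1 by (subst has_sum_reindex) (auto simp: inj_on_def o_def)
    have "((\<lambda>n. b (- int (Suc n)) * w powi (- int (Suc n))) has_sum inverse w * eval_fps Fm (inverse w)) UNIV"
    proof -
      have *: "b (- int (Suc n)) * w powi (- int (Suc n)) = inverse w * (b (- int (Suc n)) * inverse w ^ n)" for n
        by (simp only: power_int_minus power_int_of_nat power_inverse power_Suc inverse_mult_distrib mult.assoc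
          mult.left_commute[of "b _"])
      show ?thesis unfolding * by (rule has_sum_cmult_right[OF 2])
    qed
    hence 4: "((\<lambda>l. b l * w powi l) has_sum inverse w * eval_fps Fm (inverse w)) (range (\<lambda>n. - int (Suc n)))"
      by (subst has_sum_reindex) (auto simp: inj_on_def o_def)
    have U: "range int \<union> range (\<lambda>n. - int (Suc n)) = UNIV"
    proof -
      have "l \<in> range int \<union> range (\<lambda>n. - int (Suc n))" for l by (cases l rule: int_cases) blast+
      thus ?thesis by blast
    qed
    have "((\<lambda>l. b l * w powi l) has_sum (eval_fps Fp w + inverse w * eval_fps Fm (inverse w))) UNIV"
      unfolding U[symmetric] by (rule has_sum_Un_disjoint[OF 3 4]) auto
    thus ?thesis using has_sum_unique z[OF w] by blast
  qed
  have hol: "eval_fps Fp holomorphic_on UNIV" "eval_fps Fm holomorphic_on UNIV"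
    by (rule holomorphic_on_eval_fps; simp add: cp)+
  have "bounded (range (eval_fps Fp))"
  proof -
    have "compact (eval_fps Fp ` cball 0 1)" "compact ((\<lambda>w. w * eval_fps Fm w) ` cball 0 1)"
      by (intro compact_continuous_image holomorphic_on_imp_continuous_on holomorphic_intros
            holomorphic_on_subset[OF hol(1)] holomorphic_on_subset[OF hol(2)] compact_cball subset_UNIV)+
    from this[THEN compact_imp_bounded] obtain B1 B2 where "\<forall>w\<in>cball 0 1. norm (eval_fps Fp w) \<le> B1"
      "\<forall>w\<in>cball 0 1. norm (w * eval_fps Fm w) \<le> B2"
      unfolding bounded_iff by auto
    hence B: "\<And>w. norm w \<le> 1 \<Longrightarrow> norm (eval_fps Fp w) \<le> B1"
      "\<And>w. norm w \<le> 1 \<Longrightarrow> norm (w * eval_fps Fm w) \<le> B2"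
      by simp_all
    have "norm (eval_fps Fp w) \<le> max B1 B2" for w
    proof (cases "norm w \<le> 1")
      case False
      hence "w \<noteq> 0" "norm (inverse w) \<le> 1" by (auto simp: norm_inverse inverse_le_1_iff)
      thus ?thesis using B(2)[of "inverse w"] eq[of w] by (simp add: add_eq_0_iff2)
    qed (use B(1)[of w] in auto)
    thus ?thesis by (auto simp: bounded_iff)
  qed
  from Liouville_theorem[OF hol(1) this] obtain c where c: "\<And>w. eval_fps Fp w = c" by (auto simp: constant_on_def)
  have d: "disc_fps Fp" "disc_fps Fm" using cp by (auto simp: disc_fps_def)
  have 1: "Fp = fps_const c" by (rule disc_fps_eqI) (use d c in auto)
  have 2: "fps_X * Fm = - fps_const c"
  proof (rule disc_fps_eqI)
    fix q :: complex assume q: "norm q < 1" "q \<noteq> 0"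
    show "eval_fps (fps_X * Fm) q = eval_fps (- fps_const c) q"
      using eq[of "inverse q"] q d(2) c by (simp add: ev_mult ev_uminus add_eq_0_iff2 del: fps_const_neg)
  qed (use d in \<open>auto simp del: fps_const_neg\<close>)
  have c0: "c = 0" using arg_cong[OF 2, of "\<lambda>F. fps_nth F 0"] by simp
  have "Fp = 0" "Fm = 0" using 1 2 by (auto simp: c0)
  hence "b (int n) = 0" "b (- int (Suc n)) = 0" for n
    unfolding Fp_def Fm_def by (auto simp: fps_eq_iff simp del: of_nat_Suc)
  thus ?thesis by (metis int_cases)
qed

text \<open>\<open>cheb l\<close> expresses \<open>w ^ l + w ^ (- l)\<close> as a polynomial in \<open>s_of w\<close>. Its coefficients are natural numbers,
  so absolute convergence of a Laurent series at a positive \<open>x\<close> bounds the rearrangement in powers of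
  \<open>s_of w\<close> at every \<open>w\<close> with \<open>norm (s_of w) = s_of x\<close>.\<close>

fun cheb2 :: "nat \<Rightarrow> 'a :: comm_ring_1 poly \<times> 'a poly" where
  "cheb2 0 = ([:2:], [:0, 1:])"
| "cheb2 (Suc l) = (fst (cheb2 l) + snd (cheb2 l), snd (cheb2 l) + [:0, 1:] * (fst (cheb2 l) + snd (cheb2 l)))"

definition cheb :: "nat \<Rightarrow> 'a :: comm_ring_1 poly" where "cheb l = fst (cheb2 l)"

text \<open>The three-term recurrence contains a subtraction. The second component of
  \<open>cheb2\<close> carries the difference of consecutive polynomials, and in this form only
  additions occur, so nonnegativity follows by induction.\<close>

lemma cheb2_coeffs:
  "coeff (fst (cheb2 l :: 'a :: comm_ring_1 poly \<times> 'a poly)) i = of_nat (nat (coeff (fst (cheb2 l) :: int poly) i)) \<and>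
   coeff (fst (cheb2 l) :: int poly) i \<ge> 0 \<and>
   coeff (snd (cheb2 l :: 'a poly \<times> 'a poly)) i = of_nat (nat (coeff (snd (cheb2 l) :: int poly) i)) \<and>
   coeff (snd (cheb2 l) :: int poly) i \<ge> 0"
proof (induction l arbitrary: i)
  case 0
  show ?case by (auto simp: coeff_pCons split: nat.splits)
next
  case (Suc l)
  show ?case
    using Suc[of i] Suc[of "i - 1"]
    by (cases i) (auto simp: nat_add_distrib)
qed

definition cheb_coeff :: "nat \<Rightarrow> nat \<Rightarrow> nat" where "cheb_coeff l i = nat (coeff (cheb l :: int poly) i)"

lemma coeff_cheb: "coeff (cheb l :: 'a :: comm_ring_1 poly) i = of_nat (cheb_coeff l i)"
  using cheb2_coeffs[of l i] by (auto simp: cheb_def cheb_coeff_def)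

lemma cheb_eval:
  fixes w :: "'a :: field" assumes "w \<noteq> 0"
  shows "poly (cheb l) (w - 2 + 1 / w) = w ^ l + inverse w ^ l"
proof -
  have "poly (fst (cheb2 l)) (w - 2 + 1 / w) = w ^ l + inverse w ^ l \<and>
     poly (snd (cheb2 l)) (w - 2 + 1 / w) = w ^ Suc l + inverse w ^ Suc l - w ^ l - inverse w ^ l"
  proof (induction l)
    case (Suc l)
    define v where "v = inverse w"
    have wv: "w * v = 1" using assms by (simp add: v_def)
    have "1 / w = v" by (simp add: v_def divide_inverse)
    have "(w + v) * (w * w ^ l + v * v ^ l) = w * (w * w ^ l) + v * (v * v ^ l) + (w * v) * (w ^ l + v ^ l)"
      by (simp add: algebra_simps)
    hence *: "(w + v) * (w * w ^ l + v * v ^ l) = w * (w * w ^ l) + v * (v * v ^ l) + (w ^ l + v ^ l)" by (simp add: wv)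
    define p d where "p = poly (fst (cheb2 l)) (w - 2 + v)" and "d = poly (snd (cheb2 l)) (w - 2 + v)"
    have p: "p = w ^ l + v ^ l" and d: "d = w * w ^ l + v * v ^ l - w ^ l - v ^ l"
      using Suc unfolding \<open>1 / w = v\<close> v_def[symmetric] p_def d_def by auto
    have pd: "p + d = w * w ^ l + v * v ^ l" by (simp add: p d)
    have "d + (w - 2 + v) * (p + d) = d - 2 * (p + d) + (w + v) * (w * w ^ l + v * v ^ l)"
      unfolding pd by (simp add: algebra_simps)
    also have "\<dots> = w * (w * w ^ l) + v * (v * v ^ l) - w * w ^ l - v * v ^ l"
      unfolding * pd by (simp add: d algebra_simps)
    finally have "d + (w - 2 + v) * (p + d) = w * (w * w ^ l) + v * (v * v ^ l) - w * w ^ l - v * v ^ l" .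
    thus ?case using pd unfolding \<open>1 / w = v\<close> v_def[symmetric] p_def d_def by simp
  qed (auto simp: divide_inverse)
  thus ?thesis by (simp add: cheb_def)
qed

lemma degree_cheb: "degree (cheb l :: complex poly) \<le> l"
proof -
  have "degree (fst (cheb2 l) :: complex poly) \<le> l \<and> degree (snd (cheb2 l) :: complex poly) \<le> Suc l"
  proof (induction l)
    case (Suc l)
    have 1: "degree (fst (cheb2 l) + snd (cheb2 l) :: complex poly) \<le> Suc l"
      using Suc by (intro degree_add_le) auto
    hence "degree ([:0, 1:] * (fst (cheb2 l) + snd (cheb2 l)) :: complex poly) \<le> Suc (Suc l)"
      by (intro order_trans[OF degree_mult_le]) auto
    thus ?case using 1 Suc by (simp del: mult_pCons_left) (intro degree_add_le, auto)
  qed auto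
  thus ?thesis by (simp add: cheb_def)
qed

lemma cheb_coeff_eq_0: "l < i \<Longrightarrow> cheb_coeff l i = 0"
  using coeff_cheb[of l i, where ?'a = complex] degree_cheb[of l] coeff_eq_0[of "cheb l :: complex poly" i] by simp

lemma cheb_sum: "w \<noteq> 0 \<Longrightarrow> (\<Sum>i\<le>l. of_nat (cheb_coeff l i) * s_of w ^ i) = w ^ l + inverse w ^ l"
  using cheb_eval[of w l] poly_sum_atMost[OF degree_cheb, of l "s_of w"] by (simp add: s_of_def coeff_cheb)

lemma cheb_sum_real:
  fixes x :: real assumes "x > 0"
  shows "(\<Sum>i\<le>l. real (cheb_coeff l i) * (x - 2 + 1 / x) ^ i) = x ^ l + inverse x ^ l"
proof -
  have "complex_of_real (\<Sum>i\<le>l. real (cheb_coeff l i) * (x - 2 + 1 / x) ^ i) = of_real (x ^ l + inverse x ^ l)"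
    using cheb_sum[of "of_real x" l] assms by (simp add: s_of_def)
  thus ?thesis by (simp only: of_real_eq_iff)
qed

lemma s_of_real_surj: assumes "s \<ge> (0::real)" obtains x where "x > 0" "x - 2 + 1 / x = s"
proof -
  define d where "d = sqrt ((s + 2)\<^sup>2 - 4)"
  have "(s + 2)\<^sup>2 \<ge> 2\<^sup>2" using assms by (intro power_mono) auto
  hence d: "d\<^sup>2 = (s + 2)\<^sup>2 - 4" "d \<ge> 0" by (auto simp: d_def)
  define x where "x = (s + 2 + d) / 2"
  have x: "x > 0" using assms d by (simp add: x_def)
  have "x\<^sup>2 + 1 = (s + 2) * x" using d(1) by (simp add: x_def field_simps power2_eq_square)
  hence "x + 1 / x = s + 2" using x by (simp add: field_simps power2_eq_square)
  thus ?thesis using that[of x] x by simp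
qed

lemma powi_nat_abs: "w \<noteq> 0 \<Longrightarrow> w ^ nat \<bar>l\<bar> + inverse w ^ nat \<bar>l\<bar> = w powi l + w powi (- l)" for w :: "'a :: field"
  by (cases "l \<ge> 0") (auto simp: power_int_def)

text \<open>The division by 2 accounts for the sum running over both l and -l; at
  \<open>l = 0\<close> it is offset by \<open>cheb 0 = 2\<close>.\<close>

definition s_coeff :: "(int \<Rightarrow> complex) \<Rightarrow> nat \<Rightarrow> complex" where
  "s_coeff b i = (\<Sum>\<^sub>\<infinity>l. b l * of_nat (cheb_coeff (nat \<bar>l\<bar>) i) / 2)"

text \<open>The real point \<open>x\<close> has \<open>s\<close>-value equal to the norm of
  \<open>s_of w\<close>. Since the coefficients of \<open>cheb\<close> are nonnegative, the norms in
  the double series sum to the norms of the Laurent series at \<open>x\<close>, symmetrised under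
  inversion, and the order of summation may be exchanged.\<close>

lemma s_coeff_sum:
  assumes even: "\<And>l. b (- l) = b l"
    and sm: "\<And>w. w \<noteq> 0 \<Longrightarrow> (\<lambda>l. norm (b l * w powi l)) summable_on UNIV"
    and w: "w \<noteq> 0" and x: "x > 0" "x - 2 + 1 / x = norm (s_of w)"
  shows "((\<lambda>i. s_coeff b i * s_of w ^ i) has_sum (\<Sum>\<^sub>\<infinity>l. b l * w powi l)) UNIV"
    and "(\<lambda>i. norm (s_coeff b i * s_of w ^ i)) summable_on UNIV"
    and "(\<Sum>\<^sub>\<infinity>i. norm (s_coeff b i * s_of w ^ i)) \<le> (\<Sum>\<^sub>\<infinity>l. norm (b l * of_real x powi l))"
proof -
  define f where "f = (\<lambda>(l::int) i. b l * of_nat (cheb_coeff (nat \<bar>l\<bar>) i) / 2 * s_of w ^ i)"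
  have flip: "((\<lambda>l. h (- l)) has_sum S) UNIV \<longleftrightarrow> (h has_sum S) UNIV" for h :: "int \<Rightarrow> 'c :: topological_comm_monoid_add" and S
    by (rule has_sum_reindex_bij_witness[of _ uminus uminus]) auto
  define N where "N = (\<lambda>l. norm (b l) / 2 * (x powi l + x powi (- l)))"
  have fN: "((\<lambda>i. norm (f l i)) has_sum N l) UNIV" for l
  proof (rule has_sum_finite_neutralI[of "{..nat \<bar>l\<bar>}"])
    show "\<And>i. i \<in> UNIV - {..nat \<bar>l\<bar>} \<Longrightarrow> norm (f l i) = 0" by (simp add: f_def cheb_coeff_eq_0)
    have "N l = norm (b l) / 2 * (\<Sum>i\<le>nat \<bar>l\<bar>. real (cheb_coeff (nat \<bar>l\<bar>) i) * norm (s_of w) ^ i)"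
      unfolding x(2)[symmetric] cheb_sum_real[OF x(1)] N_def using x(1) by (subst powi_nat_abs) auto
    also have "\<dots> = (\<Sum>i\<le>nat \<bar>l\<bar>. norm (f l i))"
      by (simp add: sum_distrib_left f_def norm_mult norm_power norm_divide mult_ac)
    finally show "N l = (\<Sum>i\<le>nat \<bar>l\<bar>. norm (f l i))" .
  qed auto
  have fg: "(f l has_sum b l / 2 * (w powi l + w powi (- l))) UNIV" for l
  proof (rule has_sum_finite_neutralI[of "{..nat \<bar>l\<bar>}"])
    show "\<And>i. i \<in> UNIV - {..nat \<bar>l\<bar>} \<Longrightarrow> f l i = 0" by (simp add: f_def cheb_coeff_eq_0)
    have "b l / 2 * (w powi l + w powi (- l)) = b l / 2 * (\<Sum>i\<le>nat \<bar>l\<bar>. of_nat (cheb_coeff (nat \<bar>l\<bar>) i) * s_of w ^ i)"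
      unfolding cheb_sum[OF w] using w by (subst powi_nat_abs) auto
    also have "\<dots> = (\<Sum>i\<le>nat \<bar>l\<bar>. f l i)" by (simp add: sum_distrib_left f_def mult_ac)
    finally show "b l / 2 * (w powi l + w powi (- l)) = (\<Sum>i\<le>nat \<bar>l\<bar>. f l i)" .
  qed auto
  have sx: "(\<lambda>l. norm (b l * of_real x powi l)) summable_on UNIV" using sm[of "of_real x"] x by simp
  define T where "T = (\<Sum>\<^sub>\<infinity>l. norm (b l * of_real x powi l))"
  have T: "((\<lambda>l. norm (b l * of_real x powi l)) has_sum T) UNIV"
    unfolding T_def using sx by (simp add: summable_iff_has_sum_infsum)
  hence T': "((\<lambda>l. norm (b l * of_real x powi (- l))) has_sum T) UNIV"
    using flip[of "\<lambda>l. norm (b l * of_real x powi l)" T] by (simp add: even)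
  have Neq: "N l = 1 / 2 * (norm (b l * of_real x powi l) + norm (b l * of_real x powi (- l)))" for l
    using x(1) by (simp add: N_def norm_mult norm_power_int algebra_simps)
  have "((\<lambda>l. 1 / 2 * (norm (b l * of_real x powi l) + norm (b l * of_real x powi (- l)))) has_sum (1 / 2 * (T + T))) UNIV"
    by (intro has_sum_cmult_right has_sum_add T T')
  moreover have "N = (\<lambda>l. 1 / 2 * (norm (b l * of_real x powi l) + norm (b l * of_real x powi (- l))))"
    by (intro ext Neq)
  ultimately have NT: "(N has_sum T) UNIV" by simp
  define S where "S = (\<Sum>\<^sub>\<infinity>l. b l * w powi l)"
  have S: "((\<lambda>l. b l * w powi l) has_sum S) UNIV"
    unfolding S_def using Infinite_Sum.abs_summable_summable[OF sm[OF w]] by (simp add: summable_iff_has_sum_infsum)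
  hence S': "((\<lambda>l. b l * w powi (- l)) has_sum S) UNIV"
    using flip[of "\<lambda>l. b l * w powi l" S] by (simp add: even)
  have "((\<lambda>l. 1 / 2 * (b l * w powi l + b l * w powi (- l))) has_sum (1 / 2 * (S + S))) UNIV"
    by (intro has_sum_cmult_right has_sum_add S S')
  moreover have "1 / 2 * (b l * w powi l + b l * w powi (- l)) = b l / 2 * (w powi l + w powi (- l))" for l
    by (simp add: algebra_simps)
  ultimately have gS: "((\<lambda>l. b l / 2 * (w powi l + w powi (- l))) has_sum S) UNIV"
    by (simp only: add_divide_distrib[symmetric]) simp
  have h: "(\<Sum>\<^sub>\<infinity>l. f l i) = s_coeff b i * s_of w ^ i" for i
    unfolding f_def s_coeff_def by (rule infsum_cmult_left')
  note F = fubini_complex[of f N, OF fN _ fg gS]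
  have sN: "N summable_on UNIV" using NT by (auto simp: summable_on_def)
  show "((\<lambda>i. s_coeff b i * s_of w ^ i) has_sum (\<Sum>\<^sub>\<infinity>l. b l * w powi l)) UNIV"
    using F(2)[OF sN] by (simp add: h S_def)
  show "(\<lambda>i. norm (s_coeff b i * s_of w ^ i)) summable_on UNIV"
    using F(3)[OF sN] by (simp only: h)
  show "(\<Sum>\<^sub>\<infinity>i. norm (s_coeff b i * s_of w ^ i)) \<le> (\<Sum>\<^sub>\<infinity>l. norm (b l * of_real x powi l))"
    using F(4)[OF sN] infsumI[OF NT] by (simp only: h T_def)
qed

lemma summable_Ints_finite:
  fixes a :: "nat \<Rightarrow> complex"
  assumes "summable a" "\<And>n. a n \<in> \<int>"
  obtains L where "\<And>n. n \<ge> L \<Longrightarrow> a n = 0"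
proof -
  have "a \<longlonglongrightarrow> 0" by (rule summable_LIMSEQ_zero[OF assms(1)])
  hence "(\<lambda>n. norm (a n)) \<longlonglongrightarrow> 0" by (rule tendsto_norm_zero)
  hence "eventually (\<lambda>n. norm (a n) < 1) sequentially" by (rule order_tendstoD) simp
  then obtain L where L: "\<And>n. n \<ge> L \<Longrightarrow> norm (a n) < 1" by (auto simp: eventually_sequentially)
  have "a n = 0" if "n \<ge> L" for n
  proof -
    obtain k where k: "a n = of_int k" using assms(2)[of n] by (elim Ints_cases)
    hence "\<bar>k\<bar> < 1" using L[OF that] by simp
    thus ?thesis using k by simp
  qed
  thus ?thesis using that by blast
qed

text \<open>Summability of integers forces finite support. Pairing l with -l then removes the factor
  1/2, and the term at 0 is integral because \<open>cheb 0\<close> is the constant 2.\<close>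

lemma s_coeff_int:
  assumes even: "\<And>l. b (- l) = b l" and sm: "b summable_on UNIV" and int: "\<And>l. b l \<in> \<int>"
  shows "s_coeff b i \<in> \<int>"
proof -
  obtain L where L: "\<And>n. n \<ge> L \<Longrightarrow> b (int n) = 0"
    using summable_Ints_finite[OF summable_on_imp_summable[OF summable_on_pos_ints(1)[OF sm]] int] by blast
  have b0: "b l = 0" if "l \<notin> {- int L..int L}" for l
  proof -
    have "b (int (nat \<bar>l\<bar>)) = 0" using that by (intro L) auto
    thus ?thesis using even[of l] by (cases "l \<ge> 0") auto
  qed
  define c where "c = (\<lambda>l. b l * of_nat (cheb_coeff (nat \<bar>l\<bar>) i) / 2)"
  have "s_coeff b i = (\<Sum>l\<in>{- int L..int L}. c l)"
    unfolding s_coeff_def c_def by (rule infsumI, rule has_sum_finite_neutralI) (auto simp: b0)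
  also have "{- int L..int L} = {0} \<union> {1..int L} \<union> {- int L..-1}" by auto
  also have "(\<Sum>l\<in>{0} \<union> {1..int L} \<union> {- int L..-1}. c l) = c 0 + (\<Sum>l\<in>{1..int L}. c l) + (\<Sum>l\<in>{- int L..-1}. c l)"
    by (subst sum.union_disjoint; auto)+
  also have "(\<Sum>l\<in>{- int L..-1}. c l) = (\<Sum>l\<in>{1..int L}. c l)"
    by (rule sum.reindex_bij_witness[of _ uminus uminus]) (auto simp: c_def even)
  also have "c 0 + (\<Sum>l\<in>{1..int L}. c l) + (\<Sum>l\<in>{1..int L}. c l) = c 0 + (\<Sum>l\<in>{1..int L}. b l * of_nat (cheb_coeff (nat \<bar>l\<bar>) i))"
    by (simp add: sum.distrib[symmetric] c_def add.assoc)
  finally have eq: "s_coeff b i = c 0 + (\<Sum>l\<in>{1..int L}. b l * of_nat (cheb_coeff (nat \<bar>l\<bar>) i))" .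
  have "cheb_coeff 0 i = (if i = 0 then 2 else 0)" by (auto simp: cheb_coeff_def cheb_def coeff_pCons split: nat.splits)
  hence "c 0 \<in> \<int>" using int[of 0] by (auto simp: c_def)
  thus ?thesis unfolding eq using int by (intro Ints_add Ints_sum Ints_mult) auto
qed

lemma s_of_eq_1: obtains w :: complex where "w \<noteq> 0" "s_of w = 1"
proof -
  obtain x :: real where x: "x > 0" "x - 2 + 1 / x = 1" using s_of_real_surj[of 1] by auto
  have "s_of (of_real x) = of_real (x - 2 + 1 / x)" by (simp add: s_of_def)
  thus ?thesis using that[of "of_real x"] x by simp
qed

text \<open>Convergence at a point with \<open>s_of w = 1\<close> forces the integers
  \<open>s_coeff b i\<close> to vanish for large i. The Laurent series is then an integral
  polynomial in \<open>s_of w\<close>, and uniqueness identifies its coefficients.\<close>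

lemma int_of_s_coeff:
  assumes even: "\<And>l. b (- l) = b l"
    and sm: "\<And>w. w \<noteq> 0 \<Longrightarrow> (\<lambda>l. norm (b l * w powi l)) summable_on UNIV"
    and int: "\<And>i. s_coeff b i \<in> \<int>"
  shows "b l \<in> \<int>"
proof -
  obtain w1 :: complex where w1: "w1 \<noteq> 0" "s_of w1 = 1" by (rule s_of_eq_1)
  obtain x1 :: real where x1: "x1 > 0" "x1 - 2 + 1 / x1 = norm (s_of w1)" using s_of_real_surj[of "norm (s_of w1)"] by auto
  have "(\<lambda>i. norm (s_coeff b i * s_of w1 ^ i)) summable_on UNIV" by (rule s_coeff_sum(2)[OF even sm w1(1) x1])
  hence "(\<lambda>i. s_coeff b i) summable_on UNIV" using Infinite_Sum.abs_summable_summable by (simp add: w1(2))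
  then obtain I where I: "\<And>i. i \<ge> I \<Longrightarrow> s_coeff b i = 0"
    using summable_Ints_finite[of "s_coeff b", OF summable_on_imp_summable int] by blast
  have sumw: "(\<Sum>\<^sub>\<infinity>l. b l * w powi l) = (\<Sum>i<I. s_coeff b i * s_of w ^ i)" if w: "w \<noteq> 0" for w
  proof -
    obtain x :: real where x: "x > 0" "x - 2 + 1 / x = norm (s_of w)" using s_of_real_surj[of "norm (s_of w)"] by auto
    have "((\<lambda>i. s_coeff b i * s_of w ^ i) has_sum (\<Sum>i<I. s_coeff b i * s_of w ^ i)) UNIV"
      by (rule has_sum_finite_neutralI[of "{..<I}"]) (auto simp: I)
    thus ?thesis using s_coeff_sum(1)[OF even sm w x] has_sum_unique by blast
  qed
  \<comment> \<open>As a polynomial in \<open>w\<close>, the i-th summand is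
    \<open>s_coeff b i * s_of w ^ i * w ^ I\<close>; multiplication by \<open>w ^ I\<close> clears
    the negative powers.\<close>
  define R where "R = (\<Sum>i<I. smult (s_coeff b i) ([:1, - 1:] ^ (2 * i) * monom 1 (I - i)))"
  have Rint: "coeff R j \<in> \<int>" for j
  proof -
    have p: "\<forall>j. coeff ([:1, - 1:] ^ n :: complex poly) j \<in> \<int>" for n
    proof (induction n)
      case (Suc n)
      thus ?case by (auto simp: coeff_mult intro!: Ints_sum Ints_mult) (auto simp: coeff_pCons split: nat.splits)
    qed (auto simp: coeff_1)
    show ?thesis unfolding R_def
      by (auto simp: coeff_sum coeff_mult coeff_monom intro!: Ints_sum Ints_mult int p[rule_format])
  qed
  have Rev: "poly R w = w ^ I * (\<Sum>\<^sub>\<infinity>l. b l * w powi l)" if w: "w \<noteq> 0" for w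
    unfolding sumw[OF w] R_def poly_sum sum_distrib_left
  proof (rule sum.cong[OF refl])
    fix i assume "i \<in> {..<I}"
    hence "w ^ I = w ^ (I - i) * w ^ i" by (simp add: power_add[symmetric])
    moreover have "s_of w ^ i * w ^ i = (1 - w) ^ (2 * i)"
      using w by (simp add: s_of_alt power_mult power_mult_distrib[symmetric])
    ultimately show "poly (smult (s_coeff b i) ([:1, - 1:] ^ (2 * i) * monom 1 (I - i))) w = w ^ I * (s_coeff b i * s_of w ^ i)"
      by (simp add: poly_monom mult_ac)
  qed
  define c where "c = (\<lambda>l. if l \<ge> 0 then coeff R (nat l) else 0)"
  have "b (l - int I) - c l = 0" for l
  proof (rule laurent_unique)
    fix w :: complex assume w: "w \<noteq> 0"
    have "((\<lambda>l. b l * w powi l) has_sum (\<Sum>\<^sub>\<infinity>l. b l * w powi l)) UNIV"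
      using Infinite_Sum.abs_summable_summable[OF sm[OF w]] by (simp add: summable_iff_has_sum_infsum)
    hence "((\<lambda>l. w ^ I * (b l * w powi l)) has_sum (w ^ I * (\<Sum>\<^sub>\<infinity>l. b l * w powi l))) UNIV"
      by (rule has_sum_cmult_right)
    also have "?this \<longleftrightarrow> ((\<lambda>l. b (l - int I) * w powi l) has_sum (poly R w)) UNIV"
      by (rule has_sum_reindex_bij_witness[of _ "\<lambda>l. l - int I" "\<lambda>l. l + int I"])
         (auto simp: Rev w power_int_add mult_ac)
    finally have 1: "((\<lambda>l. b (l - int I) * w powi l) has_sum (poly R w)) UNIV" .
    have 2: "((\<lambda>l. c l * w powi l) has_sum (poly R w)) UNIV"
    proof (rule has_sum_finite_neutralI[of "int ` {..degree R}"])
      show "c l * w powi l = 0" if "l \<in> UNIV - int ` {..degree R}" for l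
      proof (cases "l \<ge> 0")
        case True
        hence "l = int (nat l)" by simp
        hence "nat l > degree R" using that by (metis DiffD2 atMost_iff image_eqI not_le)
        thus ?thesis by (simp add: c_def coeff_eq_0)
      qed (simp add: c_def)
      show "poly R w = (\<Sum>l\<in>int ` {..degree R}. c l * w powi l)"
        by (subst sum.reindex) (auto simp: c_def poly_altdef)
    qed auto
    show "((\<lambda>l. (b (l - int I) - c l) * w powi l) has_sum 0) UNIV"
      using has_sum_add[OF 1 has_sum_cmult_right[OF 2, of "- 1"]] by (simp add: left_diff_distrib)
  qed
  from this[of "l + int I"] have "b l = c (l + int I)" by simp
  thus ?thesis using Rint by (simp add: c_def)
qed

section \<open>The Fourier expansion of a function even in \<open>z\<close>, rearranged in powers of
  \<open>s\<close>\<close>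

locale fourier_array =
  fixes f :: "nat \<Rightarrow> int \<Rightarrow> complex" and \<phi> :: "complex \<Rightarrow> complex \<Rightarrow> complex"
  assumes fourier: "\<And>\<tau> z. Im \<tau> > 0 \<Longrightarrow> ((\<lambda>(n, l). f n l * ee \<tau> ^ n * ee z powi l) has_sum \<phi> \<tau> z) UNIV"
    and even_z: "\<And>\<tau> z. Im \<tau> > 0 \<Longrightarrow> \<phi> \<tau> (- z) = \<phi> \<tau> z"
begin

lemma abs_fourier:
  assumes "q \<noteq> 0" "norm q < 1" "w \<noteq> 0"
  shows "(\<lambda>p. norm ((\<lambda>(n, l). f n l * q ^ n * w powi l) p)) summable_on (UNIV \<times> UNIV)"
proof -
  obtain \<tau> z where t: "q = ee \<tau>" "w = ee z" using ee_surj assms by metis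
  have "Im \<tau> > 0" using assms(2) pi_gt_zero by (simp add: t norm_ee zero_less_mult_iff)
  from fourier[OF this, of z] have "(\<lambda>(n, l). f n l * q ^ n * w powi l) summable_on (UNIV \<times> UNIV)"
    by (auto simp: summable_on_def t)
  thus ?thesis using summable_on_iff_abs_summable_on_complex by blast
qed

lemma abs_row: assumes w: "w \<noteq> 0" shows "(\<lambda>l. norm (f n l * w powi l)) summable_on UNIV"
proof -
  have "(\<lambda>l. norm (f n l * (1 / 2) ^ n * w powi l)) summable_on UNIV"
    using abs_fourier[of "1 / 2" w, unfolded Infinite_Sum.abs_summable_on_Sigma_iff] w by auto
  hence "(\<lambda>l. 2 ^ n * norm (f n l * (1 / 2) ^ n * w powi l)) summable_on UNIV"
    by (rule summable_on_cmult_right)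
  thus ?thesis by (simp add: norm_mult norm_power norm_divide power_divide)
qed

lemma abs_rows:
  fixes q w :: complex
  assumes "q \<noteq> 0" "norm q < 1" "w \<noteq> 0"
  shows "(\<lambda>n. norm q ^ n * (\<Sum>\<^sub>\<infinity>l. norm (f n l * w powi l))) summable_on UNIV"
proof -
  have "(\<lambda>n. norm (\<Sum>\<^sub>\<infinity>l. norm (f n l * q ^ n * w powi l))) summable_on UNIV"
    using abs_fourier[OF assms, unfolded Infinite_Sum.abs_summable_on_Sigma_iff] by simp
  hence "(\<lambda>n. \<Sum>\<^sub>\<infinity>l. norm (f n l * q ^ n * w powi l)) summable_on UNIV"
    using summable_on_iff_abs_summable_on_real by blast
  moreover have "(\<Sum>\<^sub>\<infinity>l. norm (f n l * q ^ n * w powi l)) = norm q ^ n * (\<Sum>\<^sub>\<infinity>l. norm (f n l * w powi l))" for n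
    by (subst infsum_cmult_right'[symmetric]) (simp add: norm_mult norm_power mult_ac)
  ultimately show ?thesis by simp
qed

text \<open>The difference of the expansions at \<open>z\<close> and \<open>- z\<close> is 0.
  Comparing powers of \<open>q\<close> first and powers of \<open>w\<close> afterwards shows that
  all its coefficients vanish.\<close>

lemma fourier_even: "f n (- l) = f n l"
proof -
  define g where "g = (\<lambda>n l. f n l - f n (- l))"
  have row: "((\<lambda>l. g n l * w powi l) has_sum 0) UNIV" if w: "w \<noteq> 0" for n w
  proof -
    have sg: "(\<lambda>l. g n l * w powi l) summable_on UNIV" for n
    proof -
      have 1: "(\<lambda>l. f n l * w powi l) summable_on UNIV" by (rule Infinite_Sum.abs_summable_summable[OF abs_row[OF w]])
      have "(\<lambda>l. f n (- l) * w powi l) summable_on UNIV"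
        using Infinite_Sum.abs_summable_summable[OF abs_row[of "inverse w" n]] w
        by (subst summable_on_reindex_bij_witness[of _ uminus uminus _ "\<lambda>l. f n l * inverse w powi l"])
           (auto simp: power_int_minus power_int_inverse)
      hence "(\<lambda>l. - 1 * (f n (- l) * w powi l)) summable_on UNIV" by (rule summable_on_cmult_right)
      from summable_on_add[OF 1 this] show ?thesis by (simp add: g_def left_diff_distrib)
    qed
    define h where "h = (\<lambda>n. \<Sum>\<^sub>\<infinity>l. g n l * w powi l)"
    have sh: "((\<lambda>l. g n l * w powi l) has_sum h n) UNIV" for n
      using sg by (simp add: h_def summable_iff_has_sum_infsum)
    have sum0: "((\<lambda>n. h n * q ^ n) has_sum 0) UNIV" if q: "q \<noteq> 0" "norm q < 1" for q :: complex
    proof -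
      obtain \<tau> z where t: "q = ee \<tau>" "w = ee z" using ee_surj q w by metis
      have tau: "Im \<tau> > 0" using q(2) pi_gt_zero by (simp add: t norm_ee zero_less_mult_iff)
      have 1: "((\<lambda>(n, l). f n l * q ^ n * w powi l) has_sum \<phi> \<tau> z) UNIV" using fourier[OF tau, of z] by (simp add: t)
      have "((\<lambda>(n, l). f n l * q ^ n * inverse w powi l) has_sum \<phi> \<tau> z) UNIV"
        using fourier[OF tau, of "- z"] even_z[OF tau, of z] by (simp add: t ee_minus)
      also have "?this \<longleftrightarrow> ((\<lambda>(n, l). f n (- l) * q ^ n * w powi l) has_sum \<phi> \<tau> z) UNIV"
        by (rule has_sum_reindex_bij_witness[of _ "\<lambda>(n, l). (n, - l)" "\<lambda>(n, l). (n, - l)"])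
           (auto simp: power_int_minus power_int_inverse)
      finally have 2: "((\<lambda>(n, l). f n (- l) * q ^ n * w powi l) has_sum \<phi> \<tau> z) UNIV" .
      have "((\<lambda>p. (\<lambda>(n, l). f n l * q ^ n * w powi l) p + - 1 * (\<lambda>(n, l). f n (- l) * q ^ n * w powi l) p) has_sum \<phi> \<tau> z
        + - 1 * \<phi> \<tau> z) (UNIV \<times> UNIV)"
        using has_sum_add[OF 1 has_sum_cmult_right[OF 2, of "- 1"]] unfolding UNIV_Times_UNIV .
      hence "((\<lambda>n. h n * q ^ n) has_sum \<phi> \<tau> z + - 1 * \<phi> \<tau> z) UNIV"
      proof (rule has_sum_SigmaD)
        fix n
        show "((\<lambda>l. (\<lambda>(n, l). f n l * q ^ n * w powi l) (n, l) + - 1 * (\<lambda>(n, l). f n (- l) * q ^ n * w powi l) (n, l))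
          has_sum h n * q ^ n) UNIV"
          using has_sum_cmult_left[OF sh[of n], of "q ^ n"] by (simp add: g_def algebra_simps)
      qed
      thus ?thesis by simp
    qed
    have "disc_fps (Abs_fps h)"
    proof (rule disc_fps_of_summable)
      fix r :: real assume "0 < r" "r < 1"
      thus "summable (\<lambda>n. h n * complex_of_real r ^ n)"
        using has_sum_imp_sums[OF sum0[of "of_real r"]] by (auto simp: sums_iff)
    qed
    moreover have "eval_fps (Abs_fps h) q = 0" if "norm q < 1" "q \<noteq> 0" for q
      using has_sum_imp_sums[OF sum0[OF that(2,1)]] by (simp add: eval_fps_def sums_iff)
    ultimately have "Abs_fps h = 0" by (intro disc_fps_eqI) auto
    hence "h n = 0" by (metis fps_nth_Abs_fps fps_zero_nth)
    thus ?thesis using sh[of n] by simp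
  qed
  have "g n l = 0" by (rule laurent_unique[OF row])
  thus ?thesis by (simp add: g_def)
qed

definition s_array :: "complex fps fps" where
  "s_array = Abs_fps (\<lambda>i. Abs_fps (\<lambda>n. s_coeff (f n) i))"

text \<open>The bound in \<open>s_coeff_sum\<close> controls each row by its norms at the real point
  \<open>x\<close>, and these are summable against \<open>norm q ^ n\<close>; so the sums over n and
  i may be exchanged.\<close>

lemma fourier_s:
  assumes q: "q \<noteq> 0" "norm q < 1" and w: "w \<noteq> 0"
  shows "(\<lambda>n. norm (q ^ n * (s_coeff (f n) i * s_of w ^ i))) summable_on UNIV"
    and "((\<lambda>i. \<Sum>\<^sub>\<infinity>n. q ^ n * (s_coeff (f n) i * s_of w ^ i)) has_sum (\<Sum>\<^sub>\<infinity>n. q ^ n * (\<Sum>\<^sub>\<infinity>l. f n l * w powi l))) UNIV"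
proof -
  obtain x :: real where x: "x > 0" "x - 2 + 1 / x = norm (s_of w)" using s_of_real_surj[of "norm (s_of w)"] by auto
  note S = s_coeff_sum[OF fourier_even abs_row w x]
  define N where "N = (\<lambda>n. norm q ^ n * (\<Sum>\<^sub>\<infinity>i. norm (s_coeff (f n) i * s_of w ^ i)))"
  have fN: "((\<lambda>i. norm (q ^ n * (s_coeff (f n) i * s_of w ^ i))) has_sum N n) UNIV" for n
  proof -
    have "((\<lambda>i. norm (s_coeff (f n) i * s_of w ^ i)) has_sum (\<Sum>\<^sub>\<infinity>i. norm (s_coeff (f n) i * s_of w ^ i))) UNIV"
      using S(2)[of n] by (simp add: summable_iff_has_sum_infsum)
    from has_sum_cmult_right[OF this, of "norm q ^ n"] show ?thesis by (simp add: N_def norm_mult norm_power)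
  qed
  have sN: "N summable_on UNIV"
  proof (rule summable_on_comparison_test)
    show "(\<lambda>n. norm q ^ n * (\<Sum>\<^sub>\<infinity>l. norm (f n l * of_real x powi l))) summable_on UNIV"
      using abs_rows[OF q, of "of_real x"] x by simp
    show "N n \<le> norm q ^ n * (\<Sum>\<^sub>\<infinity>l. norm (f n l * of_real x powi l))" for n
      unfolding N_def by (intro mult_left_mono S(3)) auto
    show "0 \<le> N n" for n unfolding N_def by (intro mult_nonneg_nonneg infsum_nonneg) auto
  qed
  have fg: "((\<lambda>i. q ^ n * (s_coeff (f n) i * s_of w ^ i)) has_sum q ^ n * (\<Sum>\<^sub>\<infinity>l. f n l * w powi l)) UNIV" for n
    by (rule has_sum_cmult_right[OF S(1)])
  have gS: "((\<lambda>n. q ^ n * (\<Sum>\<^sub>\<infinity>l. f n l * w powi l)) has_sum (\<Sum>\<^sub>\<infinity>n. q ^ n * (\<Sum>\<^sub>\<infinity>l. f n l * w powi l))) UNIV"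
  proof -
    have "(\<lambda>n. norm (q ^ n * (\<Sum>\<^sub>\<infinity>l. f n l * w powi l))) summable_on UNIV"
    proof (rule summable_on_comparison_test[OF abs_rows[OF q w]])
      show "norm (q ^ n * (\<Sum>\<^sub>\<infinity>l. f n l * w powi l)) \<le> norm q ^ n * (\<Sum>\<^sub>\<infinity>l. norm (f n l * w powi l))" for n
        unfolding norm_mult[of "q ^ n"] norm_power by (intro mult_left_mono norm_infsum_bound abs_row w) auto
    qed auto
    from Infinite_Sum.abs_summable_summable[OF this] show ?thesis by (simp add: summable_iff_has_sum_infsum)
  qed
  show "(\<lambda>n. norm (q ^ n * (s_coeff (f n) i * s_of w ^ i))) summable_on UNIV"
    by (rule fubini_complex(1)[OF fN sN fg gS])
  show "((\<lambda>i. \<Sum>\<^sub>\<infinity>n. q ^ n * (s_coeff (f n) i * s_of w ^ i)) has_sum (\<Sum>\<^sub>\<infinity>n. q ^ n * (\<Sum>\<^sub>\<infinity>l. f n l * w powi l))) UNIV"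
    by (rule fubini_complex(2)[OF fN sN fg gS])
qed

text \<open>A point with \<open>s_of w = 1\<close> removes the power of \<open>s\<close> and
  isolates one coefficient.\<close>

lemma s_array_sums: "q \<noteq> 0 \<Longrightarrow> norm q < 1 \<Longrightarrow> ((\<lambda>n. s_coeff (f n) i * q ^ n) has_sum eval_fps (fps_nth s_array i) q) UNIV"
proof -
  assume q: "q \<noteq> 0" "norm q < 1"
  obtain w where w: "w \<noteq> 0" "s_of w = 1" by (rule s_of_eq_1)
  have "(\<lambda>n. norm (q ^ n * (s_coeff (f n) i * s_of w ^ i))) summable_on UNIV" by (rule fourier_s(1)[OF q w(1)])
  hence "(\<lambda>n. s_coeff (f n) i * q ^ n) summable_on UNIV"
    using Infinite_Sum.abs_summable_summable by (simp add: w(2) mult.commute)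
  then obtain S where S: "((\<lambda>n. s_coeff (f n) i * q ^ n) has_sum S) UNIV" by (auto simp: summable_on_def)
  have "S = eval_fps (fps_nth s_array i) q"
    using has_sum_imp_sums[OF S] by (simp add: eval_fps_def s_array_def sums_iff)
  thus ?thesis using S by simp
qed

lemma disc_fps2_s_array: "disc_fps2 s_array"
  unfolding disc_fps2_def
proof
  fix i
  have "disc_fps (Abs_fps (\<lambda>n. s_coeff (f n) i))"
  proof (rule disc_fps_of_summable)
    fix r :: real assume "0 < r" "r < 1"
    thus "summable (\<lambda>n. s_coeff (f n) i * complex_of_real r ^ n)"
      using has_sum_imp_sums[OF s_array_sums[of "of_real r" i]] by (auto simp: sums_iff)
  qed
  thus "disc_fps (fps_nth s_array i)" by (simp add: s_array_def)
qed

lemma s_array_eval: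
  assumes tau: "Im \<tau> > 0"
  shows "((\<lambda>i. eval_fps (fps_nth s_array i) (ee \<tau>) * s_at z ^ i) has_sum \<phi> \<tau> z) UNIV"
proof -
  let ?q = "ee \<tau>" and ?w = "ee z"
  have q: "?q \<noteq> 0" "norm ?q < 1" using norm_ee_less_1[OF tau] by auto
  have 1: "(\<Sum>\<^sub>\<infinity>n. ?q ^ n * (s_coeff (f n) i * s_of ?w ^ i)) = eval_fps (fps_nth s_array i) ?q * s_at z ^ i" for i
  proof -
    have "((\<lambda>n. s_coeff (f n) i * ?q ^ n * s_at z ^ i) has_sum eval_fps (fps_nth s_array i) ?q * s_at z ^ i) UNIV"
      by (rule has_sum_cmult_left[OF s_array_sums[OF q]])
    thus ?thesis by (intro infsumI) (simp add: s_at_def mult_ac)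
  qed
  have "((\<lambda>(n, l). f n l * ?q ^ n * ?w powi l) has_sum \<phi> \<tau> z) (UNIV \<times> UNIV)" using fourier[OF tau] by simp
  hence "((\<lambda>n. ?q ^ n * (\<Sum>\<^sub>\<infinity>l. f n l * ?w powi l)) has_sum \<phi> \<tau> z) UNIV"
  proof (rule has_sum_SigmaD)
    fix n
    have "((\<lambda>l. f n l * ?w powi l) has_sum (\<Sum>\<^sub>\<infinity>l. f n l * ?w powi l)) UNIV"
      using Infinite_Sum.abs_summable_summable[OF abs_row[of ?w n]] by (simp add: summable_iff_has_sum_infsum)
    from has_sum_cmult_right[OF this, of "?q ^ n"]
    show "((\<lambda>l. (\<lambda>(n, l). f n l * ?q ^ n * ?w powi l) (n, l)) has_sum ?q ^ n * (\<Sum>\<^sub>\<infinity>l. f n l * ?w powi l)) UNIV"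
      by (simp add: mult_ac)
  qed
  hence "(\<Sum>\<^sub>\<infinity>n. ?q ^ n * (\<Sum>\<^sub>\<infinity>l. f n l * ?w powi l)) = \<phi> \<tau> z" by (rule infsumI)
  thus ?thesis using fourier_s(2)[OF q, of ?w] by (simp add: 1)
qed

text \<open>The series in \<open>s\<close> converges at \<open>s = 1\<close>, so its radius of
  convergence is positive for every \<tau>.\<close>

lemma local_exp_s_array: "local_exp \<phi> s_array"
  unfolding local_exp_def
proof (intro conjI disc_fps2_s_array allI impI)
  fix \<tau> :: complex assume tau: "Im \<tau> > 0"
  obtain w :: complex where w: "w \<noteq> 0" "s_of w = 1" by (rule s_of_eq_1)
  obtain z where z: "w = ee z" using ee_surj[OF w(1)] by metis
  have "summable (\<lambda>i. eval_fps (fps_nth s_array i) (ee \<tau>) * 1 ^ i)"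
    using has_sum_imp_sums[OF s_array_eval[OF tau, of z]] w(2) by (auto simp: sums_iff s_at_def z)
  hence "conv_radius (fps_nth (eval_q (ee \<tau>) s_array)) \<ge> norm (1::complex)"
    by (intro conv_radius_geI) simp
  hence "fps_conv_radius (eval_q (ee \<tau>) s_array) > 0"
    unfolding fps_conv_radius_def by (rule less_le_trans[rotated]) simp
  hence "eval_fps (eval_q (ee \<tau>) s_array) has_fps_expansion eval_q (ee \<tau>) s_array" by (rule eval_fps_has_fps_expansion)
  moreover have "\<phi> \<tau> z = eval_fps (eval_q (ee \<tau>) s_array) (s_at z)" for z
    using has_sum_imp_sums[OF s_array_eval[OF tau, of z]] by (simp add: eval_fps_def sums_iff)
  ultimately show "\<exists>F. F has_fps_expansion eval_q (ee \<tau>) s_array \<and> eventually (\<lambda>z. \<phi> \<tau> z = F (s_at z)) (at 0)" by auto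
qed

lemma int_s_array:
  assumes "\<And>n l. ereal (real n) \<le> N \<Longrightarrow> f n l \<in> \<int>" shows "int_upto2 N s_array"
  unfolding int_upto2_def int_upto_def
proof (intro allI impI)
  fix i n assume n: "ereal (real n) \<le> N"
  have "f n summable_on UNIV" using Infinite_Sum.abs_summable_summable[OF abs_row[of 1 n]] by simp
  thus "fps_nth (fps_nth s_array i) n \<in> \<int>"
    using s_coeff_int[of "f n" i, OF fourier_even _ assms[OF n]] by (simp add: s_array_def)
qed

lemma int_fourier:
  assumes "int_upto2 \<infinity> s_array" shows "f n l \<in> \<int>"
proof (rule int_of_s_coeff[OF fourier_even abs_row])
  show "s_coeff (f n) i \<in> \<int>" for i using assms by (auto simp: int_upto2_def int_upto_def s_array_def)
qed

end

theorem theorem3p2: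
  fixes k :: int and m :: nat
    and \<phi> :: "complex \<Rightarrow> complex \<Rightarrow> complex"
    and f :: "nat \<Rightarrow> int \<Rightarrow> complex"
  assumes "weak_jacobi_form (2 * k) m \<phi>"
    and "jacobi_fourier_expansion \<phi> f"
    and "\<forall>n l. int n \<le> \<lfloor>real_of_int (int m + k) / 6\<rfloor> \<longrightarrow> f n l \<in> \<int>"
  shows "\<forall>n l. f n l \<in> \<int>"
proof -
  have hol2: "holomorphic2_on (\<lambda>(\<tau>, z). \<phi> \<tau> z) (upper_half_plane \<times> UNIV)"
    and modular: "\<And>a b c d :: int. \<And>\<tau> z. a * d - b * c = 1 \<Longrightarrow> Im \<tau> > 0 \<Longrightarrow>
           \<phi> ((of_int a * \<tau> + of_int b) / (of_int c * \<tau> + of_int d)) (z / (of_int c * \<tau> + of_int d)) =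
             (of_int c * \<tau> + of_int d) powi (2 * k)
             * exp (2 * pi * \<i> * of_nat m * (of_int c * z\<^sup>2 / (of_int c * \<tau> + of_int d)))
             * \<phi> \<tau> z"
    and elliptic: "\<And>x y :: int. \<And>\<tau> z. Im \<tau> > 0 \<Longrightarrow>
        \<phi> \<tau> (z + of_int x * \<tau> + of_int y) =
          exp (- 2 * pi * \<i> * of_nat m * ((of_int x)\<^sup>2 * \<tau> + 2 * of_int x * z)) * \<phi> \<tau> z"
    using assms(1) unfolding weak_jacobi_form_def upper_half_plane_def by blast+
  have ee_m: "ee u ^ m = exp (2 * of_real pi * \<i> * of_nat m * u)" for u
    unfolding ee_of_nat_mult[symmetric] by (simp add: ee_def mult_ac)
  have even_z: "\<phi> \<tau> (- z) = \<phi> \<tau> z" if "Im \<tau> > 0" for \<tau> z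
    \<comment> \<open>Instantiation follows the order of occurrence a, d, b, c. The matrix is minus
      the identity: it fixes \<tau>, negates \<open>z\<close>, and its automorphy factor is 1
      because the weight is even.\<close>
    using modular[of "- 1" "- 1" 0 0 \<tau> z] that by (simp add: power_int_minus_left)
  have S: "\<phi> (- 1 / \<tau>) (z / \<tau>) = \<tau> powi (2 * k) * ee (z\<^sup>2 / \<tau>) ^ m * \<phi> \<tau> z" if "Im \<tau> > 0" for \<tau> z
    \<comment> \<open>In the same order, this is the matrix with rows (0, -1) and (1, 0).\<close>
    using modular[of 0 0 "- 1" 1 \<tau> z] that by (simp add: ee_m)
  have per1: "\<phi> \<tau> (z + 1) = \<phi> \<tau> z" if "Im \<tau> > 0" for \<tau> z
    using elliptic[of \<tau> z 0 1] that by simp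
  have pert: "\<phi> \<tau> (z + \<tau>) = \<phi> \<tau> z * ee (- \<tau> - 2 * z) ^ m" if "Im \<tau> > 0" for \<tau> z
  proof -
    have "exp (- 2 * pi * \<i> * of_nat m * ((of_int 1)\<^sup>2 * \<tau> + 2 * of_int 1 * z)) = ee (- \<tau> - 2 * z) ^ m"
      unfolding ee_m by (intro arg_cong[where f = exp]) (simp add: algebra_simps)
    thus ?thesis using elliptic[of \<tau> z 1 0] that by (simp add: mult.commute)
  qed
  have hol: "\<phi> \<tau> holomorphic_on A" if tau: "Im \<tau> > 0" for \<tau> A
  proof -
    have "\<phi> \<tau> field_differentiable (at z)" for z
    proof -
      obtain a b where d: "((\<lambda>(\<tau>, z). \<phi> \<tau> z) has_derivative (\<lambda>(u, v). a * u + b * v)) (at (\<tau>, z) within upper_half_plane \<times> UNIV)"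
        using hol2 tau unfolding holomorphic2_on_def upper_half_plane_def by force
      have pd: "(Pair \<tau> has_derivative (\<lambda>v. (0, v))) (at z)" by (auto intro!: derivative_eq_intros)
      have sub: "range (Pair \<tau>) \<subseteq> upper_half_plane \<times> UNIV" using tau by (auto simp: upper_half_plane_def)
      have "((\<lambda>z. (\<lambda>(\<tau>, z). \<phi> \<tau> z) (\<tau>, z)) has_derivative (\<lambda>v. (\<lambda>(u, v). a * u + b * v) (0, v))) (at z)"
        by (rule has_derivative_in_compose[OF pd has_derivative_subset[OF d sub]])
      hence "(\<phi> \<tau> has_derivative (\<lambda>v. b * v)) (at z)" by simp
      hence "(\<phi> \<tau> has_field_derivative b) (at z)" by (simp add: has_field_derivative_def)
      thus ?thesis by (auto simp: field_differentiable_def)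
    qed
    thus ?thesis by (simp add: holomorphic_on_def field_differentiable_at_within)
  qed
  interpret fourier_array f \<phi>
  proof
    show "((\<lambda>(n, l). f n l * ee \<tau> ^ n * ee z powi l) has_sum \<phi> \<tau> z) UNIV" if "Im \<tau> > 0" for \<tau> z
      using assms(2) that unfolding jacobi_fourier_expansion_def upper_half_plane_def ee_def by simp
  qed (rule even_z)
  obtain Q where Q: "degree Q \<le> m" "disc_poly Q" "\<And>N. int_upto2 N s_array \<Longrightarrow> int_poly N Q"
    "\<And>\<tau> z. Im \<tau> > 0 \<Longrightarrow> z \<notin> Lattice \<tau> \<Longrightarrow> \<phi> \<tau> z = phi21 \<tau> z ^ m * poly (eval_q_poly (ee \<tau>) Q) (wp0 \<tau> z)"
    using elliptic_structure[OF hol per1 pert local_exp_s_array] by blast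
  obtain R where R: "jacobi_poly (2 * k) m R" "shift_poly R = Q"
    using modular_structure[OF Q(1,2,4) S] by blast
  define N where "N = ereal (real_of_int (2 * k + 2 * int m) / 12)"
  have "int_upto2 N s_array"
  proof (rule int_s_array)
    fix n l assume "ereal (real n) \<le> N"
    hence "real n \<le> real_of_int (int m + k) / 6" by (simp add: N_def field_simps)
    hence "int n \<le> \<lfloor>real_of_int (int m + k) / 6\<rfloor>" by (simp add: le_floor_iff)
    thus "f n l \<in> \<int>" using assms(3) by blast
  qed
  hence "int_poly N (shift_poly R)" using Q(3) R(2) by simp
  hence "int_poly \<infinity> Q" using jacobi_poly_integral[OF R(1)] R(2) by (simp add: N_def)
  \<comment> \<open>The way back: the integral polynomial gives an integral expansion of \<phi>,
    which uniqueness identifies with \<open>s_array\<close>.\<close>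
  then obtain B where "local_exp \<phi> B" "int_upto2 \<infinity> B" using local_exp_of_poly[OF Q(1,2) _ Q(4)] by blast
  hence "int_upto2 \<infinity> s_array" using local_exp_unique[OF local_exp_s_array] by blast
  thus ?thesis using int_fourier by blast
qed

end
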